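(* Let $N$ be a finitely presented graded left $\mathbf{A}$-module. The Hilbert series $\mathrm{HS}_N(t)=\sum_i \dim_{\mathbb{F}_p}([N]_i)\,t^i$ of $N$ is a rational function of the form $$\mathrm{HS}_N(t)=\frac{a(t)}{(1-t)^d\,g_{p,n}(t)},$$ where $a(t)$ is a Laurent polynomial with integer coefficients, $g_{p,n}(t)=1-t(1+t+\cdots+t^{p-1})^n$, and $d$ is the Krull dimension of the $R$-module $C_N=\mathrm{Coker}(\Theta_N)$ (in particular, $0\le d\le n$). If $d>0$, then $a(1)>0$.
   Context: Fix a prime $p$ and an integer $n\ge 1$. Let $R=\mathbb{F}_p[x_1,\ldots,x_n]$ and let $\mathbf{A}=R\{f\}/(x_i^pf \mid 1\le i\le n)$, i.e. the quotient of the free noncommutative $\mathbb{F}_p$-algebra on $x_1,\ldots,x_n,f$ by the two-sided ideal generated by $x_ix_j-x_jx_i$ and $x_i^pf$ for all $1\le i,j\le n$. It is graded with $\deg(x_i)=\deg(f)=1$, and $R$ is a graded subring. $[N]_i$ denotes the $i$th graded component of a graded module $N$, and $N(j)$ the twist with $[N(j)]_i=[N]_{i+j}$. Let $\mathbb{N}^n_{<p}$ be the set of $v\in\mathbb{N}^n$ with $0\le v_i<p$ for all $i$, and $|v|=v_1+\cdots+v_n$. For a graded left $\mathbf{A}$-module $N$, let $\mathcal{F}_{\mathbf{A}}(N)=\bigoplus_{v\in\mathbb{N}^n_{<p}}N(-|v|-1)\varepsilon_v$ with $\varepsilon_v$ formal basis symbols, made into a graded $R$-module by $x_i\cdot(g\varepsilon_v)=g\varepsilon_{v+e_i}$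 if $v_i<p-1$ and $x_i\cdot(g\varepsilon_v)=0$ if $v_i=p-1$ ($e_i$ is the $i$th standard basis vector). The structure morphism $\Theta_N:\mathcal{F}_{\mathbf{A}}(N)\to N$ is the homogeneous $R$-linear map with $\Theta_N(g\varepsilon_v)=x^vfg$. By convention the zero module has Krull dimension $0$. *)

theory Defs
  imports
    "Berlekamp_Zassenhaus.Finite_Field"
    "HOL-Algebra.QuotRing"
    "HOL-Algebra.Module"
    "HOL-Computational_Algebra.Formal_Laurent_Series"
    "HOL-Library.Extended_Nat"
    "HOL-Library.Poly_Mapping"
begin

text \<open>
  Throughout, \<open>p = CARD('p)\<close> is the prime, \<open>\<bbbF>\<^sub>p\<close> is the type \<open>'p mod_ring\<close>, and the variables are
  indexed by the finite type \<open>'n\<close>, so that \<open>n = CARD('n) \<ge> 1\<close>.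
\<close>

hide_const (open) Multiset.mult Polynomial.smult

alias lookup = Poly_Mapping.lookup
alias keys = Poly_Mapping.keys
alias single = Poly_Mapping.single

section \<open>The free algebra on the \<open>x\<^sub>i\<close> and \<open>f\<close>\<close>

text \<open>Lists under concatenation as a copy of the list type so that no instance is put on lists.\<close>

datatype 'a free_monoid = Word (letters: "'a list")

instantiation free_monoid :: (type) monoid_add
begin

definition zero_free_monoid :: "'a free_monoid" where
  "0 = Word []"

definition plus_free_monoid :: "'a free_monoid \<Rightarrow> 'a free_monoid \<Rightarrow> 'a free_monoid" where
  "u + v = Word (letters u @ letters v)"

instance
  by standard (simp_all add: zero_free_monoid_def plus_free_monoid_def)

end

datatype 'n generator = GenX 'n | GenF

text \<open>The product of finitely supported functions on words is convolution with respect to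
  concatenation, which makes this type the free algebra.\<close>

type_synonym ('p, 'n) free_algebra = "'n generator free_monoid \<Rightarrow>\<^sub>0 'p mod_ring"

definition free_gen :: "'n generator \<Rightarrow> ('p::prime_card, 'n) free_algebra" where
  "free_gen s = single (Word [s]) 1"

text \<open>A type-class ring as an object of \<open>HOL-Algebra\<close>.\<close>

definition ring_of_class :: "'a::ring_1 ring" where
  "ring_of_class = \<lparr>carrier = UNIV, mult = (*), one = 1, zero = 0, add = (+)\<rparr>"

lemma ring_of_class_simps [simp]:
  "carrier ring_of_class = UNIV" "mult ring_of_class = (*)" "one ring_of_class = 1"
  "zero ring_of_class = 0" "add ring_of_class = (+)"
  by (simp_all add: ring_of_class_def)

lemma abelian_group_ring_of_class: "abelian_group (ring_of_class :: 'a::ring_1 ring)"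
proof (rule abelian_groupI)
  fix x :: 'a
  show "\<exists>y\<in>carrier ring_of_class. y \<oplus>\<^bsub>ring_of_class\<^esub> x = \<zero>\<^bsub>ring_of_class\<^esub>"
    by (auto intro: exI[of _ "- x"])
qed (auto simp: algebra_simps)

lemma ring_ring_of_class: "ring (ring_of_class :: 'a::ring_1 ring)"
  by (rule ringI[OF abelian_group_ring_of_class])
     (auto intro!: Group.monoidI simp: algebra_simps)

lemma cring_ring_of_class: "cring (ring_of_class :: 'a::comm_ring_1 ring)"
  by (rule cringI[OF abelian_group_ring_of_class])
     (auto intro!: comm_monoidI simp: algebra_simps)

section \<open>The algebra \<open>A\<close>\<close>

definition alg_relations :: "('p::prime_card, 'n) free_algebra set" where
  "alg_relations =
     {free_gen (GenX i) * free_gen (GenX j) - free_gen (GenX j) * free_gen (GenX i) | i j. True} \<union>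
     {free_gen (GenX i) ^ CARD('p) * free_gen GenF | i. True}"

definition alg_ideal :: "('p::prime_card, 'n) free_algebra set" where
  "alg_ideal = genideal ring_of_class alg_relations"

lemma ideal_alg_ideal: "ideal alg_ideal ring_of_class"
  unfolding alg_ideal_def by (rule ring.genideal_ideal[OF ring_ring_of_class]) simp

lemma alg_relations_subset: "alg_relations \<subseteq> alg_ideal"
  unfolding alg_ideal_def by (rule ring.genideal_self[OF ring_ring_of_class]) simp

lemma alg_ideal_zero: "0 \<in> alg_ideal"
  using additive_subgroup.zero_closed[OF ideal.axioms(1)[OF ideal_alg_ideal]] by simp

lemma alg_ideal_add: "a \<in> alg_ideal \<Longrightarrow> b \<in> alg_ideal \<Longrightarrow> a + b \<in> alg_ideal"
  using additive_subgroup.a_closed[OF ideal.axioms(1)[OF ideal_alg_ideal]] by force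

lemma alg_ideal_mult_left: "a \<in> alg_ideal \<Longrightarrow> x * a \<in> alg_ideal"
  using ideal.I_l_closed[OF ideal_alg_ideal] by force

lemma alg_ideal_mult_right: "a \<in> alg_ideal \<Longrightarrow> a * x \<in> alg_ideal"
  using ideal.I_r_closed[OF ideal_alg_ideal] by force

lemma alg_ideal_uminus: "a \<in> alg_ideal \<Longrightarrow> - a \<in> alg_ideal"
  using alg_ideal_mult_left[of a "- 1"] by simp

definition alg_rel :: "('p::prime_card, 'n) free_algebra \<Rightarrow> ('p, 'n) free_algebra \<Rightarrow> bool" where
  "alg_rel a b \<longleftrightarrow> a - b \<in> alg_ideal"

lemma equivp_alg_rel: "equivp alg_rel"
proof (rule equivpI)
  show "reflp alg_rel" by (auto intro: reflpI simp: alg_rel_def alg_ideal_zero)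
  show "symp alg_rel"
    by (rule sympI) (use alg_ideal_uminus in \<open>force simp: alg_rel_def\<close>)
  show "transp alg_rel"
    by (rule transpI) (use alg_ideal_add in \<open>fastforce simp: alg_rel_def\<close>)
qed

quotient_type (overloaded) ('p, 'n) frob_alg = "('p::prime_card, 'n) free_algebra" / alg_rel
  morphisms rep_alg alg_class
  by (rule equivp_alg_rel)

instantiation frob_alg :: (prime_card, type) "{plus, minus, uminus, zero, one, times}"
begin

lift_definition zero_frob_alg :: "('a, 'b) frob_alg" is 0 .

lift_definition one_frob_alg :: "('a, 'b) frob_alg" is 1 .

lift_definition plus_frob_alg :: "('a, 'b) frob_alg \<Rightarrow> ('a, 'b) frob_alg \<Rightarrow> ('a, 'b) frob_alg" is "(+)"
  unfolding alg_rel_def using alg_ideal_add by (metis add_diff_add)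

lift_definition uminus_frob_alg :: "('a, 'b) frob_alg \<Rightarrow> ('a, 'b) frob_alg" is uminus
  unfolding alg_rel_def using alg_ideal_uminus by (metis minus_diff_minus)

lift_definition minus_frob_alg :: "('a, 'b) frob_alg \<Rightarrow> ('a, 'b) frob_alg \<Rightarrow> ('a, 'b) frob_alg" is "(-)"
proof -
  fix a b c d :: "('a, 'b) free_algebra"
  assume "alg_rel a b" "alg_rel c d"
  then have "(a - b) + - (c - d) \<in> alg_ideal"
    unfolding alg_rel_def by (intro alg_ideal_add alg_ideal_uminus)
  then show "alg_rel (a - c) (b - d)" by (simp add: alg_rel_def algebra_simps)
qed

lift_definition times_frob_alg :: "('a, 'b) frob_alg \<Rightarrow> ('a, 'b) frob_alg \<Rightarrow> ('a, 'b) frob_alg" is "(*)"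
proof -
  fix a b c d :: "('a, 'b) free_algebra"
  assume "alg_rel a b" "alg_rel c d"
  then have "(a - b) * c + b * (c - d) \<in> alg_ideal"
    unfolding alg_rel_def by (intro alg_ideal_add alg_ideal_mult_left alg_ideal_mult_right)
  then show "alg_rel (a * c) (b * d)" by (simp add: alg_rel_def algebra_simps)
qed

instance ..

end

text \<open>\<open>0 \<noteq> 1\<close> holds because the augmentation sending all generators to \<open>0\<close> kills the ideal.\<close>

lemma free_monoid_add_eq_zero: "(u + v = 0) = (u = 0 \<and> v = (0 :: 'a free_monoid))"
  by (cases u; cases v) (simp add: plus_free_monoid_def zero_free_monoid_def)

lemma lookup_mult_word_zero:
  fixes a b :: "'a free_monoid \<Rightarrow>\<^sub>0 'b::semiring_0"
  shows "lookup (a * b) 0 = lookup a 0 * lookup b 0"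
proof -
  have "Sum_any (\<lambda>l. lookup a l * Sum_any (\<lambda>q. lookup b q when 0 = l + q))
      = Sum_any (\<lambda>l. lookup a l * lookup b 0 when l = 0)"
  proof (rule Sum_any.cong)
    fix l :: "'a free_monoid"
    have "Sum_any (\<lambda>q. lookup b q when 0 = l + q) = Sum_any (\<lambda>q. (lookup b q when l = 0) when q = 0)"
      by (rule Sum_any.cong) (use free_monoid_add_eq_zero[of l] in \<open>auto simp: when_def\<close>)
    then show "lookup a l * Sum_any (\<lambda>q. lookup b q when 0 = l + q) = (lookup a l * lookup b 0 when l = 0)"
      by (simp add: when_def)
  qed
  then show ?thesis by (simp add: lookup_mult)
qed

lemma lookup_free_gen_zero: "lookup (free_gen s) 0 = 0"
  by (simp add: free_gen_def lookup_single zero_free_monoid_def)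

lemma alg_ideal_lookup_zero:
  fixes a :: "('p::prime_card, 'n) free_algebra"
  shows "a \<in> alg_ideal \<Longrightarrow> lookup a 0 = 0"
proof -
  let ?K = "{a :: ('p, 'n) free_algebra. lookup a 0 = 0}"
  have "ideal ?K ring_of_class"
  proof (rule idealI[OF ring_ring_of_class])
    show "subgroup ?K (add_monoid (ring_of_class :: ('p, 'n) free_algebra ring))"
    proof (rule group.subgroupI)
      show "group (add_monoid (ring_of_class :: ('p, 'n) free_algebra ring))"
        using abelian_group.a_group[OF abelian_group_ring_of_class] .
      show "?K \<noteq> {}" by (auto intro: exI[of _ 0])
      fix a :: "('p, 'n) free_algebra" assume "a \<in> ?K"
      moreover have "inv\<^bsub>add_monoid ring_of_class\<^esub> a = - a"
        by (rule group.inv_equality)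
           (use abelian_group.a_group[OF abelian_group_ring_of_class] in auto)
      ultimately show "inv\<^bsub>add_monoid ring_of_class\<^esub> a \<in> ?K" by simp
    qed (auto simp: lookup_add)
  qed (auto simp: lookup_mult_word_zero)
  moreover have "alg_relations \<subseteq> ?K"
    by (auto simp: alg_relations_def lookup_minus lookup_mult_word_zero lookup_free_gen_zero)
  ultimately have "alg_ideal \<subseteq> ?K"
    unfolding alg_ideal_def genideal_def by blast
  then show "a \<in> alg_ideal \<Longrightarrow> lookup a 0 = 0" by blast
qed

instance frob_alg :: (prime_card, type) ring_1
proof
  show "(0 :: ('a, 'b) frob_alg) \<noteq> 1"
  proof (transfer, rule notI)
    assume "alg_rel (0 :: ('a, 'b) free_algebra) 1"
    then show False
      using alg_ideal_lookup_zero[of "0 - 1 :: ('a, 'b) free_algebra"]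
      by (simp add: alg_rel_def lookup_minus)
  qed
qed (transfer; simp add: alg_rel_def algebra_simps alg_ideal_zero)+

definition alg_gen :: "'n generator \<Rightarrow> ('p::prime_card, 'n) frob_alg" where
  "alg_gen s = alg_class (free_gen s)"

abbreviation alg_x :: "'n \<Rightarrow> ('p::prime_card, 'n) frob_alg" where
  "alg_x i \<equiv> alg_gen (GenX i)"

abbreviation alg_f :: "('p::prime_card, 'n) frob_alg" where
  "alg_f \<equiv> alg_gen GenF"

definition alg_const :: "'p::prime_card mod_ring \<Rightarrow> ('p, 'n) frob_alg" where
  "alg_const c = alg_class (single 0 c)"

definition alg_deg :: "nat \<Rightarrow> ('p::prime_card, 'n) frob_alg set" where
  "alg_deg k = alg_class ` {a. \<forall>w\<in>keys a. length (letters w) = k}"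


lemma alg_class_add: "alg_class (a + b) = alg_class a + alg_class b"
  by (simp add: plus_frob_alg.abs_eq)

lemma alg_class_mult: "alg_class (a * b) = alg_class a * alg_class b"
  by (simp add: times_frob_alg.abs_eq)

lemma alg_class_one: "alg_class 1 = 1"
  by (simp add: one_frob_alg.abs_eq)

lemma alg_class_zero: "alg_class 0 = 0"
  by (simp add: zero_frob_alg.abs_eq)

lemma alg_class_power: "alg_class (a ^ k) = alg_class a ^ k"
  by (induction k) (simp_all add: alg_class_mult alg_class_one)

lemma alg_class_eqI: "a - b \<in> alg_ideal \<Longrightarrow> alg_class a = alg_class b"
  by (simp add: frob_alg.abs_eq_iff alg_rel_def)

lemma alg_x_commute: "alg_x i * alg_x j = alg_x j * (alg_x i :: ('p::prime_card, 'n) frob_alg)"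
  unfolding alg_gen_def alg_class_mult[symmetric]
  by (rule alg_class_eqI, rule subsetD[OF alg_relations_subset]) (auto simp: alg_relations_def)

lemma alg_x_power_f: "alg_x i ^ CARD('p) * alg_f = (0 :: ('p::prime_card, 'n) frob_alg)"
  unfolding alg_gen_def alg_class_mult[symmetric] alg_class_power[symmetric] alg_class_zero[symmetric]
  by (rule alg_class_eqI, rule subsetD[OF alg_relations_subset]) (auto simp: alg_relations_def)

lemma poly_mapping_additive_induct [case_names zero single add]:
  assumes "P 0" "\<And>k c. P (single k c)" "\<And>a b. P a \<Longrightarrow> P b \<Longrightarrow> P (a + b)"
  shows "P (a :: 'k \<Rightarrow>\<^sub>0 'b::comm_monoid_add)"
proof (induction a rule: update_induct)
  case (update f k c)
  have "Poly_Mapping.update k c f = f + single k c"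
    using update(1)
    by (intro poly_mapping_eqI) (auto simp: lookup_update lookup_add lookup_single when_def in_keys_iff)
  then show ?case using assms update by simp
qed (rule assms)

lemma alg_const_add: "alg_const (c + d) = alg_const c + alg_const d"
  by (simp add: alg_const_def single_add alg_class_add)

lemma alg_const_zero [simp]: "alg_const 0 = 0"
  by (simp add: alg_const_def alg_class_zero)

lemma alg_const_one [simp]: "alg_const 1 = 1"
  by (simp add: alg_const_def alg_class_one)

lemma alg_const_mult: "alg_const (c * d) = alg_const c * alg_const d"
  by (simp add: alg_const_def mult_single flip: alg_class_mult)

lemma alg_const_central: "alg_const c * a = a * alg_const c"
proof -
  have "single 0 c * b = b * single 0 c" for b :: "('a, 'b) free_algebra"
    by (induction b rule: poly_mapping_additive_induct)
       (simp_all add: mult_single mult.commute algebra_simps)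
  then show ?thesis
    by (induction a) (simp add: alg_const_def flip: alg_class_mult)
qed

section \<open>\<open>R\<close> and its map to \<open>A\<close>\<close>

type_synonym ('p, 'n) poly_ring = "('n \<Rightarrow>\<^sub>0 nat) \<Rightarrow>\<^sub>0 'p mod_ring"

text \<open>The product of the \<open>x\<^sub>i\<^bsup>v i\<^esup>\<close> over all \<open>i\<close>, in \<open>A\<close>. Neither \<open>prod\<close> (as \<open>A\<close> is not commutative)
  nor an ordering of the variables is available; the fold does not depend on the order because the
  \<open>x\<^sub>i\<close> commute.\<close>

definition alg_monom :: "('n::finite \<Rightarrow>\<^sub>0 nat) \<Rightarrow> ('p::prime_card, 'n) frob_alg" where
  "alg_monom v = Finite_Set.fold (\<lambda>i a. alg_x i ^ lookup v i * a) 1 UNIV"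

definition poly_to_alg :: "('p::prime_card, 'n::finite) poly_ring \<Rightarrow> ('p, 'n) frob_alg" where
  "poly_to_alg r = (\<Sum>v\<in>keys r. alg_const (lookup r v) * alg_monom v)"

lemma power_commute:
  assumes "a * b = b * (a :: 'a::monoid_mult)"
  shows "a ^ k * b ^ l = b ^ l * a ^ k"
proof -
  have *: "a * b ^ l = b ^ l * a" for l
  proof (induction l)
    case (Suc l)
    have "a * b ^ Suc l = b * (a * b ^ l)" by (simp add: assms flip: mult.assoc)
    also have "\<dots> = b ^ Suc l * a" by (simp add: Suc mult.assoc)
    finally show ?case .
  qed simp
  show ?thesis
  proof (induction k)
    case (Suc k)
    have "a ^ Suc k * b ^ l = a * (a ^ k * b ^ l)" by (simp add: mult.assoc)
    also have "\<dots> = (a * b ^ l) * a ^ k" by (simp add: Suc mult.assoc)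
    also have "\<dots> = b ^ l * a ^ Suc k" by (simp add: * mult.assoc)
    finally show ?case .
  qed simp
qed

lemma comp_fun_commute_alg_monom:
  "comp_fun_commute (\<lambda>i a. alg_x i ^ lookup v i * (a :: ('p::prime_card, 'n) frob_alg))"
  by standard (simp add: fun_eq_iff power_commute[OF alg_x_commute] flip: mult.assoc)

definition alg_monom_on :: "'n set \<Rightarrow> ('n::finite \<Rightarrow>\<^sub>0 nat) \<Rightarrow> ('p::prime_card, 'n) frob_alg" where
  "alg_monom_on S v = Finite_Set.fold (\<lambda>i a. alg_x i ^ lookup v i * a) 1 S"

lemma alg_monom_on_empty [simp]: "alg_monom_on {} v = 1"
  by (simp add: alg_monom_on_def)

lemma alg_monom_on_insert:
  "i \<notin> S \<Longrightarrow> alg_monom_on (insert i S) v = alg_x i ^ lookup v i * alg_monom_on S v"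
  unfolding alg_monom_on_def
  by (rule comp_fun_commute_on.fold_insert[OF comp_fun_commute_alg_monom[unfolded comp_fun_commute_def']]) auto

lemma alg_monom_on_commute:
  "alg_x i ^ k * alg_monom_on S v = alg_monom_on S v * (alg_x i ^ k :: ('p::prime_card, 'n::finite) frob_alg)"
proof (induction S rule: infinite_finite_induct)
  case (insert j S)
  have "alg_x i ^ k * alg_monom_on (insert j S) v
      = (alg_x i ^ k * alg_x j ^ lookup v j) * (alg_monom_on S v :: ('p, 'n) frob_alg)"
    using insert by (simp add: alg_monom_on_insert mult.assoc)
  also have "\<dots> = alg_x j ^ lookup v j * (alg_x i ^ k * alg_monom_on S v)"
    by (simp add: power_commute[OF alg_x_commute, of i k j] mult.assoc)
  also have "\<dots> = alg_monom_on (insert j S) v * alg_x i ^ k"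
    using insert by (simp add: alg_monom_on_insert mult.assoc)
  finally show ?case .
qed auto

lemma alg_monom_on_add:
  "alg_monom_on S (u + v) = alg_monom_on S u * (alg_monom_on S v :: ('p::prime_card, 'n::finite) frob_alg)"
proof (induction S rule: infinite_finite_induct)
  case (insert i S)
  have "alg_monom_on (insert i S) (u + v)
      = alg_x i ^ lookup u i * ((alg_x i ^ lookup v i * alg_monom_on S u) * (alg_monom_on S v :: ('p, 'n) frob_alg))"
    using insert(2,3) by (simp add: alg_monom_on_insert lookup_add power_add mult.assoc)
  also have "\<dots> = alg_monom_on (insert i S) u * alg_monom_on (insert i S) v"
    using insert(2)
    by (simp only: alg_monom_on_commute[of i "lookup v i" S u] alg_monom_on_insert mult.assoc if_False
        not_False_eq_True)
  finally show ?case .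
qed auto

lemma alg_monom_on_single:
  "alg_monom_on S (single i k) = (if i \<in> S then alg_x i ^ k else 1)"
proof (induction S rule: infinite_finite_induct)
  case (insert j S)
  then show ?case by (auto simp: alg_monom_on_insert lookup_single when_def)
qed auto

lemma alg_monom_eq: "alg_monom = alg_monom_on UNIV"
  by (simp add: fun_eq_iff alg_monom_def alg_monom_on_def)

lemma alg_monom_add: "alg_monom (u + v) = alg_monom u * alg_monom v"
  by (simp add: alg_monom_eq alg_monom_on_add)

lemma alg_monom_single: "alg_monom (single i k) = alg_x i ^ k"
  by (simp add: alg_monom_eq alg_monom_on_single)

lemma alg_monom_zero [simp]: "alg_monom 0 = 1"
proof -
  have "alg_monom 0 = alg_monom (single (undefined :: 'b) 0)" by simp
  then show ?thesis unfolding alg_monom_single by simp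
qed

lemma poly_to_alg_add: "poly_to_alg (r + s) = poly_to_alg r + poly_to_alg s"
  unfolding poly_to_alg_def
  by (rule setsum_keys_plus_distrib) (simp_all add: alg_const_add distrib_right)

lemma poly_to_alg_single: "poly_to_alg (single v c) = alg_const c * alg_monom v"
  by (simp add: poly_to_alg_def)

lemma poly_to_alg_zero [simp]: "poly_to_alg 0 = 0"
  by (simp add: poly_to_alg_def)

lemma poly_to_alg_one [simp]: "poly_to_alg 1 = 1"
  by (simp add: poly_to_alg_single flip: single_one)

lemma poly_to_alg_mult: "poly_to_alg (r * s) = poly_to_alg r * poly_to_alg s"
proof (induction r rule: poly_mapping_additive_induct)
  case (single u c)
  show ?case
  proof (induction s rule: poly_mapping_additive_induct)
    case (single v d)
    have "alg_const c * alg_const d * (alg_monom u * alg_monom v)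
        = alg_const c * (alg_const d * alg_monom u) * (alg_monom v :: ('a, 'b) frob_alg)"
      by (simp add: mult.assoc)
    also have "alg_const d * alg_monom u = alg_monom u * (alg_const d :: ('a, 'b) frob_alg)"
      by (rule alg_const_central)
    finally show ?case
      by (simp add: mult_single poly_to_alg_single alg_const_mult alg_monom_add mult.assoc)
  qed (simp_all add: poly_to_alg_add distrib_left)
qed (simp_all add: poly_to_alg_add distrib_right)

section \<open>Left modules\<close>

locale left_module =
  fixes scale :: "'a::ring_1 \<Rightarrow> 'm::ab_group_add \<Rightarrow> 'm"
  assumes scale_add_right: "scale a (x + y) = scale a x + scale a y"
    and scale_add_left: "scale (a + b) x = scale a x + scale b x"
    and scale_scale: "scale a (scale b x) = scale (a * b) x"
    and scale_one: "scale 1 x = x"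

text \<open>Exactness of \<open>A\<^sup>s \<rightarrow> A\<^sup>r \<rightarrow> N \<rightarrow> 0\<close>, where \<open>g\<close> lists the images of the basis of \<open>A\<^sup>r\<close>, and
  \<open>\<rho> j\<close> is the \<open>j\<close>-th relation, acting on row vectors.\<close>

definition finitely_presented :: "('a::ring_1 \<Rightarrow> 'm::ab_group_add \<Rightarrow> 'm) \<Rightarrow> bool" where
  "finitely_presented scale \<longleftrightarrow>
     (\<exists>(r::nat) (g :: nat \<Rightarrow> 'm) (s::nat) (\<rho> :: nat \<Rightarrow> nat \<Rightarrow> 'a).
        (\<forall>m. \<exists>c. m = (\<Sum>i<r. scale (c i) (g i))) \<and>
        (\<forall>c. (\<Sum>i<r. scale (c i) (g i)) = 0 \<longleftrightarrow> (\<exists>b. \<forall>i<r. c i = (\<Sum>j<s. b j * \<rho> j i))))"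

locale frob_module = left_module scale
  for scale :: "('p::prime_card, 'n::finite) frob_alg \<Rightarrow> 'm::ab_group_add \<Rightarrow> 'm"

locale graded_frob_module = frob_module scale
  for scale :: "('p::prime_card, 'n::finite) frob_alg \<Rightarrow> 'm::ab_group_add \<Rightarrow> 'm" +
  fixes gr :: "int \<Rightarrow> 'm set"
  assumes gr_zero: "0 \<in> gr i"
    and gr_add: "x \<in> gr i \<Longrightarrow> y \<in> gr i \<Longrightarrow> x + y \<in> gr i"
    and gr_uminus: "x \<in> gr i \<Longrightarrow> - x \<in> gr i"
    and gr_direct_sum: "\<exists>!c :: int \<Rightarrow>\<^sub>0 'm. (\<forall>i. lookup c i \<in> gr i) \<and> m = (\<Sum>i\<in>keys c. lookup c i)"
    and gr_scale: "a \<in> alg_deg k \<Longrightarrow> x \<in> gr i \<Longrightarrow> scale a x \<in> gr (int k + i)"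

section \<open>The structure morphism\<close>

text \<open>The underlying \<open>R\<close>-module of \<open>N\<close>. The \<open>mult\<close> and \<open>one\<close> fields of a \<open>HOL-Algebra\<close> module
  record play no role.\<close>

definition restrict_to_poly ::
  "(('p::prime_card, 'n::finite) frob_alg \<Rightarrow> 'm::ab_group_add \<Rightarrow> 'm) \<Rightarrow> (('p, 'n) poly_ring, 'm) module" where
  "restrict_to_poly scale =
     \<lparr>carrier = UNIV, mult = undefined, one = undefined, zero = 0, add = (+),
      smult = (\<lambda>r x. scale (poly_to_alg r) x)\<rparr>"

definition exps_below :: "nat \<Rightarrow> ('n \<Rightarrow>\<^sub>0 nat) set" where
  "exps_below p = {v. \<forall>i. lookup v i < p}"

text \<open>An element of \<open>\<F>\<^sub>A(N)\<close> is a finitely supported function on exponent vectors, with \<open>single v g\<close>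
  in the role of \<open>g \<epsilon>\<^sub>v\<close>. The action is the linear extension of
  \<open>c x\<^sup>u \<cdot> g \<epsilon>\<^sub>v = (c g) \<epsilon>\<^bsub>v+u\<^esub>\<close>, read as \<open>0\<close> if \<open>v + u\<close> has an entry \<open>\<ge> p\<close>. The twists only affect
  the grading, which plays no role for the cokernel as an \<open>R\<close>-module.\<close>

definition ext_smult ::
  "(('p::prime_card, 'n::finite) frob_alg \<Rightarrow> 'm::ab_group_add \<Rightarrow> 'm) \<Rightarrow>
     ('p, 'n) poly_ring \<Rightarrow> (('n \<Rightarrow>\<^sub>0 nat) \<Rightarrow>\<^sub>0 'm) \<Rightarrow> (('n \<Rightarrow>\<^sub>0 nat) \<Rightarrow>\<^sub>0 'm)" where
  "ext_smult scale r \<phi> =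
     (\<Sum>u\<in>keys r. \<Sum>v\<in>keys \<phi>.
        if v + u \<in> exps_below CARD('p)
        then single (v + u) (scale (alg_const (lookup r u)) (lookup \<phi> v)) else 0)"

definition ext_module ::
  "(('p::prime_card, 'n::finite) frob_alg \<Rightarrow> 'm::ab_group_add \<Rightarrow> 'm) \<Rightarrow>
     (('p, 'n) poly_ring, ('n \<Rightarrow>\<^sub>0 nat) \<Rightarrow>\<^sub>0 'm) module" where
  "ext_module scale =
     \<lparr>carrier = {\<phi>. keys \<phi> \<subseteq> exps_below CARD('p)}, mult = undefined, one = undefined,
      zero = 0, add = (+), smult = ext_smult scale\<rparr>"

definition structure_map ::
  "(('p::prime_card, 'n::finite) frob_alg \<Rightarrow> 'm::ab_group_add \<Rightarrow> 'm) \<Rightarrow> (('n \<Rightarrow>\<^sub>0 nat) \<Rightarrow>\<^sub>0 'm) \<Rightarrow> 'm" where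
  "structure_map scale \<phi> = (\<Sum>v\<in>keys \<phi>. scale (alg_monom v * alg_f) (lookup \<phi> v))"

definition quotient_module :: "('r, 'm) module \<Rightarrow> 'm set \<Rightarrow> ('r, 'm set) module" where
  "quotient_module M H =
     \<lparr>carrier = a_rcosets\<^bsub>M\<^esub> H, mult = undefined, one = undefined, zero = H, add = set_add M,
      smult = (\<lambda>r X. \<Union>x\<in>X. H +>\<^bsub>M\<^esub> (r \<odot>\<^bsub>M\<^esub> x))\<rparr>"

definition cokernel_module ::
  "(('p::prime_card, 'n::finite) frob_alg \<Rightarrow> 'm::ab_group_add \<Rightarrow> 'm) \<Rightarrow> (('p, 'n) poly_ring, 'm set) module" where
  "cokernel_module scale =
     quotient_module (restrict_to_poly scale) (structure_map scale ` carrier (ext_module scale))"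

text \<open>The following facts check that these are indeed \<open>R\<close>-modules and an \<open>R\<close>-linear map.\<close>

lemma single_in_ext: "single v g \<in> {\<phi>. keys \<phi> \<subseteq> exps_below p} \<longleftrightarrow> g = 0 \<or> v \<in> exps_below p"
  by auto

lemma ext_in_add: "keys \<phi> \<subseteq> E \<Longrightarrow> keys \<psi> \<subseteq> E \<Longrightarrow> keys (\<phi> + \<psi>) \<subseteq> E"
  using keys_add[of \<phi> \<psi>] by blast

lemma exps_below_add: "u + v \<in> exps_below p \<Longrightarrow> u \<in> exps_below p"
  by (auto simp: exps_below_def lookup_add intro: add_lessD1)

context left_module
begin

lemma scale_zero_right [simp]: "scale a 0 = 0"
  using scale_add_right[of a 0 0] by simp

lemma scale_zero_left [simp]: "scale 0 x = 0"
  using scale_add_left[of 0 0 x] by simp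

lemma scale_sum_right: "scale a (sum h S) = (\<Sum>i\<in>S. scale a (h i))"
  by (induction S rule: infinite_finite_induct) (simp_all add: scale_add_right)

lemma scale_minus_right: "scale a (- x) = - scale a x"
  using scale_add_right[of a x "- x"] by (simp add: minus_unique)

end

lemma alg_monom_f:
  assumes "v \<notin> exps_below CARD('p)"
  shows "alg_monom v * alg_f = (0 :: ('p::prime_card, 'n::finite) frob_alg)"
proof -
  from assms obtain i where i: "lookup v i \<ge> CARD('p)" by (auto simp: exps_below_def not_less)
  have "v = (v - single i CARD('p)) + single i CARD('p)"
    using i by (intro poly_mapping_eqI) (auto simp: lookup_add lookup_minus lookup_single when_def)
  then have "(alg_monom v :: ('p, 'n) frob_alg) = alg_monom (v - single i CARD('p)) * alg_x i ^ CARD('p)"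
    by (metis alg_monom_add alg_monom_single)
  then show ?thesis by (simp add: mult.assoc alg_x_power_f)
qed

context frob_module
begin

lemma module_restrict_to_poly: "Module.module ring_of_class (restrict_to_poly scale)"
proof (rule moduleI[OF cring_ring_of_class])
  show "abelian_group (restrict_to_poly scale)"
  proof (rule abelian_groupI)
    fix x
    show "\<exists>y\<in>carrier (restrict_to_poly scale).
        y \<oplus>\<^bsub>restrict_to_poly scale\<^esub> x = \<zero>\<^bsub>restrict_to_poly scale\<^esub>"
      by (auto simp: restrict_to_poly_def intro: exI[of _ "- x"])
  qed (auto simp: restrict_to_poly_def algebra_simps)
qed (auto simp: restrict_to_poly_def poly_to_alg_add poly_to_alg_mult
      scale_add_left scale_add_right scale_scale scale_one)

lemma ext_smult_add_left: "ext_smult scale (r + s) \<phi> = ext_smult scale r \<phi> + ext_smult scale s \<phi>"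
  unfolding ext_smult_def
  by (rule setsum_keys_plus_distrib)
     (auto simp: alg_const_add scale_add_left single_add sum.distrib[symmetric]
       intro!: sum.cong sum.neutral)

lemma ext_smult_add_right: "ext_smult scale r (\<phi> + \<psi>) = ext_smult scale r \<phi> + ext_smult scale r \<psi>"
proof -
  have "(\<Sum>v\<in>keys (\<phi> + \<psi>). if v + u \<in> exps_below CARD('p)
           then single (v + u) (scale c (lookup (\<phi> + \<psi>) v)) else 0)
      = (\<Sum>v\<in>keys \<phi>. if v + u \<in> exps_below CARD('p)
           then single (v + u) (scale c (lookup \<phi> v)) else 0)
      + (\<Sum>v\<in>keys \<psi>. if v + u \<in> exps_below CARD('p)
           then single (v + u) (scale c (lookup \<psi> v)) else 0)" for u c
    by (rule setsum_keys_plus_distrib) (auto simp: scale_add_right single_add)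
  then show ?thesis unfolding ext_smult_def by (simp add: sum.distrib)
qed

lemma ext_smult_zero [simp]: "ext_smult scale 0 \<phi> = 0" "ext_smult scale r 0 = 0"
  by (simp_all add: ext_smult_def)

lemma ext_smult_single:
  "ext_smult scale (single u c) (single v g) =
     (if v + u \<in> exps_below CARD('p) then single (v + u) (scale (alg_const c) g) else 0)"
  by (simp add: ext_smult_def)

lemma ext_smult_x:
  assumes "v \<in> exps_below CARD('p)"
  shows "ext_smult scale (single (single i 1) 1) (single v g) =
    (if lookup v i < CARD('p) - 1 then single (v + single i 1) g else 0)"
proof -
  have "v + single i 1 \<in> exps_below CARD('p) \<longleftrightarrow> lookup v i < CARD('p) - 1"
  proof
    assume "v + single i 1 \<in> exps_below CARD('p)"
    then have "lookup v i + 1 < CARD('p)"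
      unfolding exps_below_def by (auto simp: lookup_add dest: spec[of _ i])
    then show "lookup v i < CARD('p) - 1" by simp
  next
    assume "lookup v i < CARD('p) - 1"
    then show "v + single i 1 \<in> exps_below CARD('p)"
      using assms by (auto simp: exps_below_def lookup_add lookup_single when_def)
  qed
  then show ?thesis by (simp add: ext_smult_single scale_one)
qed

lemma ext_smult_closed: "keys (ext_smult scale r \<phi>) \<subseteq> exps_below CARD('p)"
proof (induction r rule: poly_mapping_additive_induct)
  case (single u c)
  show ?case
  proof (induction \<phi> rule: poly_mapping_additive_induct)
    case (add a b)
    then show ?case unfolding ext_smult_add_right by (rule ext_in_add)
  qed (auto simp: ext_smult_single split: if_splits)
next
  case (add a b)
  then show ?case unfolding ext_smult_add_left by (rule ext_in_add)
qed simp

lemma ext_smult_assoc: "ext_smult scale (r * s) \<phi> = ext_smult scale r (ext_smult scale s \<phi>)"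
proof (induction r rule: poly_mapping_additive_induct)
  case (single u c)
  show ?case
  proof (induction s rule: poly_mapping_additive_induct)
    case (single w d)
    show ?case
    proof (induction \<phi> rule: poly_mapping_additive_induct)
      case (single v g)
      have "v + (u + w) = (v + w) + u" by (simp add: ac_simps)
      then show ?case
        using exps_below_add[of "v + w" u]
        by (auto simp: mult_single ext_smult_single alg_const_mult scale_scale)
    qed (simp_all add: ext_smult_add_right)
  qed (simp_all add: ext_smult_add_left ext_smult_add_right distrib_left)
qed (simp_all add: ext_smult_add_left distrib_right)

lemma poly_mapping_sum_single: "(\<Sum>v\<in>keys \<phi>. single v (lookup \<phi> v)) = \<phi>"
  by (rule poly_mapping_eqI)
     (auto simp: lookup_sum lookup_single when_def in_keys_iff)

lemma ext_smult_one:
  assumes "keys \<phi> \<subseteq> exps_below CARD('p)"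
  shows "ext_smult scale 1 \<phi> = \<phi>"
proof -
  have "ext_smult scale 1 \<phi> = (\<Sum>v\<in>keys \<phi>. single v (lookup \<phi> v))"
    using assms
    by (simp add: ext_smult_def scale_one subset_iff flip: single_one del: single_one cong: sum.cong)
  then show ?thesis by (simp add: poly_mapping_sum_single)
qed

lemma module_ext_module: "Module.module ring_of_class (ext_module scale)"
proof (rule moduleI[OF cring_ring_of_class])
  show "abelian_group (ext_module scale)"
  proof (rule abelian_groupI)
    fix \<phi> assume "\<phi> \<in> carrier (ext_module scale)"
    then show "\<exists>\<psi>\<in>carrier (ext_module scale).
        \<psi> \<oplus>\<^bsub>ext_module scale\<^esub> \<phi> = \<zero>\<^bsub>ext_module scale\<^esub>"
      by (auto simp: ext_module_def in_keys_iff intro!: exI[of _ "- \<phi>"])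
  qed (auto simp: ext_module_def algebra_simps dest: subsetD[OF keys_add])
qed (use ext_smult_closed in \<open>auto simp: ext_module_def ext_smult_add_left ext_smult_add_right
      ext_smult_assoc ext_smult_one\<close>)

lemma structure_map_add: "structure_map scale (\<phi> + \<psi>) = structure_map scale \<phi> + structure_map scale \<psi>"
  unfolding structure_map_def by (rule setsum_keys_plus_distrib) (simp_all add: scale_add_right)

lemma structure_map_zero [simp]: "structure_map scale 0 = 0"
  by (simp add: structure_map_def)

lemma structure_map_single: "structure_map scale (single v g) = scale (alg_monom v * alg_f) g"
  by (simp add: structure_map_def)

lemma structure_map_smult:
  "structure_map scale (ext_smult scale r \<phi>) = scale (poly_to_alg r) (structure_map scale \<phi>)"
proof (induction r rule: poly_mapping_additive_induct)
  case (single u c)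
  show ?case
  proof (induction \<phi> rule: poly_mapping_additive_induct)
    case (single v g)
    have "alg_const c * alg_monom u * (alg_monom v * alg_f) = alg_const c * (alg_monom (v + u) * alg_f)"
      by (simp add: alg_monom_add mult.assoc add.commute[of v])
    also have "\<dots> = alg_monom (v + u) * alg_f * alg_const c"
      by (rule alg_const_central)
    finally have "scale (poly_to_alg (single u c)) (structure_map scale (single v g))
        = scale (alg_monom (v + u) * alg_f * alg_const c) g"
      by (simp add: structure_map_single poly_to_alg_single scale_scale)
    then show ?case
      by (auto simp: ext_smult_single structure_map_single scale_scale alg_monom_f)
  qed (simp_all add: ext_smult_add_right structure_map_add scale_add_right)
qed (simp_all add: ext_smult_add_left structure_map_add scale_add_left poly_to_alg_add)

lemma submodule_image_structure_map:
  "submodule (structure_map scale ` carrier (ext_module scale)) ring_of_class (restrict_to_poly scale)"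
proof -
  interpret N: Module.module "ring_of_class :: ('p, 'n) poly_ring ring" "restrict_to_poly scale"
    by (rule module_restrict_to_poly)
  let ?H = "structure_map scale ` carrier (ext_module scale)"
  have smult: "scale (poly_to_alg r) x \<in> ?H" if "x \<in> ?H" for r x
  proof -
    from that obtain \<phi> where "x = structure_map scale \<phi>" by auto
    then show ?thesis
      by (intro image_eqI[of _ _ "ext_smult scale r \<phi>"])
         (simp_all add: structure_map_smult ext_module_def ext_smult_closed)
  qed
  have add: "x + y \<in> ?H" if "x \<in> ?H" "y \<in> ?H" for x y
  proof -
    from that obtain \<phi> \<psi> where "x = structure_map scale \<phi>" "y = structure_map scale \<psi>"
      "keys \<phi> \<subseteq> exps_below CARD('p)" "keys \<psi> \<subseteq> exps_below CARD('p)"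
      by (auto simp: ext_module_def)
    then show ?thesis
      by (intro image_eqI[of _ _ "\<phi> + \<psi>"]) (simp_all add: structure_map_add ext_module_def ext_in_add)
  qed
  have zero: "0 \<in> ?H"
    by (auto simp: ext_module_def intro!: image_eqI[of _ _ 0])
  have neg: "- x = scale (poly_to_alg (- 1)) x" for x
  proof -
    have "poly_to_alg (- 1) + poly_to_alg 1 = (poly_to_alg (- 1 + 1) :: ('p, 'n) frob_alg)"
      by (rule poly_to_alg_add[symmetric])
    then have "poly_to_alg (- 1) = (- 1 :: ('p, 'n) frob_alg)"
      by (intro eq_neg_iff_add_eq_0[THEN iffD2]) simp
    moreover have "scale 1 x + scale (- 1) x = scale (1 + - 1) x"
      by (rule scale_add_left[symmetric])
    then have "x + scale (- 1) x = 0" by (simp add: scale_one)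
    ultimately show ?thesis by (metis minus_unique)
  qed
  show ?thesis
  proof (rule N.submoduleI)
    fix x assume x: "x \<in> ?H"
    have "\<ominus>\<^bsub>restrict_to_poly scale\<^esub> x = - x"
      by (rule N.M.minus_equality) (simp_all add: restrict_to_poly_def)
    then show "\<ominus>\<^bsub>restrict_to_poly scale\<^esub> x \<in> ?H" using smult[OF x, of "- 1"] by (simp only: neg)
  next
    show "?H \<subseteq> carrier (restrict_to_poly scale)" by (simp add: restrict_to_poly_def)
    show "\<zero>\<^bsub>restrict_to_poly scale\<^esub> \<in> ?H" using zero by (simp add: restrict_to_poly_def)
    show "x \<oplus>\<^bsub>restrict_to_poly scale\<^esub> y \<in> ?H" if "x \<in> ?H" "y \<in> ?H" for x y
      using add[OF that] by (simp add: restrict_to_poly_def)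
    show "r \<odot>\<^bsub>restrict_to_poly scale\<^esub> x \<in> ?H" if "x \<in> ?H" for r x
      using smult[OF that] by (simp add: restrict_to_poly_def)
  qed
qed

end

lemma module_quotient_module:
  fixes R :: "('r, 'b) ring_scheme" and M :: "('r, 'm) module"
  assumes "Module.module R M" "submodule H R M"
  shows "Module.module R (quotient_module M H)"
proof -
  interpret M: Module.module R M by fact
  interpret H: submodule H R M by fact
  interpret H: abelian_subgroup H M
    by (rule abelian_subgroupI3)
       (auto simp: additive_subgroup_def H.subgroup_axioms M.abelian_group_axioms)
  have carrier: "X \<in> carrier (quotient_module M H) \<longleftrightarrow> (\<exists>x\<in>carrier M. X = H +>\<^bsub>M\<^esub> x)" for X
    by (auto simp: quotient_module_def A_RCOSETS_def')
  have smult: "r \<odot>\<^bsub>quotient_module M H\<^esub> (H +>\<^bsub>M\<^esub> x) = H +>\<^bsub>M\<^esub> (r \<odot>\<^bsub>M\<^esub> x)"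
    if r: "r \<in> carrier R" and x: "x \<in> carrier M" for r x
  proof -
    have "H +>\<^bsub>M\<^esub> (r \<odot>\<^bsub>M\<^esub> y) = H +>\<^bsub>M\<^esub> (r \<odot>\<^bsub>M\<^esub> x)" if y: "y \<in> H +>\<^bsub>M\<^esub> x" for y
    proof -
      obtain h where h: "h \<in> H" "y = h \<oplus>\<^bsub>M\<^esub> x" using y unfolding a_r_coset_def' by blast
      have "h \<in> carrier M" using subsetD[OF H.subset h(1)] by simp
      then have "r \<odot>\<^bsub>M\<^esub> y = r \<odot>\<^bsub>M\<^esub> h \<oplus>\<^bsub>M\<^esub> r \<odot>\<^bsub>M\<^esub> x"
        using r x h(2) M.smult_r_distr by simp
      then have "r \<odot>\<^bsub>M\<^esub> y \<in> H +>\<^bsub>M\<^esub> (r \<odot>\<^bsub>M\<^esub> x)"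
        unfolding a_r_coset_def' using H.smult_closed[OF r h(1)] by blast
      from M.a_repr_independence[OF this M.smult_closed[OF r x] H.subgroup_axioms]
      show ?thesis by (rule sym)
    qed
    then have "(\<Union>y\<in>H +>\<^bsub>M\<^esub> x. H +>\<^bsub>M\<^esub> (r \<odot>\<^bsub>M\<^esub> y)) = (\<Union>y\<in>H +>\<^bsub>M\<^esub> x. H +>\<^bsub>M\<^esub> (r \<odot>\<^bsub>M\<^esub> x))"
      by (rule SUP_cong[OF refl])
    moreover have "H +>\<^bsub>M\<^esub> x \<noteq> {}" using x H.a_rcos_self by blast
    ultimately show ?thesis by (simp add: quotient_module_def)
  qed
  have add: "(H +>\<^bsub>M\<^esub> x) \<oplus>\<^bsub>quotient_module M H\<^esub> (H +>\<^bsub>M\<^esub> y) = H +>\<^bsub>M\<^esub> (x \<oplus>\<^bsub>M\<^esub> y)"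
    if "x \<in> carrier M" "y \<in> carrier M" for x y
    using that by (simp add: quotient_module_def H.a_rcos_sum)
  have zero: "\<zero>\<^bsub>quotient_module M H\<^esub> = H +>\<^bsub>M\<^esub> \<zero>\<^bsub>M\<^esub>"
    using M.a_coset_add_zero[of H] H.subset by (simp add: quotient_module_def)
  have grp: "abelian_group (quotient_module M H)"
  proof (rule abelian_groupI)
    fix X assume "X \<in> carrier (quotient_module M H)"
    then obtain x where x: "x \<in> carrier M" "X = H +>\<^bsub>M\<^esub> x" by (auto simp: carrier)
    show "\<exists>Y\<in>carrier (quotient_module M H).
        Y \<oplus>\<^bsub>quotient_module M H\<^esub> X = \<zero>\<^bsub>quotient_module M H\<^esub>"
    proof (rule bexI)
      show "(H +>\<^bsub>M\<^esub> (\<ominus>\<^bsub>M\<^esub> x)) \<oplus>\<^bsub>quotient_module M H\<^esub> X = \<zero>\<^bsub>quotient_module M H\<^esub>"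
        using x by (simp add: add zero M.l_neg)
      show "H +>\<^bsub>M\<^esub> (\<ominus>\<^bsub>M\<^esub> x) \<in> carrier (quotient_module M H)"
        using x by (auto simp: carrier)
    qed
  next
    show "\<zero>\<^bsub>quotient_module M H\<^esub> \<in> carrier (quotient_module M H)"
      by (auto simp: carrier zero)
  next
    fix X Y assume "X \<in> carrier (quotient_module M H)" "Y \<in> carrier (quotient_module M H)"
    then obtain x y where xy: "x \<in> carrier M" "X = H +>\<^bsub>M\<^esub> x" "y \<in> carrier M" "Y = H +>\<^bsub>M\<^esub> y"
      by (auto simp: carrier)
    show "X \<oplus>\<^bsub>quotient_module M H\<^esub> Y \<in> carrier (quotient_module M H)"
      unfolding xy add[OF xy(1,3)] using xy by (auto simp: carrier)
    show "X \<oplus>\<^bsub>quotient_module M H\<^esub> Y = Y \<oplus>\<^bsub>quotient_module M H\<^esub> X"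
      using xy by (simp add: add M.a_comm)
    fix Z assume "Z \<in> carrier (quotient_module M H)"
    then obtain z where z: "z \<in> carrier M" "Z = H +>\<^bsub>M\<^esub> z" by (auto simp: carrier)
    show "X \<oplus>\<^bsub>quotient_module M H\<^esub> Y \<oplus>\<^bsub>quotient_module M H\<^esub> Z
        = X \<oplus>\<^bsub>quotient_module M H\<^esub> (Y \<oplus>\<^bsub>quotient_module M H\<^esub> Z)"
      using xy z by (simp add: add M.a_assoc)
  next
    fix X assume "X \<in> carrier (quotient_module M H)"
    then obtain x where x: "x \<in> carrier M" "X = H +>\<^bsub>M\<^esub> x" by (auto simp: carrier)
    then show "\<zero>\<^bsub>quotient_module M H\<^esub> \<oplus>\<^bsub>quotient_module M H\<^esub> X = X"
      by (simp add: add zero)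
  qed
  show ?thesis
  proof (rule moduleI[OF M.R.cring_axioms grp])
    fix a X assume a: "a \<in> carrier R" and "X \<in> carrier (quotient_module M H)"
    then obtain x where x: "x \<in> carrier M" "X = H +>\<^bsub>M\<^esub> x" by (auto simp: carrier)
    show "a \<odot>\<^bsub>quotient_module M H\<^esub> X \<in> carrier (quotient_module M H)"
      unfolding x smult[OF a x(1)] using a x by (auto simp: carrier)
    fix Y assume "Y \<in> carrier (quotient_module M H)"
    then obtain y where y: "y \<in> carrier M" "Y = H +>\<^bsub>M\<^esub> y" by (auto simp: carrier)
    show "a \<odot>\<^bsub>quotient_module M H\<^esub> (X \<oplus>\<^bsub>quotient_module M H\<^esub> Y)
        = a \<odot>\<^bsub>quotient_module M H\<^esub> X \<oplus>\<^bsub>quotient_module M H\<^esub> a \<odot>\<^bsub>quotient_module M H\<^esub> Y"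
      using a x y by (simp add: add smult M.smult_r_distr)
  next
    fix a b X assume ab: "a \<in> carrier R" "b \<in> carrier R" and "X \<in> carrier (quotient_module M H)"
    then obtain x where x: "x \<in> carrier M" "X = H +>\<^bsub>M\<^esub> x" by (auto simp: carrier)
    show "(a \<oplus>\<^bsub>R\<^esub> b) \<odot>\<^bsub>quotient_module M H\<^esub> X
        = a \<odot>\<^bsub>quotient_module M H\<^esub> X \<oplus>\<^bsub>quotient_module M H\<^esub> b \<odot>\<^bsub>quotient_module M H\<^esub> X"
      using ab x by (simp add: add smult M.smult_l_distr)
    show "(a \<otimes>\<^bsub>R\<^esub> b) \<odot>\<^bsub>quotient_module M H\<^esub> X
        = a \<odot>\<^bsub>quotient_module M H\<^esub> (b \<odot>\<^bsub>quotient_module M H\<^esub> X)"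
      using ab x by (simp add: smult M.smult_assoc1)
  next
    fix X assume "X \<in> carrier (quotient_module M H)"
    then obtain x where x: "x \<in> carrier M" "X = H +>\<^bsub>M\<^esub> x" by (auto simp: carrier)
    then show "\<one>\<^bsub>R\<^esub> \<odot>\<^bsub>quotient_module M H\<^esub> X = X"
      by (simp add: smult)
  qed
qed

lemma (in frob_module) module_cokernel_module: "Module.module ring_of_class (cokernel_module scale)"
  unfolding cokernel_module_def
  by (rule module_quotient_module[OF module_restrict_to_poly submodule_image_structure_map])

section \<open>Krull dimension\<close>

text \<open>For the zero ring the supremum is over the empty set, hence \<open>0\<close>; this yields dimension \<open>0\<close>
  for the zero module.\<close>

definition krull_dim :: "('a, 'b) ring_scheme \<Rightarrow> enat" where
  "krull_dim R = Sup {enat k | k. \<exists>P :: nat \<Rightarrow> 'a set.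
     (\<forall>i\<le>k. primeideal (P i) R) \<and> (\<forall>i<k. P i \<subset> P (Suc i))}"

definition annihilator :: "('r, 'b) ring_scheme \<Rightarrow> ('r, 'm) module \<Rightarrow> 'r set" where
  "annihilator R M = {r \<in> carrier R. \<forall>x\<in>carrier M. r \<odot>\<^bsub>M\<^esub> x = \<zero>\<^bsub>M\<^esub>}"

definition module_krull_dim :: "('r, 'b) ring_scheme \<Rightarrow> ('r, 'm) module \<Rightarrow> enat" where
  "module_krull_dim R M = krull_dim (R Quot annihilator R M)"

section \<open>Hilbert series\<close>

abbreviation const_scale ::
  "(('p::prime_card, 'n) frob_alg \<Rightarrow> 'm::ab_group_add \<Rightarrow> 'm) \<Rightarrow> 'p mod_ring \<Rightarrow> 'm \<Rightarrow> 'm" where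
  "const_scale scale c x \<equiv> scale (alg_const c) x"

text \<open>The series is a formal Laurent series if the components are finite-dimensional and vanish in
  sufficiently negative degrees.\<close>

definition has_hilbert_series ::
  "(('p::prime_card, 'n) frob_alg \<Rightarrow> 'm::ab_group_add \<Rightarrow> 'm) \<Rightarrow> (int \<Rightarrow> 'm set) \<Rightarrow> bool" where
  "has_hilbert_series scale gr \<longleftrightarrow>
     (\<forall>i. \<exists>B. finite B \<and> gr i \<subseteq> Modules.module.span (const_scale scale) B) \<and>
     (\<exists>k. \<forall>i<k. gr i = {0})"

definition hilbert_series ::
  "(('p::prime_card, 'n) frob_alg \<Rightarrow> 'm::ab_group_add \<Rightarrow> 'm) \<Rightarrow> (int \<Rightarrow> 'm set) \<Rightarrow> rat fls" where
  "hilbert_series scale gr = Abs_fls (\<lambda>i. of_nat (vector_space.dim (const_scale scale) (gr i)))"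

lemma (in frob_module) vector_space_const_scale: "vector_space (const_scale scale)"
  by standard (simp_all add: scale_add_left scale_add_right scale_scale scale_one
      alg_const_add flip: alg_const_mult)

lemma (in frob_module) hilbert_series_nth:
  assumes "has_hilbert_series scale gr"
  shows "fls_nth (hilbert_series scale gr) i = of_nat (vector_space.dim (const_scale scale) (gr i))"
proof -
  interpret V: vector_space "const_scale scale" by (rule vector_space_const_scale)
  from assms obtain k where k: "\<forall>i<k. gr i = {0}" by (auto simp: has_hilbert_series_def)
  have "V.dim {0} = 0" using V.dim_eq_card[of "{}" "{0}"] by (simp add: V.dependent_def)
  with k show ?thesis
    unfolding hilbert_series_def by (intro nth_Abs_fls_lower_bound[of k]) simp
qed

text \<open>Laurent polynomials are finitely supported functions on the exponents.\<close>

definition laurent_eval :: "(int \<Rightarrow>\<^sub>0 int) \<Rightarrow> 'k::field \<Rightarrow> 'k" where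
  "laurent_eval a t = (\<Sum>i\<in>keys a. of_int (lookup a i) * t powi i)"

definition g_poly :: "nat \<Rightarrow> nat \<Rightarrow> 'k::comm_ring_1 \<Rightarrow> 'k" where
  "g_poly p n t = 1 - t * (\<Sum>k<p. t ^ k) ^ n"

end

theory Submission
  imports Defs "HOL-Library.Product_Plus"
begin

text \<open>
  Let \<open>K\<close> and \<open>C\<close> be the kernel and cokernel of the structure morphism of \<open>N\<close>. The exact sequence
  \<open>0 \<rightarrow> K \<rightarrow> \<F>\<^sub>A(N) \<rightarrow> N \<rightarrow> C \<rightarrow> 0\<close> gives \<open>g HS\<^sub>N = HS\<^sub>C - HS\<^sub>K\<close>. Since the structure morphism of a free
  module is injective, the snake lemma embeds \<open>K\<close> into the cokernel of the structure morphism of the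
  module of relations, which is finitely generated over \<open>R\<close>. As \<open>K\<close> is annihilated by all \<open>x\<^sub>i\<^bsup>p\<^esup>\<close>, it is
  finite-dimensional, and \<open>HS\<^sub>K\<close> is a Laurent polynomial.

  It remains to see that \<open>HS\<^sub>C\<close> has a pole of order \<open>dim C\<close> at \<open>1\<close> with positive leading coefficient.
  For \<open>C = R/I\<close> this is proved by Noetherian induction on the homogeneous ideal \<open>I\<close>, which also produces a
  chain of primes of the right length. That no chain of arbitrary primes is longer follows from the
  growth of Hilbert functions, which drops in degree with every strict inclusion of primes. The
  general case follows by a filtration with cyclic quotients.

  Because the ground field is finite, dimensions are logarithms of cardinalities, and only
  subgroups, rather than subquotients, have to be counted.
\<close>

section \<open>Finite additive subgroups\<close>

text \<open>The proof rests on a normal form: A is the direct sum of R and the x^v f A for exponents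
  v below p. Existence shows that C is finitely generated over R, because modulo the image of the
  structure morphism only the R-part of a coefficient acts on the A-generators of N. The same
  argument, applied to the relations of N, gives the finite generation of the cokernel that receives
  K. Uniqueness is the injectivity for free modules; as A is given by generators and relations, it
  has to be extracted from an explicit representation. The Krull dimension refers to arbitrary
  primes, whereas Hilbert series see only homogeneous data. The induction on ideals therefore proves
  three things about one number d: the order of the pole, an upper bound for the growth, and a chain
  of primes. In the end the numerator is c - b (1 - t)^d, with c from C and b from K. For d > 0 the
  second term vanishes at 1, so the positivity of c(1) survives; for d = 0 it subtracts the
  dimension of K.\<close>

definition addsub :: "'a::ab_group_add set \<Rightarrow> bool" where
  "addsub S \<longleftrightarrow> 0 \<in> S \<and> (\<forall>x\<in>S. \<forall>y\<in>S. x - y \<in> S)"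

lemma addsub_zero: "addsub S \<Longrightarrow> 0 \<in> S"
  by (simp add: addsub_def)

lemma addsub_diff: "addsub S \<Longrightarrow> x \<in> S \<Longrightarrow> y \<in> S \<Longrightarrow> x - y \<in> S"
  by (simp add: addsub_def)

lemma addsub_uminus: "addsub S \<Longrightarrow> x \<in> S \<Longrightarrow> - x \<in> S"
  using addsub_diff[of S 0 x] addsub_zero by fastforce

lemma addsub_add: "addsub S \<Longrightarrow> x \<in> S \<Longrightarrow> y \<in> S \<Longrightarrow> x + y \<in> S"
  using addsub_diff[of S x "- y"] addsub_uminus by fastforce

lemma addsub_sum: "addsub S \<Longrightarrow> (\<And>i. i \<in> A \<Longrightarrow> h i \<in> S) \<Longrightarrow> sum h A \<in> S"
  by (induction A rule: infinite_finite_induct) (auto intro: addsub_zero addsub_add)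

lemma addsub_Int: "addsub S \<Longrightarrow> addsub T \<Longrightarrow> addsub (S \<inter> T)"
  by (auto simp: addsub_def)

text \<open>Counting fibres stands in for quotient groups, in Lagrange's theorem as well as in
  rank-nullity.\<close>

lemma card_constant_fibers:
  assumes "finite S" "\<And>s. s \<in> S \<Longrightarrow> card {x \<in> S. f x = f s} = c"
  shows "card S = card (f ` S) * c"
proof -
  have "card S = (\<Sum>y\<in>f ` S. card {x \<in> S. f x = y})"
    using sum.image_gen[OF assms(1), of "\<lambda>_. 1::nat" f] by simp
  also have "\<dots> = (\<Sum>y\<in>f ` S. c)"
    by (rule sum.cong) (use assms(2) in auto)
  finally show ?thesis by simp
qed

text \<open>For a subspace of a vector space over the field with \<open>p\<close> elements this is the dimension.\<close>

definition ldim :: "nat \<Rightarrow> 'a set \<Rightarrow> nat" where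
  "ldim p S = multiplicity p (card S)"

text \<open>Lagrange's theorem: \<open>s\<close> is sent to its coset, and each fibre is a translate
  of \<open>T\<close>.\<close>

lemma card_addsub_dvd:
  assumes "addsub T" "T \<subseteq> S" "addsub S" "finite S"
  shows "card T dvd card S"
proof -
  have "card S = card ((\<lambda>s. {x. x - s \<in> T}) ` S) * card T"
  proof (rule card_constant_fibers[OF assms(4)])
    fix s assume s: "s \<in> S"
    have "{x \<in> S. {y. y - x \<in> T} = {y. y - s \<in> T}} = (\<lambda>t. s + t) ` T"
    proof (intro equalityI subsetI)
      fix x assume x: "x \<in> {x \<in> S. {y. y - x \<in> T} = {y. y - s \<in> T}}"
      then have "x \<in> {y. y - s \<in> T}" using addsub_zero[OF assms(1)] by auto
      then show "x \<in> (\<lambda>t. s + t) ` T" by (auto intro!: image_eqI[of _ _ "x - s"])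
    next
      fix x assume "x \<in> (\<lambda>t. s + t) ` T"
      then obtain t where t: "t \<in> T" "x = s + t" by auto
      have "y - x \<in> T \<longleftrightarrow> y - s \<in> T" for y
        using addsub_add[OF assms(1) _ t(1), of "y - x"] addsub_diff[OF assms(1) _ t(1), of "y - s"]
        by (auto simp: t(2) algebra_simps)
      moreover have "x \<in> S" using t s assms(2,3) by (auto intro: addsub_add)
      ultimately show "x \<in> {x \<in> S. {y. y - x \<in> T} = {y. y - s \<in> T}}" by auto
    qed
    then show "card {x \<in> S. {y. y - x \<in> T} = {y. y - s \<in> T}} = card T"
      by (simp add: card_image)
  qed
  then show ?thesis by simp
qed

text \<open>\<open>ldim\<close> is a multiplicity, so an inclusion helps only through divisibility
  of the cardinalities.\<close>

lemma ldim_mono: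
  assumes "addsub T" "T \<subseteq> S" "addsub S" "finite S"
  shows "ldim p T \<le> ldim p S"
  unfolding ldim_def
  by (rule dvd_imp_multiplicity_le[OF card_addsub_dvd[OF assms]])
     (use assms addsub_zero in \<open>auto simp: card_eq_0_iff\<close>)

text \<open>Rank-nullity for the map \<open>(s, t) \<mapsto> f s + t\<close>: its kernel consists of
  pairs \<open>(s, - f s)\<close>, a copy of the part of \<open>S\<close> that \<open>f\<close>
  sends into \<open>T\<close>. Read as a comparison of f(S) + T modulo T with S modulo the preimage
  of T, it counts exact sequences without forming subquotients.\<close>

lemma ldim_sum_map:
  assumes p: "prime p" and f: "\<And>x y. f (x + y) = f x + f y"
    and S: "addsub S" "finite S" and T: "addsub T" "finite T"
  shows "ldim p {f s + t | s t. s \<in> S \<and> t \<in> T} + ldim p {s \<in> S. f s \<in> T} = ldim p S + ldim p T"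
proof -
  have f0: "f 0 = 0" using f[of 0 0] by simp
  have fd: "f (x - y) = f x - f y" for x y using f[of "x - y" y] by simp
  let ?g = "\<lambda>(s, t). f s + t"
  have "card (S \<times> T) = card (?g ` (S \<times> T)) * card {s \<in> S. f s \<in> T}"
  proof (rule card_constant_fibers)
    show "finite (S \<times> T)" using S T by simp
    fix z assume "z \<in> S \<times> T"
    then obtain a b where ab: "z = (a, b)" "a \<in> S" "b \<in> T" by auto
    have "bij_betw (\<lambda>s. (a + s, b - f s)) {s \<in> S. f s \<in> T} {x \<in> S \<times> T. ?g x = ?g z}"
    proof (rule bij_betwI[where g = "\<lambda>x. fst x - a"])
      show "(\<lambda>s. (a + s, b - f s)) \<in> {s \<in> S. f s \<in> T} \<rightarrow> {x \<in> S \<times> T. ?g x = ?g z}"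
        using ab S T by (auto simp: f intro: addsub_add addsub_diff)
      show "(\<lambda>x. fst x - a) \<in> {x \<in> S \<times> T. ?g x = ?g z} \<rightarrow> {s \<in> S. f s \<in> T}"
      proof (rule Pi_I)
        fix x assume x: "x \<in> {x \<in> S \<times> T. ?g x = ?g z}"
        then obtain s t where st: "x = (s, t)" "s \<in> S" "t \<in> T" "f s + t = f a + b" using ab by auto
        have "f (s - a) = b - t" using st(4) by (simp add: fd algebra_simps)
        then show "fst x - a \<in> {s \<in> S. f s \<in> T}"
          using st ab S T by (auto intro: addsub_diff)
      qed
    next
      fix x assume x: "x \<in> {x \<in> S \<times> T. ?g x = ?g z}"
      then obtain s t where st: "x = (s, t)" "f s + t = f a + b" using ab by auto
      then show "(a + (fst x - a), b - f (fst x - a)) = x" by (simp add: fd algebra_simps)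
    qed simp
    then show "card {x \<in> S \<times> T. ?g x = ?g z} = card {s \<in> S. f s \<in> T}"
      by (simp add: bij_betw_same_card)
  qed
  moreover have "?g ` (S \<times> T) = {f s + t | s t. s \<in> S \<and> t \<in> T}" by auto
  ultimately have *: "card S * card T = card {f s + t | s t. s \<in> S \<and> t \<in> T} * card {s \<in> S. f s \<in> T}"
    by (simp add: card_cartesian_product)
  have "card S \<noteq> 0" "card T \<noteq> 0" using S T addsub_zero by (auto simp: card_eq_0_iff)
  moreover from this * have "card {f s + t | s t. s \<in> S \<and> t \<in> T} \<noteq> 0" "card {s \<in> S. f s \<in> T} \<noteq> 0"
    by (metis mult_is_0)+
  moreover have "prime_elem p" using p by simp
  ultimately show ?thesis
    using arg_cong[OF *, of "multiplicity p"]
    by (simp add: ldim_def prime_elem_multiplicity_mult_distrib)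
qed

lemma ldim_singleton: "ldim p {x} = 0"
  by (simp add: ldim_def)

lemma ldim_le:
  assumes "prime p" "card S \<le> p ^ k" "finite S" "S \<noteq> {}"
  shows "ldim p S \<le> k"
proof -
  have "p ^ ldim p S \<le> card S"
    unfolding ldim_def using assms by (intro dvd_imp_le multiplicity_dvd) (auto simp: card_gt_0_iff)
  then have "p ^ ldim p S \<le> p ^ k" using assms by simp
  then show ?thesis using assms prime_gt_1_nat power_increasing_iff by blast
qed

lemma ldim_rank_nullity:
  fixes f :: "'a::ab_group_add \<Rightarrow> 'b::ab_group_add"
  assumes p: "prime p" and f: "\<And>x y. f (x + y) = f x + f y" and S: "addsub S" "finite S"
  shows "ldim p S = ldim p (f ` S) + ldim p {s \<in> S. f s = 0}"
proof -
  have "{f s + t |s t. s \<in> S \<and> t \<in> {0}} = f ` S" by auto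
  then show ?thesis
    using ldim_sum_map[where f = f, OF p f S, of "{0}"] by (simp add: ldim_singleton addsub_def)
qed

lemma ldim_card_power:
  assumes "prime p" "card S = p ^ k"
  shows "ldim p S = k"
  using assms by (simp add: ldim_def prime_imp_prime_elem multiplicity_same_power)

section \<open>Noetherian property of polynomial rings\<close>

text \<open>Every sequence has a monotone subsequence; a decreasing one of natural numbers is
  constant from the index of its minimum on.\<close>

lemma nat_seq_mono_subseq:
  fixes s :: "nat \<Rightarrow> nat"
  shows "\<exists>r :: nat \<Rightarrow> nat. strict_mono r \<and> mono (\<lambda>k. s (r k))"
proof -
  obtain f where f: "strict_mono f" "monoseq (\<lambda>n. s (f n))" using seq_monosub by blast
  show ?thesis
  proof (cases "incseq (\<lambda>n. s (f n))")
    case True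
    then show ?thesis using f(1) by (intro exI[of _ f]) simp
  next
    case False
    then have dec: "decseq (\<lambda>n. s (f n))" using f(2) by (simp add: monoseq_iff)
    define N where "N = (ARG_MIN (\<lambda>n. s (f n)) n. True)"
    have N: "s (f N) \<le> s (f n)" for n
      unfolding N_def by (rule arg_min_nat_le) simp
    have "s (f (N + k)) = s (f N)" for k
      using N decseqD[OF dec, of N "N + k"] by (simp add: order_antisym)
    then have "mono (\<lambda>k. s (f (N + k)))" by (simp add: mono_def)
    moreover have "strict_mono (\<lambda>k. f (N + k))" using f(1) by (simp add: strict_mono_def)
    ultimately show ?thesis by (intro exI[of _ "\<lambda>k. f (N + k)"]) simp
  qed
qed

text \<open>Thinning the sequence for one variable after another makes all exponents nondecreasing
  along a subsequence; its first two terms then serve.\<close>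

lemma dickson:
  fixes s :: "nat \<Rightarrow> ('n::finite \<Rightarrow>\<^sub>0 nat)"
  shows "\<exists>i j. i < j \<and> (\<exists>w. s j = s i + w)"
proof -
  have "finite A \<Longrightarrow> \<exists>r :: nat \<Rightarrow> nat. strict_mono r \<and> (\<forall>x\<in>A. mono (\<lambda>k. lookup (s (r k)) x))" for A
  proof (induction A rule: finite_induct)
    case empty
    then show ?case by (auto intro: exI[of _ "\<lambda>k. k"] simp: strict_mono_def)
  next
    case (insert x A)
    then obtain r :: "nat \<Rightarrow> nat" where r: "strict_mono r" "\<And>x. x \<in> A \<Longrightarrow> mono (\<lambda>k. lookup (s (r k)) x)" by blast
    obtain q :: "nat \<Rightarrow> nat" where q: "strict_mono q" "mono (\<lambda>k. lookup (s (r (q k))) x)"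
      using nat_seq_mono_subseq[of "\<lambda>k. lookup (s (r k)) x"] by blast
    have "mono (\<lambda>k. lookup (s (r (q k))) y)" if "y \<in> A" for y
      using r(2)[OF that] q(1) unfolding mono_def by (meson strict_mono_less_eq)
    moreover have "strict_mono (\<lambda>k. r (q k))" using r q by (simp add: strict_mono_def)
    ultimately show ?case using q by blast
  qed
  from this[OF finite] obtain r :: "nat \<Rightarrow> nat" where r: "strict_mono r" "\<And>x. mono (\<lambda>k. lookup (s (r k)) x)"
    by blast
  have le: "lookup (s (r 0)) x \<le> lookup (s (r 1)) x" for x using monoD[OF r(2), of 0 1] by simp
  have "s (r 1) = s (r 0) + (s (r 1) - s (r 0))"
    by (rule poly_mapping_eqI) (use le in \<open>simp add: lookup_add lookup_minus\<close>)
  moreover have "r 0 < r 1" using r(1) by (simp add: strict_mono_def)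
  ultimately show ?thesis by blast
qed

text \<open>An arbitrary numbering of the variables gives access to the lexicographic order on exponents.\<close>

definition exp_code :: "('n::finite \<Rightarrow>\<^sub>0 nat) \<Rightarrow> (nat \<Rightarrow>\<^sub>0 nat)" where
  "exp_code v = (\<Sum>i\<in>UNIV. single ((SOME \<iota> :: 'n \<Rightarrow> nat. inj \<iota>) i) (lookup v i))"

lemma exp_code_add: "exp_code (u + v) = exp_code u + exp_code v"
  by (simp add: exp_code_def lookup_add single_add sum.distrib)

lemma inj_exp_code: "inj exp_code"
proof (rule injI)
  fix u v :: "'n::finite \<Rightarrow>\<^sub>0 nat"
  let ?\<iota> = "SOME \<iota> :: 'n \<Rightarrow> nat. inj \<iota>"
  obtain f :: "'n \<Rightarrow> nat" where "inj f"
    using finite_imp_inj_to_nat_seg[OF finite[of "UNIV :: 'n set"]] by metis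
  then have inj: "inj ?\<iota>" by (rule someI[of inj])
  have *: "lookup (exp_code u) (?\<iota> i) = lookup u i" for u :: "'n \<Rightarrow>\<^sub>0 nat" and i
    unfolding exp_code_def using inj
    by (simp add: lookup_sum lookup_single when_def inj_eq)
  assume "exp_code u = exp_code v"
  then show "u = v" by (intro poly_mapping_eqI) (metis *)
qed

lemma exp_code_nonneg: "0 \<le> exp_code v"
  by (rule leI) (simp add: less_poly_mapping.rep_eq less_fun_def)

text \<open>Multiplying by a monomial never decreases the code, so Dickson's lemma excludes an
  infinite descent.\<close>

lemma wf_exp_code: "wf {(u, v). exp_code u < exp_code (v :: 'n::finite \<Rightarrow>\<^sub>0 nat)}"
  unfolding wf_iff_no_infinite_down_chain
proof (rule notI, elim exE)
  fix s :: "nat \<Rightarrow> ('n \<Rightarrow>\<^sub>0 nat)"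
  assume "\<forall>i. (s (Suc i), s i) \<in> {(u, v). exp_code u < exp_code v}"
  then have "exp_code (s (Suc (i + d))) < exp_code (s i)" for i d
    by (induction d) (auto intro: less_trans)
  then have dec: "exp_code (s j) < exp_code (s i)" if "i < j" for i j
    using that less_imp_Suc_add by blast
  obtain i j w where ij: "i < j" "s j = s i + w" using dickson by metis
  have "exp_code (s i) + 0 \<le> exp_code (s j)"
    unfolding ij(2) exp_code_add by (rule add_left_mono[OF exp_code_nonneg])
  then show False using dec[OF ij(1)] by simp
qed

text \<open>A predicate on plain sets, which keeps the algebra free of carriers;
  \<open>ideal_iff_is_ideal\<close> links it to the ideals in the definition of the Krull
  dimension.\<close>

definition is_ideal :: "'a::comm_ring_1 set \<Rightarrow> bool" where
  "is_ideal I \<longleftrightarrow> addsub I \<and> (\<forall>r. \<forall>x\<in>I. r * x \<in> I)"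

lemma is_ideal_addsub: "is_ideal I \<Longrightarrow> addsub I"
  by (simp add: is_ideal_def)

lemma is_ideal_mult: "is_ideal I \<Longrightarrow> x \<in> I \<Longrightarrow> r * x \<in> I"
  by (simp add: is_ideal_def)

definition exps_upto :: "('n::finite \<Rightarrow>\<^sub>0 nat) \<Rightarrow> ('n \<Rightarrow>\<^sub>0 nat) set" where
  "exps_upto u = {v. exp_code v \<le> exp_code u}"

text \<open>In a strictly ascending chain, choose elements \<open>f\<^sub>k \<in> I\<^sub>k\<^sub>+\<^sub>1 - I\<^sub>k\<close> with minimal leading exponents.
  By Dickson's lemma the leading term of some \<open>f\<^sub>i\<close> divides that of a later \<open>f\<^sub>j\<close>, and the
  reduction of \<open>f\<^sub>j\<close> by \<open>f\<^sub>i\<close> contradicts minimality.\<close>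

lemma wf_ideals:
  "wf {(J, I). is_ideal (I :: (('n::finite \<Rightarrow>\<^sub>0 nat) \<Rightarrow>\<^sub>0 'k::field) set) \<and> is_ideal J \<and> I \<subset> J}"
  unfolding wf_iff_no_infinite_down_chain
proof (rule notI, elim exE)
  fix I :: "nat \<Rightarrow> (('n \<Rightarrow>\<^sub>0 nat) \<Rightarrow>\<^sub>0 'k) set"
  assume "\<forall>i. (I (Suc i), I i) \<in> {(J, I). is_ideal I \<and> is_ideal J \<and> I \<subset> J}"
  then have id: "is_ideal (I k)" and lt: "I k \<subset> I (Suc k)" for k by auto
  have mono: "I i \<subseteq> I j" if "i \<le> j" for i j
    using lift_Suc_mono_le[of I] lt that by blast
  \<comment> \<open>Here \<open>u\<close> only has to bound the exponents of some \<open>f\<close>;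
    minimality, through \<open>red\<close>, turns it into an exponent of \<open>f\<close>.\<close>
  define B where "B k = {u. \<exists>f \<in> I (Suc k) - I k. keys f \<subseteq> exps_upto u}" for k
  have "B k \<noteq> {}" for k
  proof -
    obtain f where f: "f \<in> I (Suc k) - I k" using lt by blast
    then have ne: "keys f \<noteq> {}" using addsub_zero[OF is_ideal_addsub[OF id]] by auto
    then have "Max (exp_code ` keys f) \<in> exp_code ` keys f" by (intro Max_in) simp_all
    then obtain u where "u \<in> keys f" "exp_code u = Max (exp_code ` keys f)" by (metis imageE)
    then have "keys f \<subseteq> exps_upto u" by (auto simp: exps_upto_def)
    then show ?thesis using f by (auto simp: B_def)
  qed
  then have "\<exists>u\<in>B k. \<forall>v. exp_code v < exp_code u \<longrightarrow> v \<notin> B k" for k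
    using wf_exp_code unfolding wf_eq_minimal by (metis (mono_tags, lifting) all_not_in_conv case_prodI mem_Collect_eq)
  then obtain u where u: "\<And>k. u k \<in> B k" "\<And>k v. exp_code v < exp_code (u k) \<Longrightarrow> v \<notin> B k" by metis
  then have "\<exists>f \<in> I (Suc k) - I k. keys f \<subseteq> exps_upto (u k)" for k by (auto simp: B_def)
  then obtain f where f: "\<And>k. f k \<in> I (Suc k) - I k" "\<And>k. keys (f k) \<subseteq> exps_upto (u k)" by metis
  have red: "lookup h (u k) \<noteq> 0" if h: "h \<in> I (Suc k) - I k" "keys h \<subseteq> exps_upto (u k)" for h k
  proof
    assume 0: "lookup h (u k) = 0"
    have ne: "keys h \<noteq> {}" using h(1) addsub_zero[OF is_ideal_addsub[OF id]] by auto
    then have "Max (exp_code ` keys h) \<in> exp_code ` keys h" by (intro Max_in) simp_all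
    then obtain v where v: "v \<in> keys h" "exp_code v = Max (exp_code ` keys h)" by (metis imageE)
    then have "keys h \<subseteq> exps_upto v" by (auto simp: exps_upto_def)
    then have "v \<in> B k" using h(1) by (auto simp: B_def)
    have "v \<noteq> u k" using v(1) 0 by (auto simp: in_keys_iff)
    then have "exp_code v \<noteq> exp_code (u k)" by (simp add: inj_eq[OF inj_exp_code])
    moreover have "exp_code v \<le> exp_code (u k)" using h(2) v(1) by (auto simp: exps_upto_def)
    ultimately have "exp_code v < exp_code (u k)" by simp
    then show False using u(2) \<open>v \<in> B k\<close> by blast
  qed
  obtain i j w where ij: "i < j" "u j = u i + w" using dickson by metis
  \<comment> \<open>\<open>c\<close> cancels the coefficient of \<open>f j\<close> at
    \<open>u j\<close>. Since \<open>f i\<close> already lies in \<open>I j\<close>, the difference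
    \<open>h\<close> is still a new element at stage \<open>j\<close>.\<close>
  define c where "c = lookup (f j) (u j) / lookup (f i) (u i)"
  define h where "h = f j - single w c * f i"
  have "f i \<in> I j" using mono[of "Suc i" j] ij(1) f(1)[of i] by auto
  then have wf: "single w c * f i \<in> I j" using is_ideal_mult[OF id] by blast
  have "h \<in> I (Suc j) - I j"
  proof
    show "h \<in> I (Suc j)"
      unfolding h_def using f(1)[of j] wf mono[of j "Suc j"] by (intro addsub_diff is_ideal_addsub id) auto
    show "h \<notin> I j"
      using addsub_add[OF is_ideal_addsub[OF id], of h j "single w c * f i"] wf f(1)[of j]
      by (auto simp: h_def)
  qed
  moreover have lk: "lookup (single w c * g) (w + v) = c * lookup g v" for g v
    by (induction g rule: poly_mapping_additive_induct)
       (auto simp: mult_single lookup_single when_def lookup_add distrib_left)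
  have "keys (single w c * f i) \<subseteq> exps_upto (u j)"
  proof
    fix v assume "v \<in> keys (single w c * f i)"
    then obtain v' where v': "v = w + v'" "v' \<in> keys (f i)" using keys_mult[of "single w c" "f i"]
      by (auto split: if_splits)
    then show "v \<in> exps_upto (u j)"
      using f(2)[of i] unfolding v'(1) ij(2) exps_upto_def
      by (auto simp: exp_code_add add.commute[of "exp_code (u i)"] intro!: add_left_mono)
  qed
  then have "keys h \<subseteq> exps_upto (u j)"
    unfolding h_def using keys_diff[of "f j" "single w c * f i"] f(2)[of j] by blast
  ultimately have "lookup h (u j) \<noteq> 0" using red by blast
  moreover have "lookup h (u j) = 0"
    using lk[of "f i" "u i"] red[OF f(1,2)[of i]]
    by (simp add: h_def lookup_minus c_def ij(2) add.commute)
  ultimately show False by simp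
qed

section \<open>Homogeneous polynomials and ideals\<close>

definition exp_deg :: "('n::finite \<Rightarrow>\<^sub>0 nat) \<Rightarrow> nat" where
  "exp_deg v = (\<Sum>i\<in>UNIV. lookup v i)"

lemma exp_deg_add: "exp_deg (u + v) = exp_deg u + exp_deg v"
  by (simp add: exp_deg_def lookup_add sum.distrib)

lemma exp_deg_zero [simp]: "exp_deg 0 = 0"
  by (simp add: exp_deg_def)

lemma exp_deg_single [simp]: "exp_deg (single i k) = k"
  by (simp add: exp_deg_def lookup_single when_def)

lemma lookup_le_exp_deg: "lookup v i \<le> exp_deg v"
  unfolding exp_deg_def by (rule member_le_sum) auto

lemma exp_deg_eq_zero_iff: "exp_deg v = 0 \<longleftrightarrow> v = 0"
  by (auto simp: exp_deg_def intro: poly_mapping_eqI)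

text \<open>Degrees are integers because they will be shifted.\<close>

definition restr :: "int set \<Rightarrow> (('n::finite \<Rightarrow>\<^sub>0 nat) \<Rightarrow>\<^sub>0 'k::zero) \<Rightarrow> (('n \<Rightarrow>\<^sub>0 nat) \<Rightarrow>\<^sub>0 'k)" where
  "restr D = Poly_Mapping.mapp (\<lambda>v c. c when int (exp_deg v) \<in> D)"

definition hpolys :: "int set \<Rightarrow> (('n::finite \<Rightarrow>\<^sub>0 nat) \<Rightarrow>\<^sub>0 'k::zero) set" where
  "hpolys D = {r. \<forall>v\<in>keys r. int (exp_deg v) \<in> D}"

lemma lookup_restr: "lookup (restr D r) v = (lookup r v when int (exp_deg v) \<in> D)"
  by (auto simp: restr_def lookup_mapp when_def in_keys_iff)

lemma restr_add: "restr D (r + s) = restr D r + restr D (s :: _ \<Rightarrow>\<^sub>0 'k::monoid_add)"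
  by (rule poly_mapping_eqI) (simp add: lookup_restr lookup_add when_def)

lemma restr_diff: "restr D (r - s) = restr D r - restr D (s :: _ \<Rightarrow>\<^sub>0 'k::ab_group_add)"
  by (rule poly_mapping_eqI) (simp add: lookup_restr lookup_minus when_def)

lemma restr_zero [simp]: "restr D 0 = 0"
  by (rule poly_mapping_eqI) (simp add: lookup_restr)

lemma restr_sum: "restr D (sum h A) = (\<Sum>a\<in>A. restr D (h a :: _ \<Rightarrow>\<^sub>0 'k::ab_group_add))"
  by (induction A rule: infinite_finite_induct) (simp_all add: restr_add)

lemma restr_restr: "restr D (restr E r) = restr (D \<inter> E) r"
  by (rule poly_mapping_eqI) (simp add: lookup_restr when_def)

lemma restr_single: "restr D (single v c) = (single v c when int (exp_deg v) \<in> D)"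
  by (rule poly_mapping_eqI) (auto simp: lookup_restr lookup_single when_def)

lemma mem_hpolys_iff: "r \<in> hpolys D \<longleftrightarrow> restr D r = r"
proof
  assume "r \<in> hpolys D"
  then show "restr D r = r"
    by (intro poly_mapping_eqI) (auto simp: hpolys_def lookup_restr in_keys_iff when_def)
next
  assume "restr D r = r"
  then have "int (exp_deg v) \<in> D" if "lookup r v \<noteq> 0" for v
    using that by (metis lookup_restr when_def)
  then show "r \<in> hpolys D" by (simp add: hpolys_def in_keys_iff)
qed

lemma restr_in_hpolys: "restr D r \<in> hpolys D"
  by (simp add: mem_hpolys_iff restr_restr)

lemma addsub_hpolys: "addsub (hpolys D :: (_ \<Rightarrow>\<^sub>0 'k::ab_group_add) set)"
  by (auto simp: addsub_def mem_hpolys_iff restr_diff)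

lemma sum_single_lookup: "(\<Sum>v\<in>keys \<phi>. single v (lookup \<phi> v)) = \<phi>"
  by (rule poly_mapping_eqI) (auto simp: lookup_sum lookup_single when_def in_keys_iff)

text \<open>Degree sets are pulled back rather than shifted, so that one formula serves single
  degrees and half-lines.\<close>

lemma restr_mult:
  fixes a r :: "('n::finite \<Rightarrow>\<^sub>0 nat) \<Rightarrow>\<^sub>0 'k::comm_ring_1"
  assumes "a \<in> hpolys {e}"
  shows "restr D (a * r) = a * restr {i. i + e \<in> D} r"
proof -
  have *: "restr D (single u c * r) = single u c * restr {i. i + int (exp_deg u) \<in> D} r" for u c
    by (induction r rule: poly_mapping_additive_induct)
       (auto simp: restr_add distrib_left mult_single restr_single when_def exp_deg_add add.commute)
  have "restr D (a * r) = (\<Sum>u\<in>keys a. restr D (single u (lookup a u) * r))"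
    by (subst sum_single_lookup[symmetric, of a]) (simp only: sum_distrib_right restr_sum)
  also have "\<dots> = (\<Sum>u\<in>keys a. single u (lookup a u) * restr {i. i + e \<in> D} r)"
    using assms by (intro sum.cong refl) (simp add: * hpolys_def)
  also have "\<dots> = a * restr {i. i + e \<in> D} r"
    by (simp add: sum_single_lookup flip: sum_distrib_right)
  finally show ?thesis .
qed

lemma finite_exps:
  "finite {v :: 'n::finite \<Rightarrow>\<^sub>0 nat. exp_deg v \<le> m}"
  "card {v :: 'n::finite \<Rightarrow>\<^sub>0 nat. exp_deg v \<le> m} \<le> (m + 1) ^ CARD('n)"
proof -
  let ?E = "{v :: 'n \<Rightarrow>\<^sub>0 nat. exp_deg v \<le> m}" and ?F = "Pi\<^sub>E (UNIV :: 'n set) (\<lambda>_. {..m})"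
  have inj: "inj_on lookup ?E" by (simp add: inj_on_def)
  have sub: "lookup ` ?E \<subseteq> ?F"
    by (auto intro: le_trans lookup_le_exp_deg)
  have fin: "finite ?F" by (rule finite_PiE) auto
  show "finite ?E" using finite_subset[OF sub fin] inj finite_image_iff by blast
  have "card ?E = card (lookup ` ?E)" using inj by (simp add: card_image)
  also have "\<dots> \<le> card ?F" by (rule card_mono[OF fin sub])
  also have "\<dots> = (m + 1) ^ CARD('n)" by (simp add: card_PiE)
  finally show "card ?E \<le> (m + 1) ^ CARD('n)" .
qed

lemma finite_hpolys:
  fixes D :: "int set"
  assumes "\<And>i. i \<in> D \<Longrightarrow> i \<le> int m"
  shows "finite (hpolys D :: (('n::finite \<Rightarrow>\<^sub>0 nat) \<Rightarrow>\<^sub>0 'k::{zero,finite}) set)"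
    and "card (hpolys D :: (('n::finite \<Rightarrow>\<^sub>0 nat) \<Rightarrow>\<^sub>0 'k::{zero,finite}) set) \<le> CARD('k) ^ ((m + 1) ^ CARD('n))"
proof -
  let ?H = "hpolys D :: (('n \<Rightarrow>\<^sub>0 nat) \<Rightarrow>\<^sub>0 'k) set"
  let ?E = "{v :: 'n \<Rightarrow>\<^sub>0 nat. exp_deg v \<le> m}" let ?F = "Pi\<^sub>E ?E (\<lambda>_. UNIV :: 'k set)"
  have fin: "finite ?F" using finite_exps by (intro finite_PiE) auto
  have sub: "(\<lambda>r. restrict (lookup r) ?E) ` ?H \<subseteq> ?F"
    by (auto simp: PiE_def extensional_def)
  have out: "lookup r v = 0" if "r \<in> ?H" "v \<notin> ?E" for r v
    using that assms by (force simp: hpolys_def in_keys_iff)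
  have inj: "inj_on (\<lambda>r. restrict (lookup r) ?E) ?H"
  proof (rule inj_onI, rule poly_mapping_eqI)
    fix r s v assume rs: "r \<in> ?H" "s \<in> ?H" "restrict (lookup r) ?E = restrict (lookup s) ?E"
    show "lookup r v = lookup s v"
      using out[OF rs(1), of v] out[OF rs(2), of v] fun_cong[OF rs(3), of v] by (auto simp: restrict_def split: if_splits)
  qed
  show "finite ?H" using finite_subset[OF sub fin] inj finite_image_iff by blast
  have "card ?H = card ((\<lambda>r. restrict (lookup r) ?E) ` ?H)" using inj by (simp add: card_image)
  also have "\<dots> \<le> card ?F" by (rule card_mono[OF fin sub])
  also have "\<dots> = CARD('k) ^ card ?E" by (simp add: card_PiE finite_exps)
  also have "\<dots> \<le> CARD('k) ^ ((m + 1) ^ CARD('n))"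
    using finite_exps(2) by (intro power_increasing) (auto simp: Suc_le_eq)
  finally show "card ?H \<le> CARD('k) ^ ((m + 1) ^ CARD('n))" .
qed

text \<open>This is \<open>ldim_sum_map\<close> on the fixed points of an idempotent
  \<open>\<rho>\<close>, the projection to some set of degrees; \<open>\<rho>f\<close> says that
  \<open>f\<close> matches these degrees with \<open>E\<close>. With \<open>\<rho>\<close> abstract,
  the lemma covers ideals of R and submodules of N alike.\<close>

lemma ldim_graded_extension:
  fixes f :: "(('n::finite \<Rightarrow>\<^sub>0 nat) \<Rightarrow>\<^sub>0 'k::{comm_ring_1,finite}) \<Rightarrow> 'm::ab_group_add" and \<rho> :: "'m \<Rightarrow> 'm"
  assumes p: "prime p"
    and f: "\<And>r s. f (r + s) = f r + f s"
    and \<rho>: "\<And>x y. \<rho> (x + y) = \<rho> x + \<rho> y" "\<And>x. \<rho> (\<rho> x) = \<rho> x"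
    and \<rho>f: "\<And>r. \<rho> (f r) = f (restr E r)"
    and E: "\<And>i. i \<in> E \<Longrightarrow> i \<le> int m"
    and L: "addsub L" "\<And>u. u \<in> L \<Longrightarrow> \<rho> u \<in> L" "finite {u \<in> L. \<rho> u = u}"
  shows "ldim p {x. (\<exists>r. \<exists>u\<in>L. x = f r + u) \<and> \<rho> x = x} + ldim p {r \<in> hpolys E. f r \<in> L}
    = ldim p (hpolys E :: (('n \<Rightarrow>\<^sub>0 nat) \<Rightarrow>\<^sub>0 'k) set) + ldim p {u \<in> L. \<rho> u = u}"
proof -
  have \<rho>0: "\<rho> 0 = 0" using \<rho>(1)[of 0 0] by simp
  have \<rho>d: "\<rho> (x - y) = \<rho> x - \<rho> y" for x y using \<rho>(1)[of "x - y" y] by simp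
  have "addsub {u \<in> L. \<rho> u = u}" using L(1) by (auto simp: addsub_def \<rho>0 \<rho>d)
  note ldim_sum_map[where f = f, OF p f addsub_hpolys[of E] finite_hpolys(1)[OF E] this L(3)]
  moreover have "{f s + t |s t. s \<in> hpolys E \<and> t \<in> {u \<in> L. \<rho> u = u}}
      = {x. (\<exists>r. \<exists>u\<in>L. x = f r + u) \<and> \<rho> x = x}" (is "?A = ?B")
  proof (intro equalityI subsetI)
    fix x assume "x \<in> ?A"
    then show "x \<in> ?B" by (auto simp: \<rho> \<rho>f mem_hpolys_iff)
  next
    fix x assume "x \<in> ?B"
    then obtain r u where x: "u \<in> L" "x = f r + u" "\<rho> x = x" by auto
    then have "x = f (restr E r) + \<rho> u" by (simp add: \<rho> \<rho>f)
    then show "x \<in> ?A" using x(1) L(2) restr_in_hpolys \<rho>(2) by blast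
  qed
  moreover have "{s \<in> hpolys E. f s \<in> {u \<in> L. \<rho> u = u}} = {r \<in> hpolys E. f r \<in> L}"
    by (auto simp: \<rho>f mem_hpolys_iff)
  ultimately show ?thesis by simp
qed

section \<open>Poles of Laurent series at 1\<close>

lemma laurent_eval_add: "laurent_eval (a + b) t = laurent_eval a t + laurent_eval b (t :: 'k::field)"
  unfolding laurent_eval_def by (rule setsum_keys_plus_distrib) (simp_all add: distrib_right)

lemma laurent_eval_diff: "laurent_eval (a - b) t = laurent_eval a t - laurent_eval b (t :: 'k::field)"
  using laurent_eval_add[of "a - b" b t] by simp

lemma laurent_eval_zero [simp]: "laurent_eval 0 t = 0"
  by (simp add: laurent_eval_def)

lemma laurent_eval_single: "laurent_eval (single i c) t = of_int c * t powi i"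
  by (simp add: laurent_eval_def)

lemma laurent_eval_one [simp]: "laurent_eval 1 t = 1"
  by (simp add: laurent_eval_single flip: single_one)

lemma laurent_eval_mult:
  fixes t :: "'k::field"
  assumes "t \<noteq> 0"
  shows "laurent_eval (a * b) t = laurent_eval a t * laurent_eval b t"
proof (induction a rule: poly_mapping_additive_induct)
  case (single i c)
  show ?case
    by (induction b rule: poly_mapping_additive_induct)
       (use assms in \<open>simp_all add: mult_single laurent_eval_single laurent_eval_add distrib_left
          power_int_add\<close>)
qed (simp_all add: laurent_eval_add distrib_right)

lemma laurent_eval_power:
  assumes "t \<noteq> 0"
  shows "laurent_eval (a ^ k) t = laurent_eval a t ^ k"
  by (induction k) (simp_all add: laurent_eval_mult[OF assms])

lemma laurent_eval_uminus: "laurent_eval (- a) t = - laurent_eval a t"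
  using laurent_eval_add[of a "- a" t] by (simp add: eq_neg_iff_add_eq_0 add.commute)

definition laurent_pole :: "nat \<Rightarrow> rat fls \<Rightarrow> rat \<Rightarrow> bool" where
  "laurent_pole d F \<beta> \<longleftrightarrow>
     (\<exists>a. F * (1 - fls_X) ^ d = laurent_eval a fls_X \<and> laurent_eval a 1 = \<beta>)"

definition positive_pole :: "nat \<Rightarrow> rat fls \<Rightarrow> bool" where
  "positive_pole d F \<longleftrightarrow> (\<exists>\<beta>>0. laurent_pole d F \<beta>)"

lemma laurent_pole_add:
  "laurent_pole d F \<beta> \<Longrightarrow> laurent_pole d G \<gamma> \<Longrightarrow> laurent_pole d (F + G) (\<beta> + \<gamma>)"
  unfolding laurent_pole_def by (metis distrib_right laurent_eval_add)

lemma laurent_pole_mult: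
  assumes "laurent_pole d F \<beta>"
  shows "laurent_pole d (laurent_eval b fls_X * F) (laurent_eval b 1 * \<beta>)"
proof -
  from assms obtain a where a: "F * (1 - fls_X) ^ d = laurent_eval a fls_X" "laurent_eval a 1 = \<beta>"
    by (auto simp: laurent_pole_def)
  then have "laurent_eval b fls_X * F * (1 - fls_X) ^ d = laurent_eval (b * a) fls_X"
    by (simp add: laurent_eval_mult mult.assoc)
  moreover have "laurent_eval (b * a) 1 = laurent_eval b 1 * \<beta>"
    using a by (simp add: laurent_eval_mult)
  ultimately show ?thesis unfolding laurent_pole_def by blast
qed

lemma laurent_pole_shift:
  assumes "laurent_pole d F \<beta>"
  shows "laurent_pole d (fls_shift k F) \<beta>"
  using laurent_pole_mult[OF assms, of "single (- k) 1"]
  by (simp add: laurent_eval_single fls_shifted_times_simps)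

lemma laurent_pole_raise:
  assumes "laurent_pole d F \<beta>" "d < e"
  shows "laurent_pole e F 0"
proof -
  from assms obtain a where a: "F * (1 - fls_X) ^ d = laurent_eval a fls_X" "laurent_eval a 1 = \<beta>"
    by (auto simp: laurent_pole_def)
  have e: "e = d + (e - d)" "e - d \<noteq> 0" using assms(2) by simp_all
  let ?b = "(1 - single 1 1) ^ (e - d) :: int \<Rightarrow>\<^sub>0 int"
  have "F * (1 - fls_X) ^ e = F * (1 - fls_X) ^ d * (1 - fls_X) ^ (e - d)"
    by (subst e(1)) (simp only: power_add mult.assoc)
  also have "\<dots> = laurent_eval (a * ?b) fls_X"
    by (simp add: a laurent_eval_mult laurent_eval_power laurent_eval_diff laurent_eval_single)
  finally have "F * (1 - fls_X) ^ e = laurent_eval (a * ?b) fls_X" .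
  moreover have "laurent_eval (a * ?b) 1 = (0 :: rat)"
    using e(2)
    by (simp add: laurent_eval_mult laurent_eval_power laurent_eval_diff laurent_eval_single)
  ultimately show ?thesis unfolding laurent_pole_def by blast
qed

text \<open>Leading coefficients of the same order are both positive and cannot cancel, so the order
  of the sum is the maximum.\<close>

lemma positive_pole_add:
  assumes "positive_pole d F" "positive_pole e G"
  shows "positive_pole (max d e) (F + G)"
proof -
  obtain \<beta> \<gamma> where *: "\<beta> > 0" "\<gamma> > 0" "laurent_pole d F \<beta>" "laurent_pole e G \<gamma>"
    using assms by (auto simp: positive_pole_def)
  consider "d < e" | "d = e" | "e < d" by linarith
  then show ?thesis
  proof cases
    case 1
    then show ?thesis using laurent_pole_add[OF laurent_pole_raise[OF *(3) 1] *(4)] *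
      by (auto simp: positive_pole_def max_def)
  next
    case 2
    then show ?thesis using laurent_pole_add[OF *(3), of G \<gamma>] * unfolding positive_pole_def
      by (intro exI[of _ "\<beta> + \<gamma>"]) auto
  next
    case 3
    then show ?thesis using laurent_pole_add[OF *(3) laurent_pole_raise[OF *(4) 3]] *
      by (auto simp: positive_pole_def max_def)
  qed
qed

lemma positive_pole_shift: "positive_pole d F \<Longrightarrow> positive_pole d (fls_shift k F)"
  unfolding positive_pole_def using laurent_pole_shift by blast

lemma positive_pole_Suc: "positive_pole d (F * (1 - fls_X)) \<Longrightarrow> positive_pole (Suc d) F"
  by (simp add: positive_pole_def laurent_pole_def mult.assoc)

section \<open>Homogeneous ideals\<close>

definition prime_ideal :: "'a::comm_ring_1 set \<Rightarrow> bool" where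
  "prime_ideal P \<longleftrightarrow> is_ideal P \<and> 1 \<notin> P \<and> (\<forall>a b. a * b \<in> P \<longrightarrow> a \<in> P \<or> b \<in> P)"

text \<open>A chain of length \<open>k\<close> in the spectrum of the quotient by \<open>I\<close>,
  expressed upstairs. The primes may be inhomogeneous.\<close>

definition chain_of_primes :: "'a::comm_ring_1 set \<Rightarrow> nat \<Rightarrow> bool" where
  "chain_of_primes I k \<longleftrightarrow>
     (\<exists>P. (\<forall>i\<le>k. prime_ideal (P i) \<and> I \<subseteq> P i) \<and> (\<forall>i<k. P i \<subset> P (Suc i)))"

lemma chain_of_primes_mono: "chain_of_primes J k \<Longrightarrow> I \<subseteq> J \<Longrightarrow> chain_of_primes I k"
  unfolding chain_of_primes_def by (meson subset_trans)

lemma chain_of_primes_Suc: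
  assumes "prime_ideal I" "I \<subset> J" "chain_of_primes J k"
  shows "chain_of_primes I (Suc k)"
proof -
  obtain P where P: "\<And>i. i \<le> k \<Longrightarrow> prime_ideal (P i) \<and> J \<subseteq> P i" "\<And>i. i < k \<Longrightarrow> P i \<subset> P (Suc i)"
    using assms(3) unfolding chain_of_primes_def by blast
  let ?P = "case_nat I P"
  have "prime_ideal (?P i) \<and> I \<subseteq> ?P i" if "i \<le> Suc k" for i
    using that assms(1,2) P(1) by (cases i) auto
  moreover have "?P i \<subset> ?P (Suc i)" if "i < Suc k" for i
    using that assms(2) P(1)[of 0] P(2) by (cases i) auto
  ultimately show ?thesis unfolding chain_of_primes_def by (intro exI[of _ ?P]) blast
qed

definition hom_ideal :: "(('n::finite \<Rightarrow>\<^sub>0 nat) \<Rightarrow>\<^sub>0 'k::comm_ring_1) set \<Rightarrow> bool" where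
  "hom_ideal I \<longleftrightarrow> is_ideal I \<and> (\<forall>D. \<forall>r\<in>I. restr D r \<in> I)"

definition ideal_adjoin :: "'a::comm_ring_1 set \<Rightarrow> 'a \<Rightarrow> 'a set" where
  "ideal_adjoin I a = {x. \<exists>r. \<exists>u\<in>I. x = a * r + u}"

definition ideal_quotient :: "'a::comm_ring_1 set \<Rightarrow> 'a \<Rightarrow> 'a set" where
  "ideal_quotient I a = {r. a * r \<in> I}"

lemma is_ideal_adjoin:
  assumes "is_ideal I"
  shows "is_ideal (ideal_adjoin I a)"
  unfolding is_ideal_def addsub_def
proof (intro conjI ballI allI)
  show "0 \<in> ideal_adjoin I a"
    using addsub_zero[OF is_ideal_addsub[OF assms]]
    by (auto simp: ideal_adjoin_def intro!: exI[of _ 0] bexI[of _ 0])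
  fix x y assume "x \<in> ideal_adjoin I a" "y \<in> ideal_adjoin I a"
  then obtain r s u v where "x = a * r + u" "y = a * s + v" "u \<in> I" "v \<in> I"
    by (auto simp: ideal_adjoin_def)
  moreover from this have "x - y = a * (r - s) + (u - v)" by (simp add: algebra_simps)
  ultimately show "x - y \<in> ideal_adjoin I a"
    unfolding ideal_adjoin_def using addsub_diff[OF is_ideal_addsub[OF assms]] by blast
next
  fix c x assume "x \<in> ideal_adjoin I a"
  then obtain r u where "x = a * r + u" "u \<in> I" by (auto simp: ideal_adjoin_def)
  moreover from this have "c * x = a * (c * r) + c * u" by (simp add: algebra_simps)
  ultimately show "c * x \<in> ideal_adjoin I a"
    unfolding ideal_adjoin_def using is_ideal_mult[OF assms] by blast
qed

lemma is_ideal_quotient: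
  assumes "is_ideal I"
  shows "is_ideal (ideal_quotient I a)"
proof -
  have "a * (c * r) \<in> I" if "a * r \<in> I" for c r
    using is_ideal_mult[OF assms that, of c] by (simp add: mult.left_commute)
  then show ?thesis
    using is_ideal_addsub[OF assms]
    by (auto simp: is_ideal_def addsub_def ideal_quotient_def right_diff_distrib)
qed

lemma subset_ideal_adjoin: "I \<subseteq> ideal_adjoin I a"
  by (auto simp: ideal_adjoin_def intro!: exI[of _ 0])

lemma mem_ideal_adjoin: "is_ideal I \<Longrightarrow> a \<in> ideal_adjoin I a"
  using addsub_zero[OF is_ideal_addsub]
  by (auto simp: ideal_adjoin_def intro!: exI[of _ 1] bexI[of _ 0])

lemma subset_ideal_quotient: "is_ideal I \<Longrightarrow> I \<subseteq> ideal_quotient I a"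
  by (auto simp: ideal_quotient_def intro: is_ideal_mult)

lemma hom_ideal_adjoin:
  assumes "hom_ideal I" "a \<in> hpolys {e}"
  shows "hom_ideal (ideal_adjoin I a)"
proof -
  have "restr D x \<in> ideal_adjoin I a" if "x \<in> ideal_adjoin I a" for D x
  proof -
    from that obtain r u where x: "x = a * r + u" "u \<in> I" by (auto simp: ideal_adjoin_def)
    then have "restr D x = a * restr {i. i + e \<in> D} r + restr D u"
      by (simp add: restr_add restr_mult[OF assms(2)])
    then show ?thesis using x assms(1) by (auto simp: ideal_adjoin_def hom_ideal_def)
  qed
  then show ?thesis using assms is_ideal_adjoin by (auto simp: hom_ideal_def)
qed

lemma hom_ideal_quotient:
  assumes "hom_ideal I" "a \<in> hpolys {e}"
  shows "hom_ideal (ideal_quotient I a)"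
proof -
  have "a * restr D r \<in> I" if "a * r \<in> I" for D r
  proof -
    have "restr {i. i - e \<in> D} (a * r) \<in> I" using that assms(1) by (auto simp: hom_ideal_def)
    then show ?thesis by (simp add: restr_mult[OF assms(2)])
  qed
  then show ?thesis using assms is_ideal_quotient by (auto simp: hom_ideal_def ideal_quotient_def)
qed

lemma exists_degree_bound: "\<exists>m. r \<in> hpolys {..int m}"
proof -
  have "int (exp_deg v) \<le> int (Max (exp_deg ` keys r))" if "v \<in> keys r" for v
    using that by simp
  then show ?thesis by (intro exI[of _ "Max (exp_deg ` keys r)"]) (simp add: hpolys_def)
qed

text \<open>Compare the leading forms of two factors.\<close>

lemma hom_ideal_prime:
  fixes I :: "(('n::finite \<Rightarrow>\<^sub>0 nat) \<Rightarrow>\<^sub>0 'k::comm_ring_1) set"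
  assumes I: "hom_ideal I" "1 \<notin> I"
    and prime: "\<And>a b e e'. a \<in> hpolys {int e} \<Longrightarrow> b \<in> hpolys {int e'} \<Longrightarrow> a * b \<in> I \<Longrightarrow> a \<in> I \<or> b \<in> I"
  shows "prime_ideal I"
proof -
  have id: "is_ideal I" using I by (simp add: hom_ideal_def)
  note as = is_ideal_addsub[OF id]
  \<comment> \<open>The induction is on the sum of two strict degree bounds: the bound 0 forces the
    zero polynomial, and removing a leading form lowers one bound by 1.\<close>
  have "a \<in> I \<or> b \<in> I"
    if "k = k1 + k2" "a \<in> hpolys {..<int k1}" "b \<in> hpolys {..<int k2}" "a * b \<in> I" for k k1 k2 a b
    using that
  proof (induction k arbitrary: k1 k2 a b)
    case 0
    then have "a = 0" by (simp add: hpolys_def)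
    then show ?case using addsub_zero[OF as] by simp
  next
    case (Suc k)
    show ?case
    proof (cases "k1 = 0 \<or> k2 = 0")
      case True
      then have "a = 0 \<or> b = 0" using Suc.prems by (auto simp: hpolys_def)
      then show ?thesis using addsub_zero[OF as] by auto
    next
      case False
      define m1 m2 where "m1 = k1 - 1" and "m2 = k2 - 1"
      have k: "k1 = Suc m1" "k2 = Suc m2" using False by (auto simp: m1_def m2_def)
      define a1 a2 where "a1 = restr {int m1} a" and "a2 = restr {..<int m1} a"
      define b1 b2 where "b1 = restr {int m2} b" and "b2 = restr {..<int m2} b"
      have sp: "restr {int m} r + restr {..<int m} r = r" if "r \<in> hpolys {..<int (Suc m)}" for m r
      proof (rule poly_mapping_eqI)
        fix v
        have "v \<notin> keys r" if "\<not> exp_deg v < Suc m"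
          using that \<open>r \<in> _\<close> by (auto simp: hpolys_def)
        then have "lookup r v = 0" if "\<not> exp_deg v < Suc m"
          using that by (simp add: in_keys_iff)
        then show "lookup (restr {int m} r + restr {..<int m} r) v = lookup r v"
          by (auto simp: lookup_add lookup_restr when_def)
      qed
      have a: "a = a1 + a2" and b: "b = b1 + b2"
        using sp[of a m1] sp[of b m2] Suc.prems by (simp_all add: k a1_def a2_def b1_def b2_def)
      have h: "a1 \<in> hpolys {int m1}" "a2 \<in> hpolys {..<int m1}" "b1 \<in> hpolys {int m2}" "b2 \<in> hpolys {..<int m2}"
        by (simp_all add: a1_def a2_def b1_def b2_def restr_in_hpolys)
      have deg: "int (exp_deg v) < int m1 + int m2" if "v \<in> keys (a2 * b)" for v
        using that keys_mult[of a2 b] h(2) Suc.prems(3)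
        by (fastforce simp: hpolys_def exp_deg_add k)
      have "restr {int (m1 + m2)} (a2 * b) = 0"
        by (rule poly_mapping_eqI) (use deg in \<open>fastforce simp: lookup_restr when_def in_keys_iff\<close>)
      moreover have "restr {int (m1 + m2)} (a1 * b) = a1 * b1"
        unfolding restr_mult[OF h(1)] b1_def by (rule arg_cong[of _ _ "\<lambda>D. a1 * restr D b"]) auto
      ultimately have "restr {int (m1 + m2)} (a * b) = a1 * b1"
        by (simp add: a distrib_right restr_add)
      then have "a1 * b1 \<in> I" using Suc.prems(4) I(1) by (metis hom_ideal_def)
      then consider "a1 \<in> I" | "b1 \<in> I" using prime h by blast
      then show ?thesis
      proof cases
        case 1
        have "a2 * b = a * b - b * a1" by (simp add: a algebra_simps)
        then have "a2 * b \<in> I" using addsub_diff[OF as Suc.prems(4) is_ideal_mult[OF id 1]] by simp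
        then have "a2 \<in> I \<or> b \<in> I" using Suc.IH[of m1 k2 a2 b] h Suc.prems(1,3) k by simp
        then show ?thesis using addsub_add[OF as 1] a by auto
      next
        case 2
        have "a * b2 = a * b - a * b1" by (simp add: b algebra_simps)
        then have "a * b2 \<in> I" using addsub_diff[OF as Suc.prems(4) is_ideal_mult[OF id 2]] by simp
        then have "a \<in> I \<or> b2 \<in> I" using Suc.IH[of k1 m2 a b2] h Suc.prems(1,2) k by simp
        then show ?thesis using addsub_add[OF as 2] b by auto
      qed
    qed
  qed
  moreover have "\<exists>k. r \<in> hpolys {..<int k}" for r :: "('n \<Rightarrow>\<^sub>0 nat) \<Rightarrow>\<^sub>0 'k"
  proof -
    obtain m where "r \<in> hpolys {..int m}" using exists_degree_bound by blast
    then show ?thesis by (intro exI[of _ "Suc m"]) (auto simp: hpolys_def)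
  qed
  ultimately show ?thesis using id I(2) unfolding prime_ideal_def by metis
qed

section \<open>Hilbert functions of homogeneous ideals\<close>

text \<open>The dimension of the part of \<open>R/I\<close> with degrees in \<open>D\<close>, if \<open>I\<close> is homogeneous; for \<open>D = {..m}\<close> and
  arbitrary \<open>I\<close>, the dimension of the image of the polynomials of degree at most \<open>m\<close>.\<close>

definition hilbert_fun :: "int set \<Rightarrow> ('p::prime_card, 'n::finite) poly_ring set \<Rightarrow> int" where
  "hilbert_fun D I = int (ldim CARD('p) (hpolys D :: ('p, 'n) poly_ring set))
     - int (ldim CARD('p) (I \<inter> hpolys D))"

lemma hilbert_fun_antimono:
  fixes I J :: "('p::prime_card, 'n::finite) poly_ring set"
  assumes "addsub I" "addsub J" "I \<subseteq> J" "\<And>i. i \<in> D \<Longrightarrow> i \<le> int m"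
  shows "hilbert_fun D J \<le> hilbert_fun D I"
proof -
  have "ldim CARD('p) (I \<inter> hpolys D) \<le> ldim CARD('p) (J \<inter> hpolys D)"
    using assms by (intro ldim_mono addsub_Int addsub_hpolys) (auto simp: finite_hpolys[OF assms(4)])
  then show ?thesis by (simp add: hilbert_fun_def)
qed

text \<open>Counts the exact sequence \<open>0 \<rightarrow> R/(I : a)(-e) \<rightarrow> R/I
  \<rightarrow> R/(I + aR) \<rightarrow> 0\<close>, whose first map is multiplication by
  \<open>a\<close>.\<close>

lemma hilbert_fun_adjoin:
  fixes I :: "('p::prime_card, 'n::finite) poly_ring set"
  assumes I: "hom_ideal I" and a: "a \<in> hpolys {int e}" and D: "\<And>i. i \<in> D \<Longrightarrow> i \<le> int m"
  shows "hilbert_fun D I = hilbert_fun D (ideal_adjoin I a)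
    + hilbert_fun {i. i + int e \<in> D} (ideal_quotient I a)"
proof -
  let ?E = "{i. i + int e \<in> D}"
  have E: "i \<le> int m" if "i \<in> ?E" for i using that D[of "i + int e"] by simp
  have L: "addsub I" "\<And>u. u \<in> I \<Longrightarrow> restr D u \<in> I"
    using I by (auto simp: hom_ideal_def is_ideal_def)
  have "{u \<in> I. restr D u = u} \<subseteq> hpolys D" by (auto simp: mem_hpolys_iff)
  then have fin: "finite {u \<in> I. restr D u = u}"
    using finite_subset finite_hpolys(1)[OF D] by blast
  have *: "ideal_adjoin I a \<inter> hpolys D = {x. (\<exists>r. \<exists>u\<in>I. x = a * r + u) \<and> restr D x = x}"
    "ideal_quotient I a \<inter> hpolys ?E = {r \<in> hpolys ?E. a * r \<in> I}"
    "I \<inter> hpolys D = {u \<in> I. restr D u = u}"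
    by (auto simp: ideal_adjoin_def ideal_quotient_def mem_hpolys_iff)
  have "ldim CARD('p) (ideal_adjoin I a \<inter> hpolys D) + ldim CARD('p) (ideal_quotient I a \<inter> hpolys ?E)
     = ldim CARD('p) (hpolys ?E :: ('p, 'n) poly_ring set) + ldim CARD('p) (I \<inter> hpolys D)"
    unfolding *
    by (rule ldim_graded_extension[OF prime_card, where f = "\<lambda>r. a * r" and \<rho> = "restr D"])
       (use a E L fin in \<open>simp_all add: distrib_left restr_add restr_restr restr_mult\<close>)
  then show ?thesis by (simp add: hilbert_fun_def)
qed

lemma hpolys_zero: "hpolys {0} = range (single 0)"
proof (intro equalityI subsetI)
  fix r :: "('n::finite \<Rightarrow>\<^sub>0 nat) \<Rightarrow>\<^sub>0 'k::zero"
  assume r: "r \<in> hpolys {0}"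
  have "r = single 0 (lookup r 0)"
  proof (rule poly_mapping_eqI)
    fix v
    have "v \<notin> keys r" if "v \<noteq> 0" using that r by (auto simp: hpolys_def exp_deg_eq_zero_iff)
    then show "lookup r v = lookup (single 0 (lookup r 0)) v"
      by (auto simp: lookup_single when_def in_keys_iff)
  qed
  then show "r \<in> range (single 0)" by blast
qed (auto simp: hpolys_def split: if_splits)

lemma hpolys_neg:
  fixes D :: "int set"
  assumes "\<And>i. i \<in> D \<Longrightarrow> i < 0"
  shows "hpolys D = {0 :: ('n::finite \<Rightarrow>\<^sub>0 nat) \<Rightarrow>\<^sub>0 'k::zero}"
proof -
  have "int (exp_deg v) \<notin> D" for v :: "'n \<Rightarrow>\<^sub>0 nat"
    using assms[of "int (exp_deg v)"] by auto
  then have "keys r = {}" if "r \<in> hpolys D" for r :: "('n \<Rightarrow>\<^sub>0 nat) \<Rightarrow>\<^sub>0 'k"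
    using that by (auto simp: hpolys_def)
  moreover have "0 \<in> hpolys D" by (simp add: hpolys_def)
  ultimately show ?thesis by (auto simp: keys_eq_empty)
qed

lemma hilbert_fun_neg:
  fixes I :: "('p::prime_card, 'n::finite) poly_ring set"
  assumes "addsub I" "\<And>i. i \<in> D \<Longrightarrow> i < 0"
  shows "hilbert_fun D I = 0"
proof -
  have "I \<inter> {0} = {0}" using addsub_zero[OF assms(1)] by auto
  then show ?thesis by (simp add: hilbert_fun_def hpolys_neg[OF assms(2)] ldim_singleton)
qed

definition hilbert_fls :: "('p::prime_card, 'n::finite) poly_ring set \<Rightarrow> rat fls" where
  "hilbert_fls I = Abs_fls (\<lambda>i. of_int (hilbert_fun {i} I))"

lemma hilbert_fls_nth: "addsub I \<Longrightarrow> fls_nth (hilbert_fls I) i = of_int (hilbert_fun {i} I)"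
  unfolding hilbert_fls_def by (rule nth_Abs_fls_lower_bound[of 0]) (auto intro!: hilbert_fun_neg)

lemma hilbert_fls_adjoin:
  fixes I :: "('p::prime_card, 'n::finite) poly_ring set"
  assumes "hom_ideal I" "a \<in> hpolys {int e}"
  shows "hilbert_fls I = hilbert_fls (ideal_adjoin I a)
    + fls_shift (- int e) (hilbert_fls (ideal_quotient I a))"
proof (rule fls_eqI)
  fix i
  have add: "addsub I" "addsub (ideal_adjoin I a)" "addsub (ideal_quotient I a)"
    using assms by (auto intro!: is_ideal_addsub is_ideal_adjoin is_ideal_quotient simp: hom_ideal_def)
  have "{j. j + int e \<in> {i}} = {i - int e}" by auto
  then have "hilbert_fun {i} I = hilbert_fun {i} (ideal_adjoin I a)
      + hilbert_fun {i - int e} (ideal_quotient I a)"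
    using hilbert_fun_adjoin[OF assms, of "{i}" "nat i"] by simp
  then show "fls_nth (hilbert_fls I) i = fls_nth (hilbert_fls (ideal_adjoin I a)
      + fls_shift (- int e) (hilbert_fls (ideal_quotient I a))) i"
    by (simp add: hilbert_fls_nth add)
qed

lemma ldim_UNIV: "ldim CARD('p) (UNIV :: 'p::prime_card mod_ring set) = 1"
  by (rule ldim_card_power[OF prime_card]) simp

lemma addsub_UNIV: "addsub UNIV"
  by (simp add: addsub_def)

text \<open>Reading off the constant term identifies the quotient with the ground field, placed in
  degree 0.\<close>

lemma hilbert_fun_irrelevant_ideal:
  fixes I :: "('p::prime_card, 'n::finite) poly_ring set"
  assumes I: "I = {r. lookup r 0 = 0}" and D: "\<And>i. i \<in> D \<Longrightarrow> i \<le> int m"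
  shows "hilbert_fun D I = (if 0 \<in> D then 1 else 0)"
proof -
  let ?p = "CARD('p)" and ?H = "hpolys D :: ('p, 'n) poly_ring set"
  have "ldim ?p ?H = ldim ?p ((\<lambda>r. lookup r 0) ` ?H) + ldim ?p {r \<in> ?H. lookup r 0 = 0}"
    by (rule ldim_rank_nullity[OF prime_card]) (auto simp: lookup_add addsub_hpolys finite_hpolys[OF D])
  moreover have "{r \<in> ?H. lookup r 0 = 0} = I \<inter> ?H" using I by auto
  moreover have "(\<lambda>r. lookup r 0) ` ?H = (if 0 \<in> D then UNIV else {0})"
  proof (cases "0 \<in> D")
    case True
    have "c \<in> (\<lambda>r. lookup r 0) ` ?H" for c
      by (rule image_eqI[of _ _ "single 0 c"]) (use True in \<open>auto simp: hpolys_def\<close>)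
    then show ?thesis using True by auto
  next
    case False
    then have "lookup r 0 = 0" if "r \<in> ?H" for r
      using that by (force simp: hpolys_def in_keys_iff)
    moreover have "0 \<in> ?H" by (simp add: hpolys_def)
    ultimately show ?thesis using False by force
  qed
  ultimately show ?thesis by (simp add: hilbert_fun_def ldim_UNIV ldim_singleton)
qed

lemma var_in_hpolys: "single (single i 1) 1 \<in> hpolys {int 1}"
  by (simp add: hpolys_def)

lemma positive_pole_one: "positive_pole 0 1"
  unfolding positive_pole_def laurent_pole_def by (intro exI[of _ 1]) (auto intro: exI[of _ 1])

text \<open>All degrees up to \<open>m\<close> are taken together, so that the exponent is the
  dimension itself and not one less; this also makes sense for ideals that are not
  homogeneous.\<close>

definition dimension_bound :: "nat \<Rightarrow> ('p::prime_card, 'n::finite) poly_ring set \<Rightarrow> bool" where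
  "dimension_bound d I \<longleftrightarrow> (\<exists>C::nat. \<forall>m::nat. hilbert_fun {..int m} I \<le> int (C * (m + 1) ^ d))"

lemma dimension_bound_adjoin:
  fixes I :: "('p::prime_card, 'n::finite) poly_ring set"
  assumes "hom_ideal I" "a \<in> hpolys {int e}"
    and "dimension_bound d1 (ideal_adjoin I a)" "dimension_bound d2 (ideal_quotient I a)"
  shows "dimension_bound (max d1 d2) I"
proof -
  obtain C1 C2 :: nat where
    C: "\<And>m. hilbert_fun {..int m} (ideal_adjoin I a) \<le> int (C1 * (m + 1) ^ d1)"
       "\<And>m. hilbert_fun {..int m} (ideal_quotient I a) \<le> int (C2 * (m + 1) ^ d2)"
    using assms(3,4) unfolding dimension_bound_def by blast
  have "hilbert_fun {..int m} I \<le> int ((C1 + C2) * (m + 1) ^ max d1 d2)" for m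
  proof -
    have eq: "{i. i + int e \<in> {..int m}} = {..int m - int e}" by auto
    \<comment> \<open>The contribution of \<open>I : a\<close> is cut off at \<open>m - e\<close>;
      for \<open>e > m\<close> only negative degrees remain and it vanishes.\<close>
    have "hilbert_fun {..int m - int e} (ideal_quotient I a) \<le> int (C2 * (m + 1) ^ d2)"
    proof (cases "e \<le> m")
      case True
      then have "hilbert_fun {..int m - int e} (ideal_quotient I a) \<le> int (C2 * (m - e + 1) ^ d2)"
        using C(2)[of "m - e"] by (simp add: of_nat_diff)
      also have "\<dots> \<le> int (C2 * (m + 1) ^ d2)"
        by (subst of_nat_le_iff) (intro mult_left_mono power_mono, auto)
      finally show ?thesis .
    next
      case False
      have "addsub (ideal_quotient I a)"
        using assms(1) by (intro is_ideal_addsub is_ideal_quotient) (simp add: hom_ideal_def)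
      then have "hilbert_fun {..int m - int e} (ideal_quotient I a) = 0"
        using False by (intro hilbert_fun_neg) auto
      then show ?thesis by simp
    qed
    then have "hilbert_fun {..int m} I \<le> int (C1 * (m + 1) ^ d1) + int (C2 * (m + 1) ^ d2)"
      using hilbert_fun_adjoin[OF assms(1,2), of "{..int m}" m] C(1)[of m] unfolding eq by simp
    also have "\<dots> \<le> int (C1 * (m + 1) ^ max d1 d2) + int (C2 * (m + 1) ^ max d1 d2)"
      by (intro add_mono of_nat_mono mult_left_mono power_increasing) auto
    finally show ?thesis by (simp add: algebra_simps)
  qed
  then show ?thesis unfolding dimension_bound_def by blast
qed

text \<open>By \<open>I : a = I\<close>, multiplication by \<open>a\<close> embeds the quotient into
  itself with cokernel given by \<open>I + aR\<close>. Hence the increments of the cumulative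
  Hilbert function grow with exponent \<open>d\<close>, and summing them up costs one more
  power.\<close>

lemma dimension_bound_Suc:
  fixes I :: "('p::prime_card, 'n::finite) poly_ring set"
  assumes "hom_ideal I" "a \<in> hpolys {int 1}" "ideal_quotient I a = I"
    and "dimension_bound d (ideal_adjoin I a)"
  shows "dimension_bound (Suc d) I"
proof -
  obtain C :: nat where C: "\<And>m. hilbert_fun {..int m} (ideal_adjoin I a) \<le> int (C * (m + 1) ^ d)"
    using assms(4) unfolding dimension_bound_def by blast
  have add: "addsub I" using assms(1) by (simp add: hom_ideal_def is_ideal_def)
  have eq: "{i. i + int 1 \<in> {..int m}} = {..int m - 1}" for m by auto
  have step: "hilbert_fun {..int m} I = hilbert_fun {..int m} (ideal_adjoin I a) + hilbert_fun {..int m - 1} I" for m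
    using hilbert_fun_adjoin[OF assms(1,2), of "{..int m}" m] unfolding eq assms(3) by simp
  have "hilbert_fun {..int m} I \<le> int (C * (m + 1) ^ Suc d)" for m
  proof (induction m)
    case 0
    show ?case using step[of 0] C[of 0] hilbert_fun_neg[OF add, of "{..-1}"] by simp
  next
    case (Suc m)
    have "hilbert_fun {..int (Suc m)} I \<le> int (C * (Suc m + 1) ^ d) + int (C * (m + 1) ^ Suc d)"
      using step[of "Suc m"] C[of "Suc m"] Suc by simp
    also have "\<dots> \<le> int (C * (Suc m + 1) ^ d) + int (C * ((m + 1) * (Suc m + 1) ^ d))"
      unfolding power_Suc by (intro add_left_mono of_nat_mono mult_left_mono power_mono) auto
    also have "\<dots> = int (C * (Suc m + 1) ^ Suc d)"
      by (simp add: algebra_simps)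
    finally show ?case .
  qed
  then show ?thesis unfolding dimension_bound_def by blast
qed

text \<open>Noetherian induction. If \<open>ab \<in> I\<close> with homogeneous \<open>a, b \<notin> I\<close>, then \<open>R/I\<close> is an extension of
  \<open>R/(I + aR)\<close> by a twist of \<open>R/(I : a)\<close>, and both ideals are strictly larger. Otherwise \<open>I\<close> is prime;
  if some variable \<open>x\<close> is not in \<open>I\<close>, it is a nonzerodivisor modulo \<open>I\<close>, so that passing to
  \<open>I + xR\<close> lowers the order of the pole by one and a chain of primes above \<open>I + xR\<close> can be extended
  by \<open>I\<close>.\<close>

lemma hom_ideal_dimension:
  fixes I :: "('p::prime_card, 'n::finite) poly_ring set"
  assumes "hom_ideal I" "1 \<notin> I"
  shows "\<exists>d. positive_pole d (hilbert_fls I) \<and> dimension_bound d I \<and> chain_of_primes I d"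
  using assms
proof (induction I rule: wf_induct_rule[OF wf_ideals])
  case (1 I)
  have id: "is_ideal I" using 1(2) by (simp add: hom_ideal_def)
  note as = is_ideal_addsub[OF id]
  have IH: "\<exists>d. positive_pole d (hilbert_fls J) \<and> dimension_bound d J \<and> chain_of_primes J d"
    if "hom_ideal J" "1 \<notin> J" "I \<subset> J" for J
    using 1(1)[of J] that id by (simp add: hom_ideal_def)
  show ?case
  proof (cases "prime_ideal I")
    case False
    then obtain a b e e' where ab: "a \<in> hpolys {int e}" "b \<in> hpolys {int e'}" "a * b \<in> I" "a \<notin> I" "b \<notin> I"
      using hom_ideal_prime[OF 1(2,3)] by blast
    let ?J = "ideal_adjoin I a" and ?K = "ideal_quotient I a"
    have "1 \<notin> ?J"
    proof
      assume "1 \<in> ?J"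
      then obtain r u where "1 = a * r + u" "u \<in> I" by (auto simp: ideal_adjoin_def)
      moreover from this have "b = r * (a * b) + b * u"
        by (metis mult.commute mult.left_commute mult.right_neutral distrib_left)
      ultimately show False
        using ab(3,5) is_ideal_mult[OF id] addsub_add[OF as] by metis
    qed
    moreover have "I \<subset> ?J" using subset_ideal_adjoin mem_ideal_adjoin[OF id] ab(4) by blast
    ultimately obtain d1 where d1: "positive_pole d1 (hilbert_fls ?J)" "dimension_bound d1 ?J" "chain_of_primes ?J d1"
      using IH[OF hom_ideal_adjoin[OF 1(2) ab(1)]] by blast
    have "1 \<notin> ?K" using ab(4) by (simp add: ideal_quotient_def)
    moreover have "b \<in> ?K" using ab(3) by (simp add: ideal_quotient_def)
    then have "I \<subset> ?K" using subset_ideal_quotient[OF id] ab(5) by blast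
    ultimately obtain d2 where d2: "positive_pole d2 (hilbert_fls ?K)" "dimension_bound d2 ?K" "chain_of_primes ?K d2"
      using IH[OF hom_ideal_quotient[OF 1(2) ab(1)]] by blast
    have "positive_pole (max d1 d2) (hilbert_fls I)"
      unfolding hilbert_fls_adjoin[OF 1(2) ab(1)] by (intro positive_pole_add positive_pole_shift d1 d2)
    moreover have "dimension_bound (max d1 d2) I"
      by (rule dimension_bound_adjoin[OF 1(2) ab(1) d1(2) d2(2)])
    moreover have "chain_of_primes I (max d1 d2)"
      using chain_of_primes_mono[OF d1(3) subset_ideal_adjoin]
        chain_of_primes_mono[OF d2(3) subset_ideal_quotient[OF id]] by (simp add: max_def)
    ultimately show ?thesis by blast
  next
    case prime: True
    show ?thesis
    proof (cases "\<forall>i. single (single i 1) 1 \<in> I")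
      case True
      have "r \<in> I" if "lookup r 0 = 0" for r
      proof -
        have "single v (lookup r v) \<in> I" if "v \<in> keys r" for v
        proof -
          have "v \<noteq> 0" using that \<open>lookup r 0 = 0\<close> by (auto simp: in_keys_iff)
          then obtain i where i: "lookup v i \<noteq> 0" by (metis poly_mapping_eqI lookup_zero)
          have "v = (v - single i 1) + single i 1"
            using i by (intro poly_mapping_eqI) (auto simp: lookup_add lookup_minus lookup_single when_def)
          then have "single v (lookup r v) = single (v - single i 1) (lookup r v) * single (single i 1) 1"
            by (metis mult_single mult.right_neutral)
          then show ?thesis using True is_ideal_mult[OF id] by metis
        qed
        then have "(\<Sum>v\<in>keys r. single v (lookup r v)) \<in> I" by (rule addsub_sum[OF as])
        then show ?thesis by (simp add: sum_single_lookup)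
      qed
      \<comment> \<open>By homogeneity \<open>I\<close> contains the constant term of each of its
        elements, and a nonzero constant is a unit.\<close>
      moreover have "lookup r 0 = 0" if "r \<in> I" for r
      proof (rule ccontr)
        assume "lookup r 0 \<noteq> 0"
        moreover obtain c where c: "restr {0} r = single 0 c"
          using restr_in_hpolys[of "{0}" r] unfolding hpolys_zero by blast
        moreover have "lookup r 0 = c" using arg_cong[OF c, of "\<lambda>r. lookup r 0"] by (simp add: lookup_restr)
        ultimately have "single 0 (inverse c) * restr {0} r = 1" by (simp add: mult_single)
        moreover have "restr {0} r \<in> I" using that 1(2) by (simp add: hom_ideal_def)
        ultimately show False using 1(3) is_ideal_mult[OF id] by metis
      qed
      ultimately have I: "I = {r. lookup r 0 = 0}" by blast
      have "hilbert_fls I = 1"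
      proof (rule fls_eqI)
        fix i show "fls_nth (hilbert_fls I) i = fls_nth 1 i"
          using hilbert_fun_irrelevant_ideal[OF I, of "{i}" "nat i"] by (simp add: hilbert_fls_nth[OF as])
      qed
      moreover have "dimension_bound 0 I"
        unfolding dimension_bound_def
      proof (intro exI[of _ 1] allI)
        fix m show "hilbert_fun {..int m} I \<le> int (1 * (m + 1) ^ 0)"
          using hilbert_fun_irrelevant_ideal[OF I, of "{..int m}" m] by simp
      qed
      moreover have "chain_of_primes I 0"
        using prime by (auto simp: chain_of_primes_def intro!: exI[of _ "\<lambda>_. I"])
      ultimately show ?thesis using positive_pole_one by (intro exI[of _ 0]) simp
    next
      case False
      then obtain i where i: "single (single i 1) 1 \<notin> I" by blast
      define x :: "('p, 'n) poly_ring" where "x = single (single i 1) 1"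
      have x: "x \<notin> I" "x \<in> hpolys {int 1}" using i var_in_hpolys by (simp_all add: x_def)
      let ?J = "ideal_adjoin I x"
      have q: "ideal_quotient I x = I"
        using prime x(1) subset_ideal_quotient[OF id, of x] by (auto simp: ideal_quotient_def prime_ideal_def)
      have "1 \<notin> ?J"
      proof
        assume "1 \<in> ?J"
        then obtain r u where ru: "1 = x * r + u" "u \<in> I" by (auto simp: ideal_adjoin_def)
        \<comment> \<open>A multiple of \<open>x\<close> has no part of degree 0, so
          \<open>1\<close> would be the degree-0 part of \<open>u\<close> and lie in
          \<open>I\<close>.\<close>
        have "restr {i. i + int 1 \<in> {0}} r = 0"
          by (rule poly_mapping_eqI) (simp add: lookup_restr when_def)
        then have "restr {0} (x * r) = 0" unfolding restr_mult[OF x(2)] by simp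
        moreover have "restr {0} (1 :: ('p, 'n) poly_ring) = 1"
          using restr_single[of "{0}" "0 :: 'n \<Rightarrow>\<^sub>0 nat" "1 :: 'p mod_ring"] by simp
        ultimately have "1 = restr {0} u" using arg_cong[OF ru(1), of "restr {0}"] by (simp add: restr_add)
        then show False using ru(2) 1(2,3) by (metis hom_ideal_def)
      qed
      moreover have lt: "I \<subset> ?J" using subset_ideal_adjoin mem_ideal_adjoin[OF id] x(1) by blast
      ultimately obtain d where d: "positive_pole d (hilbert_fls ?J)" "dimension_bound d ?J" "chain_of_primes ?J d"
        using IH[OF hom_ideal_adjoin[OF 1(2) x(2)]] by blast
      have "hilbert_fls I = hilbert_fls ?J + hilbert_fls I * fls_X"
        using hilbert_fls_adjoin[OF 1(2) x(2)] by (simp add: q fls_X_times_conv_shift)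
      then have "hilbert_fls I * (1 - fls_X) = hilbert_fls ?J" by (simp add: algebra_simps)
      then have "positive_pole (Suc d) (hilbert_fls I)" using d(1) by (intro positive_pole_Suc) simp
      moreover have "dimension_bound (Suc d) I" by (rule dimension_bound_Suc[OF 1(2) x(2) q d(2)])
      moreover have "chain_of_primes I (Suc d)" by (rule chain_of_primes_Suc[OF prime lt d(3)])
      ultimately show ?thesis by blast
    qed
  qed
qed

section \<open>Chains of primes and growth\<close>

lemma hpolys_upto_mult:
  fixes a r :: "('n::finite \<Rightarrow>\<^sub>0 nat) \<Rightarrow>\<^sub>0 'k::comm_ring_1"
  assumes "a \<in> hpolys {..int e}" "r \<in> hpolys {..m - int e}"
  shows "a * r \<in> hpolys {..m}"
  using assms keys_mult[of a r] by (fastforce simp: hpolys_def exp_deg_add)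

lemma addsub_sum_map:
  assumes f: "\<And>x y. f (x + y) = f x + f y" and S: "addsub S" and T: "addsub T"
  shows "addsub {f s + t | s t. s \<in> S \<and> t \<in> T}"
  unfolding addsub_def
proof (intro conjI ballI)
  have "f 0 = 0" using f[of 0 0] by simp
  then show "0 \<in> {f s + t | s t. s \<in> S \<and> t \<in> T}" 
    using addsub_zero[OF S] addsub_zero[OF T] by (auto intro!: exI[of _ 0])
  fix x y assume "x \<in> {f s + t | s t. s \<in> S \<and> t \<in> T}" "y \<in> {f s + t | s t. s \<in> S \<and> t \<in> T}"
  then obtain s t s' t' where "x = f s + t" "y = f s' + t'" "s \<in> S" "t \<in> T" "s' \<in> S" "t' \<in> T" by auto
  moreover from this have "x - y = f (s - s') + (t - t')"
    using f[of "s - s'" s'] by (simp add: algebra_simps)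
  ultimately show "x - y \<in> {f s + t | s t. s \<in> S \<and> t \<in> T}"
    using addsub_diff[OF S, of s s'] addsub_diff[OF T, of t t'] by blast
qed

text \<open>Nonzero constants are units, so the line of constants survives in the quotient.\<close>

lemma hilbert_fun_pos:
  fixes I :: "('p::prime_card, 'n::finite) poly_ring set"
  assumes I: "is_ideal I" "1 \<notin> I"
  shows "1 \<le> hilbert_fun {..int m} I"
proof -
  let ?p = "CARD('p)" and ?H = "hpolys {..int m} :: ('p, 'n) poly_ring set"
  have fin: "finite ?H" by (rule finite_hpolys(1)[of _ m]) auto
  have as: "addsub (I \<inter> ?H)" by (intro addsub_Int is_ideal_addsub I addsub_hpolys)
  let ?U = "{single 0 c + t | c t. c \<in> UNIV \<and> t \<in> I \<inter> ?H}"
  have "ldim ?p ?U + ldim ?p {c \<in> UNIV. single 0 c \<in> I \<inter> ?H}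
      = ldim ?p (UNIV :: 'p mod_ring set) + ldim ?p (I \<inter> ?H)"
    by (rule ldim_sum_map[OF prime_card]) (use fin as in \<open>auto simp: single_add addsub_UNIV\<close>)
  moreover have "c = 0" if "single 0 c \<in> I" for c
  proof (rule ccontr)
    assume "c \<noteq> 0"
    then have "single 0 (inverse c) * single 0 c = (1 :: ('p, 'n) poly_ring)" by (simp add: mult_single)
    then show False using is_ideal_mult[OF I(1) that] I(2) by metis
  qed
  then have "{c \<in> UNIV. single 0 c \<in> I \<inter> ?H} = {0}"
    using addsub_zero[OF as] by auto
  moreover have "ldim ?p ?U \<le> ldim ?p ?H"
  proof (rule ldim_mono[OF addsub_sum_map _ addsub_hpolys fin])
    have "single 0 c \<in> ?H" for c by (simp add: hpolys_def)
    then show "?U \<subseteq> ?H" using addsub_add[OF addsub_hpolys] by blast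
  qed (use as in \<open>simp_all add: single_add addsub_UNIV\<close>)
  ultimately show ?thesis by (simp add: hilbert_fun_def ldim_UNIV ldim_singleton)
qed

text \<open>Multiplication by \<open>a \<in> Q - P\<close> is injective modulo \<open>P\<close> with image in \<open>Q\<close>.\<close>

lemma hilbert_fun_prime_step:
  fixes P Q :: "('p::prime_card, 'n::finite) poly_ring set"
  assumes P: "prime_ideal P" and Q: "is_ideal Q" and PQ: "P \<subseteq> Q"
    and a: "a \<in> Q" "a \<notin> P" "a \<in> hpolys {..int e}"
  shows "hilbert_fun {..int m - int e} P + hilbert_fun {..int m} Q \<le> hilbert_fun {..int m} P"
proof -
  let ?p = "CARD('p)" and ?H = "hpolys {..int m} :: ('p, 'n) poly_ring set"
    and ?E = "hpolys {..int m - int e} :: ('p, 'n) poly_ring set"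
  have fin: "finite ?H" "finite ?E" by (rule finite_hpolys(1)[of _ m]; auto)+
  have idP: "is_ideal P" using P by (simp add: prime_ideal_def)
  have as: "addsub (P \<inter> ?H)" "addsub (Q \<inter> ?H)" by (intro addsub_Int is_ideal_addsub idP Q addsub_hpolys)+
  let ?U = "{a * s + t | s t. s \<in> ?E \<and> t \<in> P \<inter> ?H}"
  have "ldim ?p ?U + ldim ?p {s \<in> ?E. a * s \<in> P \<inter> ?H} = ldim ?p ?E + ldim ?p (P \<inter> ?H)"
    by (rule ldim_sum_map[OF prime_card]) (use fin as in \<open>auto simp: distrib_left addsub_hpolys\<close>)
  moreover have "{s \<in> ?E. a * s \<in> P \<inter> ?H} = P \<inter> ?E"
    using P a(2) is_ideal_mult[OF idP] hpolys_upto_mult[OF a(3)] by (auto simp: prime_ideal_def)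
  moreover have "ldim ?p ?U \<le> ldim ?p (Q \<inter> ?H)"
  proof (rule ldim_mono[OF addsub_sum_map _ as(2)])
    have "a * s \<in> Q" for s using is_ideal_mult[OF Q a(1), of s] by (simp add: mult.commute)
    then show "?U \<subseteq> Q \<inter> ?H"
      using PQ hpolys_upto_mult[OF a(3)] by (auto intro!: addsub_add[OF is_ideal_addsub[OF Q]] addsub_add[OF addsub_hpolys])
  qed (use as fin in \<open>simp_all add: distrib_left addsub_hpolys\<close>)
  ultimately show ?thesis by (simp add: hilbert_fun_def)
qed

text \<open>At multiples of a step \<open>E\<close>, \<open>hilbert_fun_prime_step\<close> becomes
  the recurrence of Pascal's triangle and yields binomial coefficients as lower bounds. All links of
  the chain must share one \<open>E\<close>, hence the claim for every sufficiently large
  \<open>E\<close>.\<close>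

lemma hilbert_fun_chain:
  fixes P :: "nat \<Rightarrow> ('p::prime_card, 'n::finite) poly_ring set"
  assumes "\<And>i. i \<le> k \<Longrightarrow> prime_ideal (P i)" "\<And>i. i < k \<Longrightarrow> P i \<subset> P (Suc i)"
  shows "\<exists>E0. \<forall>E\<ge>E0. \<forall>j. int (j choose k) \<le> hilbert_fun {..int (E * j)} (P 0)"
  using assms
proof (induction k arbitrary: P)
  case 0
  then show ?case using hilbert_fun_pos[of "P 0"] by (auto simp: prime_ideal_def simp del: of_nat_mult)
next
  case (Suc k)
  have "\<exists>E0. \<forall>E\<ge>E0. \<forall>j. int (j choose k) \<le> hilbert_fun {..int (E * j)} (P (Suc 0))"
    by (rule Suc.IH[of "\<lambda>i. P (Suc i)"]) (use Suc.prems in auto)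
  then obtain E0 where E0: "\<And>E j. E \<ge> E0 \<Longrightarrow> int (j choose k) \<le> hilbert_fun {..int (E * j)} (P 1)"
    unfolding One_nat_def by blast
  obtain a where a: "a \<in> P 1" "a \<notin> P 0" using Suc.prems(2)[of 0] by auto
  obtain e where e: "a \<in> hpolys {..int e}" using exists_degree_bound by blast
  have P: "prime_ideal (P 0)" "is_ideal (P 1)" "P 0 \<subseteq> P 1"
    using Suc.prems(1)[of 0] Suc.prems(1)[of 1] Suc.prems(2)[of 0] by (auto simp: prime_ideal_def)
  have "int (j choose Suc k) \<le> hilbert_fun {..int (E * j)} (P 0)" if E: "E \<ge> max E0 e" for E j
  proof (induction j)
    case 0
    then show ?case using hilbert_fun_pos[of "P 0" 0] P(1) by (simp add: prime_ideal_def)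
  next
    case (Suc j)
    have "a \<in> hpolys {..int E}" using e E by (auto simp: hpolys_def)
    then have "hilbert_fun {..int (E * Suc j) - int E} (P 0) + hilbert_fun {..int (E * Suc j)} (P 1)
        \<le> hilbert_fun {..int (E * Suc j)} (P 0)"
      by (rule hilbert_fun_prime_step[OF P a])
    moreover have "int (E * Suc j) - int E = int (E * j)" by (simp add: algebra_simps)
    ultimately have "hilbert_fun {..int (E * j)} (P 0) + hilbert_fun {..int (E * Suc j)} (P 1)
        \<le> hilbert_fun {..int (E * Suc j)} (P 0)" by (simp only:)
    moreover have "int (Suc j choose k) \<le> hilbert_fun {..int (E * Suc j)} (P 1)"
      by (rule E0) (use E in simp)
    \<comment> \<open>Pascal's rule asks for \<open>j choose k\<close>, while \<open>P 1\<close> is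
      evaluated one index higher.\<close>
    moreover have "j choose k \<le> Suc j choose k" by (cases k) simp_all
    ultimately show ?case using Suc by simp
  qed
  then show ?case by blast
qed

text \<open>At \<open>j = k * t\<close> the binomial coefficient is at least \<open>t ^ k\<close>,
  while the right-hand side is at most a constant times \<open>t ^ d\<close>. For
  \<open>k > d\<close> that constant would bound every \<open>t \<ge> 1\<close>.\<close>

lemma binomial_growth:
  assumes "\<And>j. (j choose k) \<le> C * (E * j + 1) ^ d"
  shows "k \<le> d"
proof (rule ccontr)
  assume k: "\<not> k \<le> d"
  have *: "t \<le> C * (E * k + 1) ^ d" if t: "t \<ge> 1" for t
  proof -
    have "(real (k * t) / real k) ^ k \<le> real ((k * t) choose k)"
      using t by (intro binomial_ge_n_over_k_pow_k) simp
    then have "real (t ^ k) \<le> real ((k * t) choose k)" using k by simp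
    then have "t ^ k \<le> (k * t) choose k" by (simp only: of_nat_le_iff)
    also have "\<dots> \<le> C * (E * (k * t) + 1) ^ d" by (rule assms)
    also have "\<dots> \<le> C * ((E * k + 1) * t) ^ d"
      using t by (intro mult_left_mono power_mono) (auto simp: algebra_simps)
    finally have "t ^ k \<le> (C * (E * k + 1) ^ d) * t ^ d" by (simp only: power_mult_distrib mult.assoc)
    moreover have "t ^ Suc d \<le> t ^ k" using t k by (intro power_increasing) auto
    ultimately have "t * t ^ d \<le> (C * (E * k + 1) ^ d) * t ^ d"
      by (metis le_trans power_Suc)
    moreover have "t ^ d > 0" using t by simp
    ultimately show ?thesis by (simp only: mult_le_cancel2)
  qed
  from *[of "C * (E * k + 1) ^ d + 1"] show False by simp
qed

text \<open>The Hilbert function of the smallest prime in the chain is squeezed between a binomial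
  coefficient of order \<open>k\<close> and the Hilbert function of \<open>I\<close>.\<close>

lemma chain_of_primes_le:
  fixes I :: "('p::prime_card, 'n::finite) poly_ring set"
  assumes "addsub I" "dimension_bound d I" "chain_of_primes I k"
  shows "k \<le> d"
proof -
  obtain P where P: "\<And>i. i \<le> k \<Longrightarrow> prime_ideal (P i) \<and> I \<subseteq> P i" "\<And>i. i < k \<Longrightarrow> P i \<subset> P (Suc i)"
    using assms(3) unfolding chain_of_primes_def by blast
  obtain E where E: "\<And>j. int (j choose k) \<le> hilbert_fun {..int (E * j)} (P 0)"
    using hilbert_fun_chain[of k P] P by blast
  obtain C :: nat where C: "\<And>m. hilbert_fun {..int m} I \<le> int (C * (m + 1) ^ d)"
    using assms(2) unfolding dimension_bound_def by blast
  have "(j choose k) \<le> C * (E * j + 1) ^ d" for j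
  proof -
    have "addsub (P 0)" using P(1)[of 0] by (simp add: prime_ideal_def is_ideal_def)
    then have "hilbert_fun {..int (E * j)} (P 0) \<le> hilbert_fun {..int (E * j)} I"
      using assms(1) P(1)[of 0] by (intro hilbert_fun_antimono[of _ _ _ "E * j"]) auto
    then have "int (j choose k) \<le> int (C * (E * j + 1) ^ d)" using E[of j] C[of "E * j"] by linarith
    then show ?thesis by (simp only: of_nat_le_iff)
  qed
  then show ?thesis by (rule binomial_growth)
qed

text \<open>Exponents of degree at most \<open>m\<close> fit into a cube with \<open>m + 1\<close>
  values per variable. This crude bound already limits the dimension by the number of
  variables.\<close>

lemma dimension_bound_vars: "dimension_bound CARD('n) ({0} :: ('p::prime_card, 'n::finite) poly_ring set)"
  unfolding dimension_bound_def
proof (intro exI[of _ 1] allI)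
  fix m :: nat
  let ?H = "hpolys {..int m} :: ('p, 'n) poly_ring set"
  have "ldim CARD('p) ?H \<le> (m + 1) ^ CARD('n)"
    using finite_hpolys[of "{..int m}" m, where 'k = "'p mod_ring" and 'n = 'n] addsub_zero[OF addsub_hpolys[of "{..int m}"]]
    by (intro ldim_le[OF prime_card]) auto
  then have "int (ldim CARD('p) ?H) \<le> int ((m + 1) ^ CARD('n))" by (simp only: of_nat_le_iff)
  then show "hilbert_fun {..int m} ({0} :: ('p, 'n) poly_ring set) \<le> int (1 * (m + 1) ^ CARD('n))"
    unfolding hilbert_fun_def mult_1 by linarith
qed

lemma chain_of_primes_le_vars:
  assumes "chain_of_primes (I :: ('p::prime_card, 'n::finite) poly_ring set) k" "0 \<in> I"
  shows "k \<le> CARD('n)"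
  by (rule chain_of_primes_le[OF _ dimension_bound_vars chain_of_primes_mono[OF assms(1)]])
     (use assms in \<open>auto simp: addsub_def\<close>)

section \<open>Normal form in \<open>A\<close>\<close>

lemma frob_module_regular: "frob_module ((*) :: ('p::prime_card, 'n::finite) frob_alg \<Rightarrow> _)"
  by standard (simp_all add: algebra_simps)

text \<open>\<open>R \<oplus> \<F>\<^sub>A(A)\<close> becomes a left \<open>A\<close>-module by letting \<open>f\<close> send \<open>e\<close> to \<open>(0, (\<pi> e) \<epsilon>\<^sub>0)\<close>, where \<open>\<pi>\<close> is the
  natural map to \<open>A\<close> (\<open>nf_eval\<close> below). The orbit of \<open>(1, 0)\<close> then yields an inverse of \<open>\<pi>\<close>.\<close>

type_synonym ('p, 'n) normal_form = "('p, 'n) poly_ring \<times> (('n \<Rightarrow>\<^sub>0 nat) \<Rightarrow>\<^sub>0 ('p, 'n) frob_alg)"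

definition nf_eval :: "('p::prime_card, 'n::finite) normal_form \<Rightarrow> ('p, 'n) frob_alg" where
  "nf_eval e = poly_to_alg (fst e) + structure_map (*) (snd e)"

definition nf_smult :: "('p::prime_card, 'n::finite) poly_ring \<Rightarrow> ('p, 'n) normal_form \<Rightarrow> ('p, 'n) normal_form" where
  "nf_smult r e = (r * fst e, ext_smult (*) r (snd e))"

fun nf_gen :: "'n generator \<Rightarrow> ('p::prime_card, 'n::finite) normal_form \<Rightarrow> ('p, 'n) normal_form" where
  "nf_gen (GenX i) e = nf_smult (single (single i 1) 1) e"
| "nf_gen GenF e = (0, single 0 (nf_eval e))"

definition nf_act :: "('p::prime_card, 'n::finite) free_algebra \<Rightarrow> ('p, 'n) normal_form \<Rightarrow> ('p, 'n) normal_form" where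
  "nf_act a e = (\<Sum>w\<in>keys a. nf_smult (single 0 (lookup a w)) (foldr nf_gen (letters w) e))"

lemma nf_smult_add_left: "nf_smult (r + s) e = nf_smult r e + nf_smult s e"
  by (simp add: nf_smult_def distrib_right frob_module.ext_smult_add_left[OF frob_module_regular])

lemma nf_smult_add_right: "nf_smult r (e + e') = nf_smult r e + nf_smult r e'"
  by (simp add: nf_smult_def distrib_left frob_module.ext_smult_add_right[OF frob_module_regular])

lemma nf_smult_assoc: "nf_smult r (nf_smult s e) = nf_smult (r * s) e"
  by (simp add: nf_smult_def mult.assoc frob_module.ext_smult_assoc[OF frob_module_regular])

lemma nf_smult_zero [simp]: "nf_smult 0 e = 0" "nf_smult r 0 = 0"
  using nf_smult_add_left[of 0 0 e] nf_smult_add_right[of r 0 0] by simp_all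

lemma nf_smult_closed: "keys (snd (nf_smult r (e :: ('p::prime_card, 'n::finite) normal_form))) \<subseteq> exps_below CARD('p)"
  by (simp add: nf_smult_def frob_module.ext_smult_closed[OF frob_module_regular])

lemma nf_smult_commute: "nf_smult r (nf_smult s e) = nf_smult s (nf_smult r e)"
  by (simp add: nf_smult_assoc mult.commute)

lemma nf_eval_add: "nf_eval (e + e') = nf_eval e + nf_eval e'"
  by (simp add: nf_eval_def poly_to_alg_add frob_module.structure_map_add[OF frob_module_regular])

lemma nf_eval_zero [simp]: "nf_eval 0 = 0"
  using nf_eval_add[of 0 0] by simp

lemma nf_eval_smult: "nf_eval (nf_smult r e) = poly_to_alg r * nf_eval e"
  by (simp add: nf_eval_def nf_smult_def poly_to_alg_mult distrib_left
      frob_module.structure_map_smult[OF frob_module_regular])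

lemma poly_to_alg_const: "poly_to_alg (single 0 c) = alg_const c"
  by (simp add: poly_to_alg_single)

lemma nf_eval_gen: "nf_eval (nf_gen g e) = alg_gen g * nf_eval e"
proof (cases g)
  case (GenX i)
  then show ?thesis by (simp add: nf_eval_smult poly_to_alg_single alg_monom_single)
next
  case GenF
  then show ?thesis
    using frob_module.structure_map_single[OF frob_module_regular, of 0 "nf_eval e"]
    by (simp add: nf_eval_def)
qed

lemma nf_gen_add: "nf_gen g (e + e') = nf_gen g e + nf_gen g e'"
  by (cases g) (simp_all add: nf_smult_add_right nf_eval_add single_add)

lemma zero_in_exps_below: "0 \<in> exps_below CARD('p::prime_card)"
  using prime_card[where 'a = 'p] by (simp add: exps_below_def prime_gt_0_nat)

lemma nf_gen_const:
  fixes e :: "('p::prime_card, 'n::finite) normal_form"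
  shows "nf_gen g (nf_smult (single 0 c) e) = nf_smult (single 0 c) (nf_gen g e)"
proof (cases g)
  case (GenX i)
  then show ?thesis by (simp add: nf_smult_commute[of "single 0 c"])
next
  case GenF
  show ?thesis
    unfolding GenF nf_gen.simps nf_eval_smult poly_to_alg_const
    by (simp add: nf_smult_def frob_module.ext_smult_single[OF frob_module_regular] zero_in_exps_below)
qed

lemma nf_word_add: "foldr nf_gen w (e + e') = foldr nf_gen w e + foldr nf_gen w e'"
  by (induction w) (simp_all add: nf_gen_add)

lemma nf_word_const: "foldr nf_gen w (nf_smult (single 0 c) e) = nf_smult (single 0 c) (foldr nf_gen w e)"
  by (induction w) (simp_all add: nf_gen_const)

lemma nf_act_add: "nf_act (a + b) e = nf_act a e + nf_act b e"
  unfolding nf_act_def by (rule setsum_keys_plus_distrib) (simp_all add: single_add nf_smult_add_left)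

lemma nf_act_zero [simp]: "nf_act 0 e = 0"
  by (simp add: nf_act_def)

lemma nf_act_single: "nf_act (single w c) e = nf_smult (single 0 c) (foldr nf_gen (letters w) e)"
  by (simp add: nf_act_def)

lemma nf_act_add_right: "nf_act a (e + e') = nf_act a e + nf_act a e'"
  by (simp add: nf_act_def nf_word_add nf_smult_add_right sum.distrib)

lemma nf_act_mult: "nf_act (a * b) e = nf_act a (nf_act b e)"
proof (induction a rule: poly_mapping_additive_induct)
  case (single w c)
  show ?case
  proof (induction b rule: poly_mapping_additive_induct)
    case (single w' d)
    show ?case
      by (simp add: mult_single nf_act_single plus_free_monoid_def nf_word_const nf_smult_assoc)
  next
    case zero
    show ?case using nf_act_add_right[of "single w c" 0 0] by simp
  qed (simp_all add: distrib_left nf_act_add nf_act_add_right)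
qed (simp_all add: distrib_right nf_act_add)

lemma nf_act_diff: "nf_act (a - b) e = nf_act a e - nf_act b e"
  using nf_act_add[of "a - b" b e] by simp

lemma nf_smult_one: "keys (snd e) \<subseteq> exps_below CARD('p) \<Longrightarrow> nf_smult 1 (e :: ('p::prime_card, 'n::finite) normal_form) = e"
  by (simp add: nf_smult_def frob_module.ext_smult_one[OF frob_module_regular])

lemma nf_gen_closed: "keys (snd (nf_gen g (e :: ('p::prime_card, 'n::finite) normal_form))) \<subseteq> exps_below CARD('p)"
  using zero_in_exps_below[where 'p = 'p] by (cases g) (auto simp: nf_smult_closed[THEN subsetD])

lemma nf_act_gen: "nf_act (free_gen g) e = nf_gen g e"
  using nf_smult_one[OF nf_gen_closed[of g e]] by (simp add: free_gen_def nf_act_single)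

lemma nf_act_x_power:
  assumes "keys (snd e) \<subseteq> exps_below CARD('p)"
  shows "nf_act (free_gen (GenX i) ^ k) (e :: ('p::prime_card, 'n::finite) normal_form)
    = nf_smult (single (single i k) 1) e"
proof (induction k)
  case 0
  show ?case using nf_smult_one[OF assms]
    by (simp add: nf_act_single zero_free_monoid_def flip: single_one)
next
  case (Suc k)
  then show ?case
    by (simp add: nf_act_mult nf_act_gen nf_smult_assoc mult_single flip: single_add)
qed

text \<open>The \<open>x\<^sub>i\<close> act by commuting multiplications, and the truncation of
  exponents in the second component makes \<open>x\<^sub>i\<^sup>p\<close> vanish on every value of
  \<open>f\<close>. So the action descends from the free algebra to A.\<close>

lemma nf_act_ideal:
  assumes "a \<in> alg_ideal"
  shows "nf_act a e = (0 :: ('p::prime_card, 'n::finite) normal_form)"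
proof -
  \<comment> \<open>Quantifying over all \<open>e\<close> makes the annihilator a two-sided
    ideal.\<close>
  let ?K = "{a :: ('p, 'n) free_algebra. \<forall>e. nf_act a e = 0}"
  have "ideal ?K ring_of_class"
  proof (rule idealI[OF ring_ring_of_class])
    show "subgroup ?K (add_monoid (ring_of_class :: ('p, 'n) free_algebra ring))"
    proof (rule group.subgroupI)
      show "group (add_monoid (ring_of_class :: ('p, 'n) free_algebra ring))"
        using abelian_group.a_group[OF abelian_group_ring_of_class] .
      show "?K \<noteq> {}" by (auto intro: exI[of _ 0])
      fix a :: "('p, 'n) free_algebra" assume "a \<in> ?K"
      moreover have "inv\<^bsub>add_monoid ring_of_class\<^esub> a = - a"
        by (rule group.inv_equality)
           (use abelian_group.a_group[OF abelian_group_ring_of_class] in auto)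
      ultimately show "inv\<^bsub>add_monoid ring_of_class\<^esub> a \<in> ?K"
        using nf_act_diff[of 0 a] by simp
    qed (auto simp: nf_act_add)
    have "nf_act x 0 = 0" for x :: "('p, 'n) free_algebra" using nf_act_add_right[of x 0 0] by simp
    then show "x \<otimes>\<^bsub>ring_of_class\<^esub> a \<in> ?K" if "a \<in> ?K" for a x :: "('p, 'n) free_algebra"
      using that by (simp add: nf_act_mult del: split_paired_All)
    show "a \<otimes>\<^bsub>ring_of_class\<^esub> x \<in> ?K" if "a \<in> ?K" for a x :: "('p, 'n) free_algebra"
      using that by (simp add: nf_act_mult del: split_paired_All)
  qed
  moreover have "alg_relations \<subseteq> ?K"
  proof -
    have "nf_act (free_gen (GenX i) * free_gen (GenX j) - free_gen (GenX j) * free_gen (GenX i)) e = 0"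
      for i j and e :: "('p, 'n) normal_form"
      by (simp add: nf_act_diff nf_act_mult nf_act_gen) (rule nf_smult_commute)
    moreover have "nf_act (free_gen (GenX i) ^ CARD('p) * free_gen GenF) e = 0"
      for i and e :: "('p, 'n) normal_form"
    proof -
      have "single i CARD('p) \<notin> exps_below CARD('p)"
        by (auto simp: exps_below_def intro!: exI[of _ i])
      then have "nf_smult (single (single i CARD('p)) 1) (nf_gen GenF e) = 0"
        by (simp add: nf_smult_def frob_module.ext_smult_single[OF frob_module_regular] zero_prod_def)
      then show ?thesis
        using nf_act_x_power[OF nf_gen_closed[of GenF e], of i "CARD('p)"]
        by (simp add: nf_act_mult nf_act_gen)
    qed
    ultimately show ?thesis by (auto simp: alg_relations_def)
  qed
  ultimately have "alg_ideal \<subseteq> ?K"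
    unfolding alg_ideal_def genideal_def by blast
  then show ?thesis using assms by blast
qed

definition alg_act :: "('p::prime_card, 'n::finite) frob_alg \<Rightarrow> ('p, 'n) normal_form \<Rightarrow> ('p, 'n) normal_form" where
  "alg_act a = nf_act (rep_alg a)"

lemma alg_class_rep: "alg_class (rep_alg a) = a"
  by (rule Quotient3_abs_rep[OF Quotient3_frob_alg])

lemma alg_act_class: "alg_act (alg_class a) e = nf_act a e"
proof -
  have "rep_alg (alg_class a) - a \<in> alg_ideal"
    using alg_class_rep[of "alg_class a"] by (simp add: frob_alg.abs_eq_iff alg_rel_def)
  then show ?thesis
    using nf_act_ideal[of "rep_alg (alg_class a) - a" e] nf_act_diff[of "rep_alg (alg_class a)" a e] by (simp add: alg_act_def)
qed

lemma alg_act_mult: "alg_act (a * b) e = alg_act a (alg_act b e)"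
  by (metis alg_act_class alg_class_mult alg_class_rep nf_act_mult)

lemma alg_act_gen: "alg_act (alg_gen g) e = nf_gen g e"
  by (simp add: alg_gen_def alg_act_class nf_act_gen)

lemma alg_act_add: "alg_act (a + b) e = alg_act a e + alg_act b e"
  by (metis alg_act_class alg_class_add alg_class_rep nf_act_add)

text \<open>The map to A is A-linear. At \<open>e = (1, 0)\<close>, which it sends to 1, this
  recovers every \<open>a\<close> from its orbit point, so normal forms exist.\<close>

lemma nf_eval_alg_act:
  fixes a :: "('p::prime_card, 'n::finite) frob_alg"
  shows "nf_eval (alg_act a e) = a * nf_eval e"
proof -
  have "nf_eval (foldr nf_gen w e) = alg_class (single (Word w) 1) * nf_eval e" for w
  proof (induction w)
    case Nil
    show ?case by (simp add: alg_class_one flip: zero_free_monoid_def)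
  next
    case (Cons g w)
    have "single (Word (g # w)) (1 :: 'p mod_ring) = free_gen g * single (Word w) 1"
      by (simp add: free_gen_def mult_single plus_free_monoid_def)
    then show ?case using Cons by (simp add: nf_eval_gen alg_class_mult alg_gen_def mult.assoc)
  qed
  note word = this
  have "nf_eval (nf_act b e) = alg_class b * nf_eval e" for b
  proof (induction b rule: poly_mapping_additive_induct)
    case (single w c)
    have "single w c = single 0 c * single (Word (letters w)) 1" by (simp add: mult_single)
    then have "alg_class (single w c) = alg_const c * alg_class (single (Word (letters w)) 1)"
      by (metis alg_class_mult alg_const_def)
    then show ?case
      by (simp only: nf_act_single nf_eval_smult poly_to_alg_const word mult.assoc)
  qed (simp_all add: nf_act_add nf_eval_add alg_class_add alg_class_zero distrib_right)
  then show ?thesis by (metis alg_act_class alg_class_rep)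
qed

lemma alg_act_monom:
  assumes "keys (snd e) \<subseteq> exps_below CARD('p)"
  shows "alg_act (alg_monom v) (e :: ('p::prime_card, 'n::finite) normal_form) = nf_smult (single v 1) e"
proof -
  have "alg_act (alg_monom_on S v) e = nf_smult (single (\<Sum>i\<in>S. single i (lookup v i)) 1) e" if "finite S" for S
    using that
  proof (induction S rule: finite_induct)
    case empty
    show ?case using nf_smult_one[OF assms] alg_act_class[of 1 e] nf_act_x_power[OF assms, of undefined 0]
      by (simp add: alg_class_one)
  next
    case (insert i S)
    have "alg_act (alg_x i ^ lookup v i) e' = nf_smult (single (single i (lookup v i)) 1) e'"
      if "keys (snd e') \<subseteq> exps_below CARD('p)" for e' :: "('p, 'n) normal_form"
      using nf_act_x_power[OF that] by (simp add: alg_gen_def alg_act_class flip: alg_class_power)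
    then show ?case
      using insert by (simp add: alg_monom_on_insert alg_act_mult nf_smult_closed nf_smult_assoc mult_single)
  qed
  moreover have "(\<Sum>i\<in>UNIV. single i (lookup v i)) = v"
    by (rule poly_mapping_eqI) (simp add: lookup_sum lookup_single when_def)
  ultimately show ?thesis using finite[of "UNIV :: 'n set"] by (simp add: alg_monom_eq)
qed

lemma alg_act_closed:
  "keys (snd (alg_act a (e :: ('p::prime_card, 'n::finite) normal_form))) \<subseteq> exps_below CARD('p)"
  unfolding alg_act_def nf_act_def snd_sum
  by (rule subset_trans[OF keys_sum]) (use nf_smult_closed in blast)

lemma nf_eval_one: "nf_eval (1, 0) = 1"
  by (simp add: nf_eval_def frob_module.structure_map_zero[OF frob_module_regular])

lemma alg_normal_form:
  obtains r \<phi> where "keys \<phi> \<subseteq> exps_below CARD('p)"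
    "(a :: ('p::prime_card, 'n::finite) frob_alg) = poly_to_alg r + structure_map (*) \<phi>"
proof -
  have "a = nf_eval (alg_act a (1, 0))" by (simp add: nf_eval_alg_act nf_eval_one)
  then show ?thesis using that[OF alg_act_closed] unfolding nf_eval_def by blast
qed

text \<open>\<open>x\<^sup>v f b\<close> carries \<open>(1, 0)\<close> to
  \<open>(0, single v b)\<close>, so acting on \<open>(1, 0)\<close> reads off the coefficients of
  \<open>\<phi>\<close>.\<close>

lemma alg_normal_form_unique:
  fixes \<phi> :: "('n::finite \<Rightarrow>\<^sub>0 nat) \<Rightarrow>\<^sub>0 ('p::prime_card, 'n) frob_alg"
  assumes "keys \<phi> \<subseteq> exps_below CARD('p)" "structure_map (*) \<phi> = 0"
  shows "\<phi> = 0"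
proof -
  let ?o = "(1, 0) :: ('p, 'n) normal_form"
  have zero: "alg_act 0 ?o = 0" using alg_act_add[of 0 0 ?o] by simp
  have *: "alg_act (alg_monom v * alg_f * b) ?o = (0, single v b)" if "v \<in> exps_below CARD('p)" for v b
  proof -
    have "nf_eval (alg_act b ?o) = b" by (simp add: nf_eval_alg_act nf_eval_one)
    then have "alg_act (alg_monom v * alg_f * b) ?o = nf_smult (single v 1) (0, single 0 b)"
      using alg_act_monom[OF nf_gen_closed[of GenF "alg_act b ?o"], of v]
      by (simp add: alg_act_mult alg_act_gen)
    then show ?thesis
      using that by (simp add: nf_smult_def frob_module.ext_smult_single[OF frob_module_regular])
  qed
  have "alg_act (sum h A) ?o = (\<Sum>x\<in>A. alg_act (h x) ?o)" for h and A :: "('n \<Rightarrow>\<^sub>0 nat) set"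
    by (induction A rule: infinite_finite_induct) (simp_all add: zero alg_act_add)
  then have "alg_act (structure_map (*) \<phi>) ?o = (\<Sum>v\<in>keys \<phi>. (0, single v (lookup \<phi> v)))"
    using assms(1) * by (simp add: structure_map_def subset_iff)
  then have "(0, \<Sum>v\<in>keys \<phi>. single v (lookup \<phi> v)) = (0 :: ('p, 'n) normal_form)"
    by (simp add: assms(2) zero sum_prod)
  then show ?thesis by (simp add: sum_single_lookup zero_prod_def)
qed

section \<open>Finiteness of the kernel of the structure morphism\<close>

text \<open>The structure morphism on arbitrary coefficient families instead of finitely supported
  functions; only the values at exponents below p count.\<close>

definition fsum :: "(('p::prime_card, 'n::finite) frob_alg \<Rightarrow> 'm::ab_group_add \<Rightarrow> 'm) \<Rightarrow> (('n \<Rightarrow>\<^sub>0 nat) \<Rightarrow> 'm) \<Rightarrow> 'm" where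
  "fsum scale h = (\<Sum>v\<in>exps_below CARD('p). scale (alg_monom v * alg_f) (h v))"

lemma finite_exps_below: "finite (exps_below k :: ('n::finite \<Rightarrow>\<^sub>0 nat) set)"
proof (rule finite_subset[OF _ finite_exps(1)])
  show "exps_below k \<subseteq> {v :: 'n \<Rightarrow>\<^sub>0 nat. exp_deg v \<le> CARD('n) * k}"
    using sum_bounded_above[of "UNIV :: 'n set" "lookup v" k for v]
    by (auto simp: exps_below_def exp_deg_def less_imp_le)
qed

lemma fsum_regular_eq_zero:
  fixes h :: "('n::finite \<Rightarrow>\<^sub>0 nat) \<Rightarrow> ('p::prime_card, 'n) frob_alg"
  assumes "fsum (*) h = 0" "v \<in> exps_below CARD('p)"
  shows "h v = 0"
proof -
  let ?E = "exps_below CARD('p) :: ('n \<Rightarrow>\<^sub>0 nat) set"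
  let ?\<phi> = "\<Sum>v\<in>?E. single v (h v)"
  have lk: "lookup ?\<phi> v = (h v when v \<in> ?E)" for v
    by (simp add: lookup_sum lookup_single when_def finite_exps_below)
  then have keys: "keys ?\<phi> \<subseteq> ?E" by (auto simp: in_keys_iff)
  have "structure_map (*) ?\<phi> = (\<Sum>v\<in>?E. alg_monom v * alg_f * lookup ?\<phi> v)"
    unfolding structure_map_def
    by (rule sum.mono_neutral_left[OF finite_exps_below keys]) (auto simp: in_keys_iff)
  also have "\<dots> = fsum (*) h" by (simp add: fsum_def lk)
  finally have "?\<phi> = 0" using alg_normal_form_unique[OF keys] assms(1) by simp
  then show ?thesis using lk[of v] assms(2) by simp
qed

text \<open>The base \<open>L\<close> plays the part of 0: generation modulo \<open>L\<close> is
  expressed without quotient modules.\<close>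

primrec rspan ::
  "(('p::prime_card, 'n::finite) frob_alg \<Rightarrow> 'm::ab_group_add \<Rightarrow> 'm) \<Rightarrow> 'm set \<Rightarrow> 'm list \<Rightarrow> 'm set" where
  "rspan scale L [] = L"
| "rspan scale L (c # cs) = {x. \<exists>r. \<exists>u\<in>rspan scale L cs. x = scale (poly_to_alg r) c + u}"

definition rsub :: "(('p::prime_card, 'n::finite) frob_alg \<Rightarrow> 'm::ab_group_add \<Rightarrow> 'm) \<Rightarrow> 'm set \<Rightarrow> bool" where
  "rsub scale L \<longleftrightarrow> addsub L \<and> (\<forall>r. \<forall>x\<in>L. scale (poly_to_alg r) x \<in> L)"

lemma rsub_addsub: "rsub scale L \<Longrightarrow> addsub L"
  by (simp add: rsub_def)

lemma rsub_scale: "rsub scale L \<Longrightarrow> x \<in> L \<Longrightarrow> scale (poly_to_alg r) x \<in> L"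
  by (simp add: rsub_def)

lemma rsub_Int: "rsub scale L \<Longrightarrow> rsub scale M \<Longrightarrow> rsub scale (L \<inter> M)"
  by (auto simp: rsub_def addsub_Int)

lemma poly_to_alg_diff: "poly_to_alg (r - s) = poly_to_alg r - poly_to_alg s"
  using poly_to_alg_add[of "r - s" s] by simp

lemma poly_to_alg_sum: "poly_to_alg (sum h A) = (\<Sum>a\<in>A. poly_to_alg (h a))"
  by (induction A rule: infinite_finite_induct) (simp_all add: poly_to_alg_add)

section \<open>Submodules over R that are finitely generated over a base submodule\<close>

context frob_module
begin

lemma scale_diff_right: "scale a (x - y) = scale a x - scale a y"
  using scale_add_right[of a "x - y" y] by simp

lemma scale_diff_left: "scale (a - b) x = scale a x - scale b x"
  using scale_add_left[of "a - b" b x] by simp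

lemma scale_sum_left: "scale (sum h S) x = (\<Sum>i\<in>S. scale (h i) x)"
  by (induction S rule: infinite_finite_induct) (simp_all add: scale_add_left)

lemma rsub_rspan: "rsub scale L \<Longrightarrow> rsub scale (rspan scale L cs)"
proof (induction cs)
  case (Cons c cs)
  then have IH: "rsub scale (rspan scale L cs)" by simp
  let ?S = "rspan scale L cs" and ?T = "rspan scale L (c # cs)"
  have "0 = scale (poly_to_alg 0) c + 0" by simp
  then have "0 \<in> ?T" unfolding rspan.simps using addsub_zero[OF rsub_addsub[OF IH]] by blast
  moreover have "x - y \<in> ?T" if "x \<in> ?T" "y \<in> ?T" for x y
  proof -
    from that obtain r s u v where "x = scale (poly_to_alg r) c + u" "y = scale (poly_to_alg s) c + v"
      "u \<in> ?S" "v \<in> ?S" by auto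
    moreover from this have "x - y = scale (poly_to_alg (r - s)) c + (u - v)"
      by (simp add: poly_to_alg_diff scale_diff_left)
    ultimately show ?thesis
      unfolding rspan.simps using addsub_diff[OF rsub_addsub[OF IH], of u v] by blast
  qed
  moreover have "scale (poly_to_alg q) x \<in> ?T" if "x \<in> ?T" for x q
  proof -
    from that obtain r u where "x = scale (poly_to_alg r) c + u" "u \<in> ?S" by auto
    moreover from this have "scale (poly_to_alg q) x = scale (poly_to_alg (q * r)) c + scale (poly_to_alg q) u"
      by (simp add: scale_add_right scale_scale poly_to_alg_mult)
    ultimately show ?thesis unfolding rspan.simps using rsub_scale[OF IH, of u q] by blast
  qed
  ultimately show ?case unfolding rsub_def addsub_def by blast
qed simp

lemma subset_rspan_Cons: "rspan scale L cs \<subseteq> rspan scale L (c # cs)"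
  by (auto intro!: exI[of _ 0])

lemma subset_rspan: "L \<subseteq> rspan scale L cs"
proof (induction cs)
  case (Cons c cs)
  then show ?case using subset_rspan_Cons by (rule subset_trans)
qed simp

lemma set_subset_rspan:
  assumes "rsub scale L"
  shows "set cs \<subseteq> rspan scale L cs"
proof (induction cs)
  case (Cons c cs)
  have "c = scale (poly_to_alg 1) c + 0" by (simp add: scale_one)
  then have "c \<in> rspan scale L (c # cs)"
    unfolding rspan.simps using addsub_zero[OF rsub_addsub[OF rsub_rspan[OF assms]]] by blast
  then show ?case using Cons subset_rspan_Cons by fastforce
qed simp

lemma rspan_subset:
  assumes "rsub scale T" "L \<subseteq> T" "set cs \<subseteq> T"
  shows "rspan scale L cs \<subseteq> T"
  using assms(3)
proof (induction cs)
  case (Cons c cs)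
  then have "scale (poly_to_alg r) c + u \<in> T" if "u \<in> rspan scale L cs" for r u
    using that by (intro addsub_add[OF rsub_addsub[OF assms(1)]] rsub_scale[OF assms(1)]) auto
  then show ?case by auto
qed (use assms in simp)

lemma rspan_append: "rspan scale L (cs @ ds) = rspan scale (rspan scale L ds) cs"
  by (induction cs) simp_all

text \<open>The intersection \<open>T'\<close> of \<open>T\<close> with the span of the generators other than \<open>c\<close> is finitely generated
  modulo \<open>L\<close> by induction. Among the ideals of leading coefficients (at
  \<open>c\<close>) of the finitely generated extensions of \<open>T'\<close> in \<open>T\<close> there is a maximal one, and the corresponding
  extension is all of \<open>T\<close>.\<close>

lemma rsub_finitely_generated:
  assumes L: "rsub scale L" and T: "rsub scale T" "L \<subseteq> T" "T \<subseteq> rspan scale L cs"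
  shows "\<exists>ts. set ts \<subseteq> T \<and> T = rspan scale L ts"
  using T
proof (induction cs arbitrary: T)
  case Nil
  then show ?case by (intro exI[of _ "[]"]) auto
next
  case (Cons c cs)
  let ?S = "rspan scale L cs"
  define T' where "T' = T \<inter> ?S"
  have S: "rsub scale ?S" by (rule rsub_rspan[OF L])
  have T': "rsub scale T'" unfolding T'_def by (rule rsub_Int[OF Cons.prems(1) S])
  have "L \<subseteq> T'" using Cons.prems(2) subset_rspan by (auto simp: T'_def)
  then obtain us where us: "set us \<subseteq> T'" "T' = rspan scale L us"
    using Cons.IH[OF T'] by (auto simp: T'_def)
  define J where "J ts = {r. \<exists>u\<in>?S. scale (poly_to_alg r) c + u \<in> rspan scale T' ts}" for ts
  have J: "is_ideal (J ts)" for ts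
  proof -
    have R: "rsub scale (rspan scale T' ts)" by (rule rsub_rspan[OF T'])
    have "0 \<in> J ts"
      using addsub_zero[OF rsub_addsub[OF S]] addsub_zero[OF rsub_addsub[OF R]]
      by (auto simp: J_def intro!: bexI[of _ 0])
    moreover have "r - s \<in> J ts" if rs: "r \<in> J ts" "s \<in> J ts" for r s
    proof -
      obtain u v where uv: "u \<in> ?S" "v \<in> ?S" "scale (poly_to_alg r) c + u \<in> rspan scale T' ts"
        "scale (poly_to_alg s) c + v \<in> rspan scale T' ts" using rs by (auto simp: J_def)
      have "scale (poly_to_alg (r - s)) c + (u - v)
          = (scale (poly_to_alg r) c + u) - (scale (poly_to_alg s) c + v)"
        by (simp add: poly_to_alg_diff scale_diff_left)
      then have "scale (poly_to_alg (r - s)) c + (u - v) \<in> rspan scale T' ts"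
        using addsub_diff[OF rsub_addsub[OF R] uv(3,4)] by (simp only:)
      then show ?thesis using addsub_diff[OF rsub_addsub[OF S] uv(1,2)] unfolding J_def by blast
    qed
    moreover have "q * r \<in> J ts" if r: "r \<in> J ts" for q r
    proof -
      obtain u where u: "u \<in> ?S" "scale (poly_to_alg r) c + u \<in> rspan scale T' ts"
        using r by (auto simp: J_def)
      have "scale (poly_to_alg (q * r)) c + scale (poly_to_alg q) u
          = scale (poly_to_alg q) (scale (poly_to_alg r) c + u)"
        by (simp add: scale_add_right scale_scale poly_to_alg_mult)
      then have "scale (poly_to_alg (q * r)) c + scale (poly_to_alg q) u \<in> rspan scale T' ts"
        using rsub_scale[OF R u(2), of q] by (simp only:)
      then show ?thesis using rsub_scale[OF S u(1), of q] unfolding J_def by blast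
    qed
    ultimately show ?thesis by (auto simp: is_ideal_def addsub_def)
  qed
  have "J [] \<in> J ` {ts. set ts \<subseteq> T}" by (intro imageI) simp
  then have "\<exists>z\<in>J ` {ts. set ts \<subseteq> T}. \<forall>y.
      (y, z) \<in> {(J, I). is_ideal I \<and> is_ideal J \<and> I \<subset> J} \<longrightarrow> y \<notin> J ` {ts. set ts \<subseteq> T}"
    by (rule wf_eq_minimal[THEN iffD1, OF wf_ideals, THEN spec, THEN spec, THEN mp])
  then obtain z where z: "z \<in> J ` {ts. set ts \<subseteq> T}"
    "\<And>y. (y, z) \<in> {(J, I). is_ideal I \<and> is_ideal J \<and> I \<subset> J} \<Longrightarrow> y \<notin> J ` {ts. set ts \<subseteq> T}"
    by blast
  then obtain ts where "set ts \<subseteq> T" "z = J ts" by blast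
  then have ts: "set ts \<subseteq> T" "\<And>ss. set ss \<subseteq> T \<Longrightarrow> \<not> J ts \<subset> J ss"
    using z(2) J by auto
  have "T' \<subseteq> T" by (simp add: T'_def)
  have "T \<subseteq> rspan scale T' ts"
  proof
    fix t assume t: "t \<in> T"
    then obtain r u where ru: "t = scale (poly_to_alg r) c + u" "u \<in> ?S" using Cons.prems(3) by auto
    have "J ts \<subseteq> J (t # ts)" using subset_rspan_Cons[of T' ts t] unfolding J_def by blast
    moreover have "\<not> J ts \<subset> J (t # ts)" using ts t by (intro ts(2)) simp
    ultimately have eq: "J (t # ts) = J ts" by blast
    have "t \<in> rspan scale T' (t # ts)" by (rule subsetD[OF set_subset_rspan[OF T']]) simp
    then have "r \<in> J (t # ts)" using ru unfolding J_def by blast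
    then have "r \<in> J ts" by (simp only: eq)
    then obtain u' where u': "u' \<in> ?S" "scale (poly_to_alg r) c + u' \<in> rspan scale T' ts"
      unfolding J_def by blast
    \<comment> \<open>Subtracting an element of the extension with the same coefficient
      \<open>r\<close> at \<open>c\<close> leaves an element of \<open>T'\<close>.\<close>
    have "u - u' = t - (scale (poly_to_alg r) c + u')" by (simp add: ru(1))
    moreover have "rspan scale T' ts \<subseteq> T" by (rule rspan_subset[OF Cons.prems(1) \<open>T' \<subseteq> T\<close> ts(1)])
    then have "t - (scale (poly_to_alg r) c + u') \<in> T"
      using u'(2) by (intro addsub_diff[OF rsub_addsub[OF Cons.prems(1)] t]) blast
    moreover have "u - u' \<in> ?S" by (rule addsub_diff[OF rsub_addsub[OF S] ru(2) u'(1)])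
    ultimately have "u - u' \<in> T'" unfolding T'_def by (simp only: Int_iff simp_thms)
    then have "u - u' \<in> rspan scale T' ts" using subset_rspan by blast
    then have "(u - u') + (scale (poly_to_alg r) c + u') \<in> rspan scale T' ts"
      using u'(2) by (rule addsub_add[OF rsub_addsub[OF rsub_rspan[OF T']]])
    then show "t \<in> rspan scale T' ts" by (simp add: ru(1) add.commute)
  qed
  moreover have "rspan scale T' ts \<subseteq> T" by (rule rspan_subset[OF Cons.prems(1) \<open>T' \<subseteq> T\<close> ts(1)])
  ultimately have "T = rspan scale L (ts @ us)" by (simp add: rspan_append flip: us(2))
  moreover have "set (ts @ us) \<subseteq> T" using ts(1) us(1) \<open>T' \<subseteq> T\<close> by auto
  ultimately show ?case by blast
qed

lemma scale_monom_in_rsub: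
  assumes L: "rsub scale L" and t: "\<And>i. scale (alg_x i ^ CARD('p)) t \<in> L" and v: "v \<notin> exps_below CARD('p)"
  shows "scale (poly_to_alg (single v c)) t \<in> L"
proof -
  from v obtain i where i: "lookup v i \<ge> CARD('p)" by (auto simp: exps_below_def not_less)
  have "v = (v - single i CARD('p)) + single i CARD('p)"
    using i by (intro poly_mapping_eqI) (auto simp: lookup_add lookup_minus lookup_single when_def)
  then have "single v c = single (v - single i CARD('p)) c * single (single i CARD('p)) 1"
    by (simp add: mult_single)
  then have "scale (poly_to_alg (single v c)) t
      = scale (poly_to_alg (single (v - single i CARD('p)) c)) (scale (alg_x i ^ CARD('p)) t)"
    by (simp only: poly_to_alg_mult scale_scale) (simp add: poly_to_alg_single alg_monom_single)
  then show ?thesis using rsub_scale[OF L t] by simp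
qed

text \<open>Modulo \<open>L\<close>, a polynomial acts on a generator only through its monomials
  with exponents below p, and over a finite field there are finitely many such polynomials.\<close>

lemma finite_index:
  assumes L: "rsub scale L" and ts: "\<And>t i. t \<in> set ts \<Longrightarrow> scale (alg_x i ^ CARD('p)) t \<in> L"
  shows "\<exists>B. finite B \<and> (\<forall>x\<in>rspan scale L ts. \<exists>b\<in>B. x - b \<in> L)"
  using ts
proof (induction ts)
  case Nil
  then show ?case by (intro exI[of _ "{0}"]) auto
next
  case (Cons t ts)
  then obtain B where B: "finite B" "\<And>x. x \<in> rspan scale L ts \<Longrightarrow> \<exists>b\<in>B. x - b \<in> L" by auto
  let ?E = "exps_below CARD('p) :: ('n \<Rightarrow>\<^sub>0 nat) set"
  let ?P = "{r :: ('p, 'n) poly_ring. keys r \<subseteq> ?E}"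
  have "?P \<subseteq> hpolys {..int (Max (exp_deg ` ?E))}"
    by (auto simp: hpolys_def intro!: Max_ge finite_exps_below)
  then have "finite ?P" using finite_hpolys(1)[of "{..int (Max (exp_deg ` ?E))}"] finite_subset by blast
  let ?C = "(\<lambda>(s, b). scale (poly_to_alg s) t + b) ` (?P \<times> B)"
  have "\<exists>b\<in>?C. x - b \<in> L" if x: "x \<in> rspan scale L (t # ts)" for x
  proof -
    obtain r u where ru: "x = scale (poly_to_alg r) t + u" "u \<in> rspan scale L ts" using x by auto
    obtain b where b: "b \<in> B" "u - b \<in> L" using B(2)[OF ru(2)] by blast
    let ?s = "\<Sum>v\<in>keys r \<inter> ?E. single v (lookup r v)" and ?q = "\<Sum>v\<in>keys r - ?E. single v (lookup r v)"
    have "r = ?s + ?q"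
      using sum.Int_Diff[of "keys r" "\<lambda>v. single v (lookup r v)" ?E] by (simp add: sum_single_lookup)
    then have "poly_to_alg r = poly_to_alg (?s + ?q)" by (rule arg_cong)
    then have "scale (poly_to_alg r) t = scale (poly_to_alg ?s) t + scale (poly_to_alg ?q) t"
      by (simp only: poly_to_alg_add scale_add_left)
    moreover have "scale (poly_to_alg ?q) t \<in> L"
    proof -
      have "scale (poly_to_alg ?q) t = (\<Sum>v\<in>keys r - ?E. scale (poly_to_alg (single v (lookup r v))) t)"
        by (simp only: poly_to_alg_sum scale_sum_left)
      then show ?thesis
        using scale_monom_in_rsub[OF L Cons.prems[of t]] by (auto intro!: addsub_sum rsub_addsub L)
    qed
    ultimately have "x - (scale (poly_to_alg ?s) t + b) \<in> L"
      using addsub_add[OF rsub_addsub[OF L] _ b(2), of "scale (poly_to_alg ?q) t"]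
      by (simp add: ru(1) algebra_simps)
    moreover have "keys ?s \<subseteq> ?E" by (rule subset_trans[OF keys_sum]) (auto split: if_splits)
    ultimately show ?thesis using b(1) by force
  qed
  then show ?case using \<open>finite ?P\<close> B(1) by (intro exI[of _ ?C]) auto
qed

lemma fsum_diff: "fsum scale (\<lambda>v. h v - h' v) = fsum scale h - fsum scale h'"
  by (simp add: fsum_def scale_diff_right sum_subtractf)

lemma fsum_zero [simp]: "fsum scale (\<lambda>_. 0) = 0"
  by (simp add: fsum_def)

lemma structure_map_eq_fsum:
  assumes "keys \<phi> \<subseteq> exps_below CARD('p)"
  shows "structure_map scale \<phi> = fsum scale (lookup \<phi>)"
  unfolding structure_map_def fsum_def
  by (rule sum.mono_neutral_left[OF finite_exps_below assms]) (auto simp: in_keys_iff)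

lemma fsum_eq_structure_map:
  "fsum scale h = structure_map scale (\<Sum>v\<in>exps_below CARD('p). single v (h v))"
  "keys (\<Sum>v\<in>exps_below CARD('p). single v (h v)) \<subseteq> exps_below CARD('p)"
proof -
  let ?\<phi> = "\<Sum>v\<in>exps_below CARD('p). single v (h v)"
  have lk: "lookup ?\<phi> v = (h v when v \<in> exps_below CARD('p))" for v
    by (simp add: lookup_sum lookup_single when_def finite_exps_below)
  then show "keys ?\<phi> \<subseteq> exps_below CARD('p)" by (auto simp: in_keys_iff)
  from structure_map_eq_fsum[OF this] show "fsum scale h = structure_map scale ?\<phi>"
    by (simp add: fsum_def lk)
qed

lemma image_structure_map:
  "structure_map scale ` {\<phi>. keys \<phi> \<subseteq> exps_below CARD('p)} = range (fsum scale)"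
proof (intro equalityI subsetI)
  fix x assume "x \<in> range (fsum scale)"
  then obtain h where "x = fsum scale h" by blast
  then show "x \<in> structure_map scale ` {\<phi>. keys \<phi> \<subseteq> exps_below CARD('p)}"
    using fsum_eq_structure_map[of h] by (intro image_eqI[of _ _ "\<Sum>v\<in>exps_below CARD('p). single v (h v)"]) simp_all
qed (auto simp: structure_map_eq_fsum)

text \<open>Besides the R-stability of the image, this records that the new coefficients stay in
  every ground-field subspace containing the old ones. Taking the module of relations for
  \<open>M\<close> gives the R-stability of the image of its coefficient families.\<close>

lemma scale_poly_fsum:
  "\<exists>h'. scale (poly_to_alg r) (fsum scale h) = fsum scale h' \<and>
    (\<forall>M. (\<forall>v. h v \<in> M) \<longrightarrow> addsub M \<longrightarrow> (\<forall>c. \<forall>x\<in>M. scale (alg_const c) x \<in> M) \<longrightarrow> (\<forall>v. h' v \<in> M))"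
proof -
  let ?\<phi> = "\<Sum>v\<in>exps_below CARD('p). single v (h v)" and ?E = "exps_below CARD('p) :: ('n \<Rightarrow>\<^sub>0 nat) set"
  let ?h = "lookup (ext_smult scale r ?\<phi>)"
  have "scale (poly_to_alg r) (fsum scale h) = structure_map scale (ext_smult scale r ?\<phi>)"
    by (simp add: fsum_eq_structure_map(1) structure_map_smult)
  also have "\<dots> = fsum scale ?h" by (rule structure_map_eq_fsum[OF ext_smult_closed])
  finally have "scale (poly_to_alg r) (fsum scale h) = fsum scale ?h" .
  moreover have "?h w \<in> M" if M: "\<And>v. h v \<in> M" "addsub M" "\<And>c x. x \<in> M \<Longrightarrow> scale (alg_const c) x \<in> M" for M w
  proof -
    have lk: "lookup ?\<phi> v = (h v when v \<in> ?E)" for v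
      by (simp add: lookup_sum lookup_single when_def finite_exps_below)
    have "lookup ?\<phi> v \<in> M" for v using M(1) addsub_zero[OF M(2)] by (simp add: lk when_def)
    then show ?thesis
      using M(3) addsub_zero[OF M(2)] unfolding ext_smult_def lookup_sum
      by (auto intro!: addsub_sum[OF M(2)] simp: lookup_single when_def)
  qed
  ultimately show ?thesis by blast
qed

lemma alg_x_power_f_monom: "alg_x i ^ CARD('p) * (alg_monom v * alg_f) = (0 :: ('p, 'n) frob_alg)"
proof -
  have "alg_x i ^ CARD('p) * alg_monom v = alg_monom v * (alg_x i ^ CARD('p) :: ('p, 'n) frob_alg)"
    unfolding alg_monom_eq by (rule alg_monom_on_commute)
  then have "alg_x i ^ CARD('p) * (alg_monom v * alg_f)
      = alg_monom v * (alg_x i ^ CARD('p) * (alg_f :: ('p, 'n) frob_alg))"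
    by (simp flip: mult.assoc)
  then show ?thesis by (simp add: alg_x_power_f)
qed

lemma scale_x_power_fsum: "scale (alg_x i ^ CARD('p)) (fsum scale h) = 0"
  by (simp add: fsum_def scale_sum_right scale_scale alg_x_power_f_monom)

end

text \<open>Free modules of finite rank are realised inside the finitely supported sequences over \<open>A\<close>.\<close>

definition free_scale :: "'a::ring_1 \<Rightarrow> (nat \<Rightarrow>\<^sub>0 'a) \<Rightarrow> (nat \<Rightarrow>\<^sub>0 'a)" where
  "free_scale a y = Poly_Mapping.map ((*) a) y"

lemma lookup_free_scale: "lookup (free_scale a y) i = a * lookup y i"
  by (simp add: free_scale_def Poly_Mapping.map.rep_eq when_def)

lemma frob_module_free: "frob_module (free_scale :: ('p::prime_card, 'n::finite) frob_alg \<Rightarrow> _)"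
  by standard (rule poly_mapping_eqI; simp add: lookup_free_scale lookup_add algebra_simps)+

lemma lookup_fsum_free:
  "lookup (fsum free_scale h) i = fsum (*) (\<lambda>v. lookup (h v) i :: ('p::prime_card, 'n::finite) frob_alg)"
  by (simp add: fsum_def lookup_sum lookup_free_scale)

lemma fsum_free_eq_zero:
  fixes h :: "('n::finite \<Rightarrow>\<^sub>0 nat) \<Rightarrow> (nat \<Rightarrow>\<^sub>0 ('p::prime_card, 'n) frob_alg)"
  assumes "fsum free_scale h = 0" "v \<in> exps_below CARD('p)"
  shows "h v = 0"
proof (rule poly_mapping_eqI)
  fix i
  have "fsum (*) (\<lambda>v. lookup (h v) i) = 0"
    using assms(1) by (simp flip: lookup_fsum_free)
  then show "lookup (h v) i = lookup 0 i" using fsum_regular_eq_zero[OF _ assms(2)] by fastforce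
qed

text \<open>Let \<open>M \<subseteq> A\<^sup>r\<close> be the module of relations. Lifting the coefficients of an element of the kernel to \<open>A\<^sup>r\<close>
  yields, by the injectivity of the structure morphism of \<open>A\<^sup>r\<close>, an embedding of the kernel into
  \<open>M\<close> modulo the image of \<open>\<F>\<^sub>A(M)\<close> (the connecting map of the snake lemma). Its values are
  annihilated by all \<open>x\<^sub>i\<^bsup>p\<^esup>\<close>, hence lie in a finitely generated \<open>R\<close>-module that is
  annihilated by a power of the irrelevant ideal.\<close>

lemma (in frob_module) finite_kernel_structure_map:
  assumes "finitely_presented scale"
  shows "finite {\<phi>. keys \<phi> \<subseteq> exps_below CARD('p) \<and> structure_map scale \<phi> = 0}"
proof -
  interpret W: frob_module "free_scale :: ('p, 'n) frob_alg \<Rightarrow> _" by (rule frob_module_free)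
  let ?E = "exps_below CARD('p) :: ('n \<Rightarrow>\<^sub>0 nat) set"
  let ?F = "fsum (free_scale :: ('p, 'n) frob_alg \<Rightarrow> _)"
  from assms obtain r :: nat and g :: "nat \<Rightarrow> 'm" and s :: nat and \<rho> :: "nat \<Rightarrow> nat \<Rightarrow> ('p, 'n) frob_alg"
    where gen: "\<And>m. \<exists>c. m = (\<Sum>i<r. scale (c i) (g i))"
      and rel: "\<And>c. (\<Sum>i<r. scale (c i) (g i)) = 0 \<longleftrightarrow> (\<exists>b. \<forall>i<r. c i = (\<Sum>j<s. b j * \<rho> j i))"
    unfolding finitely_presented_def by blast
  \<comment> \<open>The presentation map, extended to sequences of any length; \<open>M\<close>
    below cuts back to the first \<open>r\<close> coordinates.\<close>
  define ev where "ev y = (\<Sum>i<r. scale (lookup y i) (g i))" for y :: "nat \<Rightarrow>\<^sub>0 ('p, 'n) frob_alg"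
  have ev_diff: "ev (x - y) = ev x - ev y" for x y
    by (simp add: ev_def lookup_minus scale_diff_left sum_subtractf)
  have ev_scale: "ev (free_scale a y) = scale a (ev y)" for a y
    by (simp add: ev_def lookup_free_scale scale_sum_right scale_scale)
  have ev_sum: "ev (sum h A) = (\<Sum>a\<in>A. ev (h a))" for h and A :: "('n \<Rightarrow>\<^sub>0 nat) set"
    unfolding ev_def by (simp add: lookup_sum scale_sum_left) (rule sum.swap)
  have ev_fsum: "ev (?F h) = fsum scale (\<lambda>v. ev (h v))" for h
    by (simp add: fsum_def ev_sum ev_scale)
  define M where "M = {y. (\<forall>i\<ge>r. lookup y i = 0) \<and> ev y = 0}"
  have M_scale: "free_scale a y \<in> M" if "y \<in> M" for a y
    using that by (simp add: M_def ev_scale lookup_free_scale)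
  have M: "addsub M"
    by (simp add: addsub_def M_def ev_diff lookup_minus) (simp add: ev_def)
  have M_fsum: "?F h \<in> M" if "\<And>v. h v \<in> M" for h
    unfolding fsum_def by (intro addsub_sum[OF M] M_scale that)
  define \<rho>' where "\<rho>' j = (\<Sum>i<r. single i (\<rho> j i))" for j
  have lk\<rho>: "lookup (\<rho>' j) i = (\<rho> j i when i < r)" for i j
    by (simp add: \<rho>'_def lookup_sum lookup_single when_def)
  have \<rho>M: "\<rho>' j \<in> M" if "j < s" for j
  proof -
    have "(\<Sum>k<s. (if k = j then 1 else 0) * \<rho> k i) = (\<Sum>k<s. if k = j then \<rho> k i else 0)" for i
      by (rule sum.cong) auto
    then have "\<rho> j i = (\<Sum>k<s. (if k = j then 1 else 0) * \<rho> k i)" for i using that by simp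
    then have "(\<Sum>i<r. scale (\<rho> j i) (g i)) = 0" 
      unfolding rel by (intro exI[of _ "\<lambda>k. if k = j then 1 else 0"]) blast
    then show ?thesis by (simp add: M_def ev_def lk\<rho>)
  qed
  define H where "H = ?F ` {h. \<forall>v. h v \<in> M}"
  have HM: "H \<subseteq> M" using M_fsum by (auto simp: H_def)
  have H: "rsub free_scale H"
    unfolding rsub_def addsub_def
  proof (intro conjI ballI allI)
    show "0 \<in> H" using W.fsum_zero addsub_zero[OF M] by (auto simp: H_def image_iff intro!: exI[of _ "\<lambda>_. 0"])
    show "x - y \<in> H" if xy: "x \<in> H" "y \<in> H" for x y
    proof -
      obtain h k where "x = ?F h" "y = ?F k" "\<forall>v. h v \<in> M" "\<forall>v. k v \<in> M" using xy by (auto simp: H_def)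
      then show ?thesis
        using addsub_diff[OF M] by (auto simp: H_def W.fsum_diff[symmetric] intro!: imageI)
    qed
    show "free_scale (poly_to_alg q) x \<in> H" if x: "x \<in> H" for q x
    proof -
      obtain h where h: "x = ?F h" "\<forall>v. h v \<in> M" using x by (auto simp: H_def)
      obtain h' where h': "free_scale (poly_to_alg q) (?F h) = ?F h'"
        "\<forall>M. (\<forall>v. h v \<in> M) \<longrightarrow> addsub M \<longrightarrow>
           (\<forall>c. \<forall>x\<in>M. free_scale (alg_const c) x \<in> M) \<longrightarrow> (\<forall>v. h' v \<in> M)"
        using W.scale_poly_fsum[of q h] by (elim exE conjE)
      have "\<forall>v. h' v \<in> M"
        using h'(2)[THEN spec, of M] h(2) M M_scale by simp
      with h'(1) show ?thesis by (auto simp: H_def h(1))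
    qed
  qed
  \<comment> \<open>\<open>M\<close> is the A-span of the relations. The normal form splits each
    coefficient into an R-part and a summand that lands in \<open>H\<close>.\<close>
  have M_rspan: "M \<subseteq> rspan free_scale H (map \<rho>' [0..<s])"
  proof
    fix y assume y: "y \<in> M"
    then obtain b where b: "\<And>i. i < r \<Longrightarrow> lookup y i = (\<Sum>j<s. b j * \<rho> j i)"
      using rel[of "lookup y"] by (auto simp: M_def ev_def)
    have "y = (\<Sum>j<s. free_scale (b j) (\<rho>' j))"
    proof (rule poly_mapping_eqI)
      fix i
      have "lookup y i = 0" if "\<not> i < r" using y that by (simp add: M_def)
      then show "lookup y i = lookup (\<Sum>j<s. free_scale (b j) (\<rho>' j)) i"
        using b[of i] by (cases "i < r") (simp_all add: lookup_sum lookup_free_scale lk\<rho>)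
    qed
    moreover have "free_scale (b j) (\<rho>' j) \<in> rspan free_scale H (map \<rho>' [0..<s])" if j: "j < s" for j
    proof -
      let ?S = "rspan free_scale H (map \<rho>' [0..<s])"
      have S: "rsub free_scale ?S" by (rule W.rsub_rspan[OF H])
      obtain q \<phi> where b: "keys \<phi> \<subseteq> ?E" "b j = poly_to_alg q + structure_map (*) \<phi>"
        by (rule alg_normal_form)
      have "structure_map (*) \<phi> = fsum (*) (lookup \<phi>)"
        by (rule frob_module.structure_map_eq_fsum[OF frob_module_regular b(1)])
      then have "free_scale (structure_map (*) \<phi>) (\<rho>' j) = ?F (\<lambda>v. free_scale (lookup \<phi> v) (\<rho>' j))"
        by (simp add: fsum_def W.scale_sum_left W.scale_scale)
      then have "free_scale (structure_map (*) \<phi>) (\<rho>' j) \<in> H"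
        unfolding H_def using M_scale[OF \<rho>M[OF j]] by blast
      moreover have "\<rho>' j \<in> ?S" using W.set_subset_rspan[OF H, of "map \<rho>' [0..<s]"] j by auto
      ultimately show ?thesis
        unfolding b(2) W.scale_add_left using W.subset_rspan[of H "map \<rho>' [0..<s]"]
        by (intro addsub_add[OF rsub_addsub[OF S]] rsub_scale[OF S]) blast+
    qed
    ultimately show "y \<in> rspan free_scale H (map \<rho>' [0..<s])"
      by (auto intro!: addsub_sum rsub_addsub W.rsub_rspan H)
  qed
  \<comment> \<open>Modulo \<open>H\<close> this is the part killed by all
    \<open>x\<^sub>i\<^sup>p\<close>. Lying in a finitely generated extension of \<open>H\<close>,
    it is itself finitely generated over \<open>H\<close>, and then of finite index.\<close>
  define T where "T = {y \<in> M. \<forall>i. free_scale (alg_x i ^ CARD('p)) y \<in> H}"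
  have T: "rsub free_scale T"
  proof -
    have "free_scale (alg_x i ^ CARD('p)) (free_scale (poly_to_alg q) x) \<in> H"
      if "free_scale (alg_x i ^ CARD('p)) x \<in> H" for q x i
    proof -
      have "alg_x i ^ CARD('p) = (poly_to_alg (single (single i CARD('p)) 1) :: ('p, 'n) frob_alg)"
        by (simp add: poly_to_alg_single alg_monom_single)
      then have "alg_x i ^ CARD('p) * poly_to_alg q = poly_to_alg q * (alg_x i ^ CARD('p) :: ('p, 'n) frob_alg)"
        by (metis mult.commute poly_to_alg_mult)
      then show ?thesis using rsub_scale[OF H that, of q] by (simp add: W.scale_scale)
    qed
    then show ?thesis
      using addsub_diff[OF M] addsub_zero[OF M] M_scale addsub_zero[OF rsub_addsub[OF H]]
        addsub_diff[OF rsub_addsub[OF H]]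
      by (auto simp: rsub_def addsub_def T_def W.scale_diff_right)
  qed
  have "H \<subseteq> T"
    using HM W.scale_x_power_fsum addsub_zero[OF rsub_addsub[OF H]] by (auto simp: T_def H_def)
  moreover have "T \<subseteq> rspan free_scale H (map \<rho>' [0..<s])" using M_rspan by (auto simp: T_def)
  ultimately obtain ts where ts: "set ts \<subseteq> T" "T = rspan free_scale H ts"
    using W.rsub_finitely_generated[OF H T] by blast
  have "free_scale (alg_x i ^ CARD('p)) t \<in> H" if "t \<in> set ts" for t i
    using that ts(1) unfolding T_def by blast
  then have "\<exists>B. finite B \<and> (\<forall>y\<in>T. \<exists>b\<in>B. y - b \<in> H)"
    unfolding ts(2) by (rule W.finite_index[OF H])
  then obtain B where B: "finite B" "\<And>y. y \<in> T \<Longrightarrow> \<exists>b\<in>B. y - b \<in> H" by blast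
  have "\<exists>y. (\<forall>i\<ge>r. lookup y i = 0) \<and> ev y = m" for m
  proof -
    obtain c where c: "m = (\<Sum>i<r. scale (c i) (g i))" using gen by blast
    have "lookup (\<Sum>i<r. single i (c i)) i = (c i when i < r)" for i
      by (simp add: lookup_sum lookup_single when_def)
    then show ?thesis
      by (intro exI[of _ "\<Sum>i<r. single i (c i)"]) (simp add: ev_def c)
  qed
  \<comment> \<open>A set-theoretic section of \<open>ev\<close>: injectivity of
    \<open>\<beta>\<close> is shown by comparing two lifts, not through a kernel.\<close>
  then obtain \<sigma> where \<sigma>: "\<And>m i. r \<le> i \<Longrightarrow> lookup (\<sigma> m) i = 0" "\<And>m. ev (\<sigma> m) = m" by metis
  let ?K = "{\<phi>. keys \<phi> \<subseteq> ?E \<and> structure_map scale \<phi> = 0}"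
  define Y where "Y \<phi> = ?F (\<lambda>v. \<sigma> (lookup \<phi> v))" for \<phi>
  have "Y \<phi> \<in> T" if "\<phi> \<in> ?K" for \<phi>
  proof -
    have "ev (Y \<phi>) = 0"
      using that structure_map_eq_fsum[of \<phi>] by (simp add: Y_def ev_fsum \<sigma>)
    then show ?thesis
      using addsub_zero[OF rsub_addsub[OF H]]
      by (simp add: T_def M_def Y_def W.scale_x_power_fsum lookup_fsum_free \<sigma>(1)
          frob_module.fsum_zero[OF frob_module_regular])
  qed
  then have "\<forall>\<phi>\<in>?K. \<exists>b. b \<in> B \<and> Y \<phi> - b \<in> H" using B(2) by fast
  from bchoice[OF this] obtain \<beta>
    where \<beta>: "\<And>\<phi>. \<phi> \<in> ?K \<Longrightarrow> \<beta> \<phi> \<in> B \<and> Y \<phi> - \<beta> \<phi> \<in> H" by fast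
  have "inj_on \<beta> ?K"
  proof (rule inj_onI)
    fix \<phi> \<psi> assume *: "\<phi> \<in> ?K" "\<psi> \<in> ?K" "\<beta> \<phi> = \<beta> \<psi>"
    then have "(Y \<phi> - \<beta> \<phi>) - (Y \<psi> - \<beta> \<psi>) \<in> H"
      by (intro addsub_diff[OF rsub_addsub[OF H]] \<beta>[THEN conjunct2])
    then have "Y \<phi> - Y \<psi> \<in> H" using *(3) by simp
    then obtain h where h: "Y \<phi> - Y \<psi> = ?F h" "\<And>v. h v \<in> M" by (auto simp: H_def)
    \<comment> \<open>Injectivity of the structure morphism of the free module makes the two lifts
      differ by \<open>h\<close>, which \<open>ev\<close> kills.\<close>
    have "?F (\<lambda>v. (\<sigma> (lookup \<phi> v) - \<sigma> (lookup \<psi> v)) - h v) = 0"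
      using h(1) by (simp add: W.fsum_diff Y_def)
    then have eq: "\<sigma> (lookup \<phi> v) - \<sigma> (lookup \<psi> v) - h v = 0" if "v \<in> ?E" for v
      using that by (rule fsum_free_eq_zero)
    have "lookup \<phi> v = lookup \<psi> v" if "v \<in> ?E" for v
    proof -
      have "ev (\<sigma> (lookup \<phi> v) - \<sigma> (lookup \<psi> v)) = ev (h v)" using eq[OF that] by simp
      then show ?thesis using h(2)[of v] by (simp add: ev_diff \<sigma> M_def)
    qed
    moreover have "lookup \<phi> v = lookup \<psi> v" if "v \<notin> ?E" for v
      using * that by (metis (mono_tags, lifting) in_keys_iff mem_Collect_eq subsetD)
    ultimately show "\<phi> = \<psi>" by (intro poly_mapping_eqI) blast
  qed
  moreover have "\<beta> ` ?K \<subseteq> B" using \<beta> by blast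
  ultimately show ?thesis using finite_imageD[of \<beta> ?K] finite_subset[OF _ B(1)] by simp
qed

section \<open>Graded modules\<close>

lemma alg_deg_mult:
  assumes "a \<in> alg_deg k" "b \<in> alg_deg l"
  shows "a * b \<in> alg_deg (k + l)"
proof -
  obtain a' b' where ab: "a = alg_class a'" "b = alg_class b'"
    "\<forall>w\<in>keys a'. length (letters w) = k" "\<forall>w\<in>keys b'. length (letters w) = l"
    using assms by (auto simp: alg_deg_def)
  have "length (letters w) = k + l" if "w \<in> keys (a' * b')" for w
    using that keys_mult[of a' b'] ab(3,4) by (fastforce simp: plus_free_monoid_def)
  then show ?thesis unfolding alg_deg_def ab(1,2) alg_class_mult[symmetric] by blast
qed

lemma alg_const_deg: "alg_const c \<in> alg_deg 0"
  unfolding alg_const_def alg_deg_def by (rule imageI) (auto simp: zero_free_monoid_def split: if_splits)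

lemma alg_gen_deg: "alg_gen g \<in> alg_deg 1"
  unfolding alg_gen_def alg_deg_def by (rule imageI) (auto simp: free_gen_def split: if_splits)

lemma alg_power_deg: "alg_gen g ^ k \<in> alg_deg k"
proof (induction k)
  case (Suc k)
  show ?case using alg_deg_mult[OF alg_gen_deg Suc] by simp
qed (use alg_const_deg[of 1] in simp)

lemma alg_monom_deg: "alg_monom v \<in> alg_deg (exp_deg v)"
proof -
  have "finite S \<Longrightarrow> alg_monom_on S v \<in> alg_deg (\<Sum>i\<in>S. lookup v i)" for S
  proof (induction S rule: finite_induct)
    case empty
    show ?case using alg_const_deg[of 1] by simp
  next
    case (insert i S)
    then show ?case using alg_deg_mult[OF alg_power_deg] by (simp add: alg_monom_on_insert)
  qed
  then show ?thesis by (simp add: alg_monom_eq exp_deg_def)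
qed

section \<open>Homogeneous parts of elements of N\<close>

context graded_frob_module
begin

definition dec :: "'m \<Rightarrow> (int \<Rightarrow>\<^sub>0 'm)" where
  "dec m = (THE c. (\<forall>i. lookup c i \<in> gr i) \<and> m = (\<Sum>i\<in>keys c. lookup c i))"

lemma dec: "lookup (dec m) i \<in> gr i" "m = (\<Sum>i\<in>keys (dec m). lookup (dec m) i)"
  using theI'[OF gr_direct_sum[of m]] unfolding dec_def by blast+

lemma dec_eqI: "(\<And>i. lookup c i \<in> gr i) \<Longrightarrow> m = (\<Sum>i\<in>keys c. lookup c i) \<Longrightarrow> dec m = c"
  using gr_direct_sum[of m] dec[of m] by blast

lemma dec_add: "dec (x + y) = dec x + dec y"
proof (rule dec_eqI)
  show "lookup (dec x + dec y) i \<in> gr i" for i by (simp add: lookup_add gr_add dec)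
  have "(\<Sum>i\<in>keys (dec x + dec y). lookup (dec x + dec y) i)
      = (\<Sum>i\<in>keys (dec x). lookup (dec x) i) + (\<Sum>i\<in>keys (dec y). lookup (dec y) i)"
    by (rule setsum_keys_plus_distrib) simp_all
  then show "x + y = (\<Sum>i\<in>keys (dec x + dec y). lookup (dec x + dec y) i)" by (simp flip: dec(2))
qed

lemma dec_homogeneous:
  assumes "x \<in> gr i"
  shows "dec x = single i x"
  by (rule dec_eqI) (use assms gr_zero in \<open>auto simp: lookup_single when_def\<close>)

definition part :: "int set \<Rightarrow> 'm \<Rightarrow> 'm" where
  "part D m = (\<Sum>i\<in>keys (dec m). if i \<in> D then lookup (dec m) i else 0)"

lemma part_add: "part D (x + y) = part D x + part D y"
  unfolding part_def dec_add by (rule setsum_keys_plus_distrib) simp_all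

lemma part_zero [simp]: "part D 0 = 0"
  using part_add[of D 0 0] by simp

lemma part_diff: "part D (x - y) = part D x - part D y"
  using part_add[of D "x - y" y] by simp

lemma part_sum: "part D (sum h A) = (\<Sum>a\<in>A. part D (h a))"
  by (induction A rule: infinite_finite_induct) (simp_all add: part_add)

lemma part_homogeneous: "x \<in> gr i \<Longrightarrow> part D x = (if i \<in> D then x else 0)"
  by (simp add: part_def dec_homogeneous)

lemma part_part: "part D (part E m) = part (D \<inter> E) m"
proof -
  have "part D (part E (\<Sum>i\<in>keys (dec m). lookup (dec m) i)) = part (D \<inter> E) (\<Sum>i\<in>keys (dec m). lookup (dec m) i)"
    unfolding part_sum by (intro sum.cong) (simp_all add: part_homogeneous[OF dec(1)])
  then show ?thesis by (simp flip: dec(2))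
qed

lemma part_in_gr: "part {i} m \<in> gr i"
proof -
  have "part {i} m = (if i \<in> keys (dec m) then lookup (dec m) i else 0)"
    unfolding part_def by simp
  then show ?thesis by (simp add: dec gr_zero)
qed

lemma gr_iff: "x \<in> gr i \<longleftrightarrow> part {i} x = x"
  using part_in_gr[of i x] part_homogeneous[of x i "{i}"] by auto

lemma addsub_gr: "addsub (gr i)"
  using gr_zero gr_add[of _ i] gr_uminus[of _ i] unfolding addsub_def by (metis diff_conv_add_uminus)

lemma part_scale:
  assumes "a \<in> alg_deg k"
  shows "part D (scale a m) = scale a (part {i. i + int k \<in> D} m)"
proof -
  have "part D (scale a (lookup (dec m) i)) = scale a (part {i. i + int k \<in> D} (lookup (dec m) i))" for i
    using part_homogeneous[OF gr_scale[OF assms dec(1)], of D m i] part_homogeneous[OF dec(1), of _ m i]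
    by (simp add: add.commute)
  then have "part D (scale a (\<Sum>i\<in>keys (dec m). lookup (dec m) i))
      = scale a (part {i. i + int k \<in> D} (\<Sum>i\<in>keys (dec m). lookup (dec m) i))"
    by (simp add: scale_sum_right part_sum)
  then show ?thesis by (simp flip: dec(2))
qed

lemma part_scale_poly:
  assumes "c \<in> gr e"
  shows "part D (scale (poly_to_alg r) c) = scale (poly_to_alg (restr {i. i + e \<in> D} r)) c"
proof (induction r rule: poly_mapping_additive_induct)
  case (single v a)
  have "scale (poly_to_alg (single v a)) c \<in> gr (int (exp_deg v) + e)"
    unfolding poly_to_alg_single
    using gr_scale[OF alg_deg_mult[OF alg_const_deg alg_monom_deg] assms, of a v] by simp
  then show ?case by (simp add: part_homogeneous restr_single when_def)
qed (simp_all add: poly_to_alg_add scale_add_left part_add restr_add)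

section \<open>Graded submodules over R and their cyclic extensions\<close>

definition gsub :: "'m set \<Rightarrow> bool" where
  "gsub L \<longleftrightarrow> rsub scale L \<and> (\<forall>D. \<forall>x\<in>L. part D x \<in> L)"

lemma gsub_rspan_Cons:
  assumes "gsub L" "c \<in> gr e"
  shows "gsub (rspan scale L [c])"
proof -
  have "part D x \<in> rspan scale L [c]" if x: "x \<in> rspan scale L [c]" for D x
  proof -
    obtain r u where "x = scale (poly_to_alg r) c + u" "u \<in> L" using x by auto
    moreover from this have "part D x = scale (poly_to_alg (restr {i. i + e \<in> D} r)) c + part D u"
      by (simp add: part_add part_scale_poly[OF assms(2)])
    moreover have "part D u \<in> L" if "u \<in> L" for u using that assms(1) by (simp add: gsub_def)
    ultimately show ?thesis by auto
  qed
  then show ?thesis using rsub_rspan assms(1) unfolding gsub_def by blast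
qed

definition colon :: "'m set \<Rightarrow> 'm \<Rightarrow> ('p, 'n) poly_ring set" where
  "colon L c = {r. scale (poly_to_alg r) c \<in> L}"

lemma hom_ideal_colon:
  assumes "gsub L" "c \<in> gr e"
  shows "hom_ideal (colon L c)"
proof -
  have L: "rsub scale L" using assms(1) by (simp add: gsub_def)
  have "restr D r \<in> colon L c" if "r \<in> colon L c" for D r
  proof -
    have "{i. i + e \<in> {i. i - e \<in> D}} = D" by simp
    then show ?thesis
      using that assms(1) part_scale_poly[OF assms(2), of "{i. i - e \<in> D}" r]
      by (metis (mono_tags, lifting) colon_def gsub_def mem_Collect_eq)
  qed
  moreover have "is_ideal (colon L c)"
    using addsub_zero[OF rsub_addsub[OF L]] addsub_diff[OF rsub_addsub[OF L]] rsub_scale[OF L]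
    by (auto simp: is_ideal_def addsub_def colon_def poly_to_alg_diff scale_diff_left poly_to_alg_mult
        scale_scale[symmetric])
  ultimately show ?thesis by (simp add: hom_ideal_def)
qed

text \<open>Extending \<open>L\<close> by \<open>c\<close> adds a copy of R modulo the colon ideal,
  shifted by the degree \<open>e\<close> of \<open>c\<close>.\<close>

lemma ldim_rspan_Cons:
  assumes L: "gsub L" and c: "c \<in> gr e" and fin: "finite (L \<inter> gr i)"
  shows "finite (rspan scale L [c] \<inter> gr i)"
    and "int (ldim CARD('p) (rspan scale L [c] \<inter> gr i))
      = int (ldim CARD('p) (L \<inter> gr i)) + hilbert_fun {i - e} (colon L c)"
proof -
  have E: "{j. j + e \<in> {i}} = {i - e}" by auto
  let ?f = "\<lambda>r. scale (poly_to_alg r) c"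
  have eq: "rspan scale L [c] \<inter> gr i = {x. (\<exists>r. \<exists>u\<in>L. x = ?f r + u) \<and> part {i} x = x}"
    "L \<inter> gr i = {u \<in> L. part {i} u = u}" "colon L c \<inter> hpolys {i - e} = {r \<in> hpolys {i - e}. ?f r \<in> L}"
    by (auto simp: gr_iff colon_def)
  have "ldim CARD('p) {x. (\<exists>r. \<exists>u\<in>L. x = ?f r + u) \<and> part {i} x = x}
      + ldim CARD('p) {r \<in> hpolys {i - e}. ?f r \<in> L}
      = ldim CARD('p) (hpolys {i - e} :: ('p, 'n) poly_ring set) + ldim CARD('p) {u \<in> L. part {i} u = u}"
  proof (rule ldim_graded_extension[OF prime_card])
    show "part {i} (?f r) = ?f (restr {i - e} r)" for r using part_scale_poly[OF c, of "{i}" r] by (simp only: E)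
    show "j \<le> int (nat (i - e))" if "j \<in> {i - e}" for j using that by simp
    show "finite {u \<in> L. part {i} u = u}" using fin by (simp only: eq)
  qed (use L in \<open>auto simp: poly_to_alg_add scale_add_left part_add part_part gsub_def rsub_def\<close>)
  then show "int (ldim CARD('p) (rspan scale L [c] \<inter> gr i))
      = int (ldim CARD('p) (L \<inter> gr i)) + hilbert_fun {i - e} (colon L c)"
    unfolding hilbert_fun_def eq by linarith
  \<comment> \<open>Finiteness takes its own argument, as \<open>ldim\<close> is 0 on infinite
    sets.\<close>
  have "rspan scale L [c] \<inter> gr i \<subseteq> (\<lambda>(s, t). ?f s + t) ` (hpolys {i - e} \<times> (L \<inter> gr i))"
  proof
    fix x assume x: "x \<in> rspan scale L [c] \<inter> gr i"
    then obtain r u where ru: "u \<in> L" "x = ?f r + u" by auto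
    then have "x = ?f (restr {i - e} r) + part {i} u"
      using x part_scale_poly[OF c, of "{i}" r] by (simp only: Int_iff gr_iff part_add E)
    moreover have "part {i} u \<in> L \<inter> gr i" using ru(1) L part_in_gr by (simp add: gsub_def)
    ultimately show "x \<in> (\<lambda>(s, t). ?f s + t) ` (hpolys {i - e} \<times> (L \<inter> gr i))"
      using restr_in_hpolys[of "{i - e}" r] by force
  qed
  moreover have "finite (hpolys {i - e} :: ('p, 'n) poly_ring set)"
    by (rule finite_hpolys(1)[of _ "nat (i - e)"]) simp
  ultimately show "finite (rspan scale L [c] \<inter> gr i)"
    using fin by (meson finite_SigmaI finite_imageI finite_subset)
qed

text \<open>The component of degree \<open>i\<close> of \<open>\<F>\<^sub>A(N)\<close>, where \<open>\<epsilon>\<^sub>v\<close> has degree \<open>|v| + 1\<close>.\<close>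

definition ext_gr :: "int \<Rightarrow> (('n \<Rightarrow>\<^sub>0 nat) \<Rightarrow>\<^sub>0 'm) set" where
  "ext_gr i = {\<phi>. keys \<phi> \<subseteq> exps_below CARD('p) \<and>
     (\<forall>v\<in>exps_below CARD('p). lookup \<phi> v \<in> gr (i - int (exp_deg v) - 1))}"

lemma alg_monom_f_deg: "alg_monom v * alg_f \<in> alg_deg (exp_deg v + 1)"
  by (rule alg_deg_mult[OF alg_monom_deg alg_gen_deg])

lemma part_fsum:
  "part D (fsum scale h) = fsum scale (\<lambda>v. part {i. i + int (exp_deg v + 1) \<in> D} (h v))"
  unfolding fsum_def part_sum part_scale[OF alg_monom_f_deg] ..

lemma gsub_range_fsum: "gsub (range (fsum scale))"
proof -
  have "x - y \<in> range (fsum scale)" if "x \<in> range (fsum scale)" "y \<in> range (fsum scale)" for x y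
    using that by (auto simp: fsum_diff[symmetric])
  moreover have "scale (poly_to_alg r) x \<in> range (fsum scale)" if x: "x \<in> range (fsum scale)" for r x
  proof -
    obtain h where "x = fsum scale h" using x by blast
    moreover obtain h' where "scale (poly_to_alg r) (fsum scale h) = fsum scale h'"
      using scale_poly_fsum[of r h] by (elim exE conjE)
    ultimately show ?thesis by simp
  qed
  moreover have "0 \<in> range (fsum scale)" using fsum_zero by (metis rangeI)
  ultimately show ?thesis by (auto simp: gsub_def rsub_def addsub_def part_fsum)
qed

text \<open>The structure morphism is homogeneous: in a preimage of a homogeneous element, each
  coefficient can be cut down to its part of degree \<open>i - |v| - 1\<close>.\<close>

lemma image_ext_gr: "structure_map scale ` ext_gr i = range (fsum scale) \<inter> gr i"
proof (intro equalityI subsetI)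
  fix x assume "x \<in> structure_map scale ` ext_gr i"
  then obtain \<phi> where \<phi>: "\<phi> \<in> ext_gr i" "x = fsum scale (lookup \<phi>)"
    by (auto simp: ext_gr_def structure_map_eq_fsum)
  have "scale (alg_monom v * alg_f) (lookup \<phi> v) \<in> gr i" if "v \<in> exps_below CARD('p)" for v
    using gr_scale[OF alg_monom_f_deg, of "lookup \<phi> v" "i - int (exp_deg v) - 1" v] \<phi>(1) that
    by (simp add: ext_gr_def)
  then have "x \<in> gr i" unfolding \<phi>(2) fsum_def by (intro addsub_sum[OF addsub_gr])
  then show "x \<in> range (fsum scale) \<inter> gr i" using \<phi>(2) by blast
next
  fix x assume x: "x \<in> range (fsum scale) \<inter> gr i"
  then obtain h where h: "x = fsum scale h" by blast
  define h' where "h' v = part {i - int (exp_deg v) - 1} (h v)" for v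
  have "{j. j + int (exp_deg v + 1) \<in> {i}} = {i - int (exp_deg v) - 1}" for v :: "'n \<Rightarrow>\<^sub>0 nat"
    by auto
  then have "part {i} x = fsum scale h'"
    unfolding h part_fsum h'_def by (simp only:)
  then have "x = fsum scale h'" using x gr_iff[of x i] by simp
  moreover have "(\<Sum>v\<in>exps_below CARD('p). single v (h' v)) \<in> ext_gr i"
    using fsum_eq_structure_map(2)[of h'] part_in_gr
    by (simp add: ext_gr_def lookup_sum lookup_single when_def finite_exps_below h'_def)
  ultimately show "x \<in> structure_map scale ` ext_gr i"
    by (auto simp: fsum_eq_structure_map(1))
qed

lemma addsub_ext_gr: "addsub (ext_gr i)"
proof -
  have "\<phi> - \<psi> \<in> ext_gr i" if "\<phi> \<in> ext_gr i" "\<psi> \<in> ext_gr i" for \<phi> \<psi>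
  proof -
    have "keys (\<phi> - \<psi>) \<subseteq> exps_below CARD('p)"
      by (rule subset_trans[OF keys_diff]) (use that in \<open>simp add: ext_gr_def\<close>)
    then show ?thesis
      using that addsub_diff[OF addsub_gr] by (simp add: ext_gr_def lookup_minus)
  qed
  then show ?thesis using gr_zero by (simp add: addsub_def) (simp add: ext_gr_def)
qed

lemma ext_gr_bij:
  "bij_betw (\<lambda>\<phi>. restrict (lookup \<phi>) (exps_below CARD('p))) (ext_gr i)
     (Pi\<^sub>E (exps_below CARD('p)) (\<lambda>v. gr (i - int (exp_deg v) - 1)))"
proof (rule bij_betwI[where g = "\<lambda>h. \<Sum>v\<in>exps_below CARD('p). single v (h v)"])
  let ?E = "exps_below CARD('p) :: ('n \<Rightarrow>\<^sub>0 nat) set"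
  have lk: "lookup (\<Sum>v\<in>?E. single v (h v)) w = (h w when w \<in> ?E)" for h :: "_ \<Rightarrow> 'm" and w
    by (simp add: lookup_sum lookup_single when_def finite_exps_below)
  show "(\<lambda>\<phi>. restrict (lookup \<phi>) ?E) \<in> ext_gr i \<rightarrow> (Pi\<^sub>E ?E (\<lambda>v. gr (i - int (exp_deg v) - 1)))"
    by (auto simp: ext_gr_def)
  show "(\<lambda>h. \<Sum>v\<in>?E. single v (h v)) \<in> (Pi\<^sub>E ?E (\<lambda>v. gr (i - int (exp_deg v) - 1))) \<rightarrow> ext_gr i"
    using fsum_eq_structure_map(2) by (auto simp: ext_gr_def lk)
  show "(\<Sum>v\<in>?E. single v (restrict (lookup \<phi>) ?E v)) = \<phi>" if "\<phi> \<in> ext_gr i" for \<phi>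
  proof (rule poly_mapping_eqI)
    fix w
    have "w \<notin> ?E \<Longrightarrow> lookup \<phi> w = 0" using that by (auto simp: ext_gr_def in_keys_iff)
    then show "lookup (\<Sum>v\<in>?E. single v (restrict (lookup \<phi>) ?E v)) w = lookup \<phi> w" by (simp add: lk when_def)
  qed
  show "restrict (lookup (\<Sum>v\<in>?E. single v (h v))) ?E = h"
    if "h \<in> Pi\<^sub>E ?E (\<lambda>v. gr (i - int (exp_deg v) - 1))" for h
    using that by (auto simp: lk fun_eq_iff restrict_def PiE_def extensional_def)
qed

lemma ldim_ext_gr:
  assumes "\<And>v. finite (gr (i - int (exp_deg (v :: 'n \<Rightarrow>\<^sub>0 nat)) - 1))"
  shows "finite (ext_gr i)"
    and "ldim CARD('p) (ext_gr i) = (\<Sum>v\<in>exps_below CARD('p). ldim CARD('p) (gr (i - int (exp_deg (v :: 'n \<Rightarrow>\<^sub>0 nat)) - 1)))"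
proof -
  let ?E = "exps_below CARD('p) :: ('n \<Rightarrow>\<^sub>0 nat) set"
  have "finite (Pi\<^sub>E ?E (\<lambda>v. gr (i - int (exp_deg v) - 1)))"
    using assms by (intro finite_PiE finite_exps_below)
  then show "finite (ext_gr i)" using bij_betw_finite[OF ext_gr_bij] by blast
  have "card (ext_gr i) = (\<Prod>v\<in>?E. card (gr (i - int (exp_deg v) - 1)))"
    using bij_betw_same_card[OF ext_gr_bij, of i] by (simp add: card_PiE finite_exps_below)
  moreover have "card (gr j) \<noteq> 0" if "finite (gr j)" for j using that gr_zero by (auto simp: card_eq_0_iff)
  ultimately show "ldim CARD('p) (ext_gr i) = (\<Sum>v\<in>?E. ldim CARD('p) (gr (i - int (exp_deg v) - 1)))"
    unfolding ldim_def
    using assms prime_card[where 'a = 'p]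
    by (auto simp: finite_exps_below intro!: prime_elem_multiplicity_prod_distrib prime_imp_prime_elem)
qed

lemma ldim_kernel:
  assumes "finite (ext_gr i)"
  shows "ldim CARD('p) (ext_gr i) = ldim CARD('p) (range (fsum scale) \<inter> gr i)
    + ldim CARD('p) {\<phi> \<in> ext_gr i. structure_map scale \<phi> = 0}"
  using ldim_rank_nullity[OF prime_card, of "structure_map scale" "ext_gr i"]
  by (simp add: structure_map_add addsub_ext_gr assms image_ext_gr)

end

section \<open>Krull dimension\<close>

lemma ideal_iff_is_ideal: "ideal I ring_of_class \<longleftrightarrow> is_ideal I"
proof
  assume "ideal I ring_of_class"
  then interpret I: ideal I "ring_of_class :: 'a ring" .
  have "x - y \<in> I" if "x \<in> I" "y \<in> I" for x y
    using additive_subgroup.a_closed[OF I.additive_subgroup_axioms that(1) I.I_l_closed[OF that(2), of "- 1"]]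
    by simp
  then show "is_ideal I"
    using additive_subgroup.zero_closed[OF I.additive_subgroup_axioms] I.I_l_closed
    by (auto simp: is_ideal_def addsub_def)
next
  assume I: "is_ideal I"
  show "ideal I ring_of_class"
  proof (rule idealI[OF ring_ring_of_class])
    show "subgroup I (add_monoid ring_of_class)"
    proof (rule group.subgroupI)
      show "group (add_monoid (ring_of_class :: 'a ring))"
        using abelian_group.a_group[OF abelian_group_ring_of_class] .
      show "I \<noteq> {}" using addsub_zero[OF is_ideal_addsub[OF I]] by auto
      fix a assume "a \<in> I"
      moreover have "inv\<^bsub>add_monoid ring_of_class\<^esub> a = - a"
        by (rule group.inv_equality)
           (use abelian_group.a_group[OF abelian_group_ring_of_class] in auto)
      ultimately show "inv\<^bsub>add_monoid ring_of_class\<^esub> a \<in> I"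
        using addsub_uminus[OF is_ideal_addsub[OF I]] by simp
    qed (use addsub_add[OF is_ideal_addsub[OF I]] in auto)
  qed (use is_ideal_mult[OF I] in \<open>auto simp: mult.commute\<close>)
qed

lemma coset_eq: "I +>\<^bsub>ring_of_class\<^esub> r = (\<lambda>h. h + r) ` (I :: 'a::comm_ring_1 set)"
  by (auto simp: a_r_coset_def')

lemma coset_eq_iff:
  assumes "addsub (I :: 'a::comm_ring_1 set)"
  shows "I +>\<^bsub>ring_of_class\<^esub> r = I +>\<^bsub>ring_of_class\<^esub> s \<longleftrightarrow> r - s \<in> I"
proof
  assume "I +>\<^bsub>ring_of_class\<^esub> r = I +>\<^bsub>ring_of_class\<^esub> s"
  moreover have "r \<in> I +>\<^bsub>ring_of_class\<^esub> r" unfolding coset_eq using addsub_zero[OF assms] by force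
  ultimately show "r - s \<in> I" unfolding coset_eq by auto
next
  assume rs: "r - s \<in> I"
  have "h + r \<in> (\<lambda>h. h + s) ` I" if "h \<in> I" for h
    using addsub_add[OF assms that rs] by (intro image_eqI[of _ _ "h + (r - s)"]) auto
  moreover have "h + s \<in> (\<lambda>h. h + r) ` I" if "h \<in> I" for h
    using addsub_diff[OF assms that rs] by (intro image_eqI[of _ _ "h - (r - s)"]) auto
  ultimately show "I +>\<^bsub>ring_of_class\<^esub> r = I +>\<^bsub>ring_of_class\<^esub> s" unfolding coset_eq by blast
qed

lemma prime_ideal_of_quotient:
  fixes I :: "'a::comm_ring_1 set"
  assumes I: "is_ideal I" and Q: "primeideal Q (ring_of_class Quot I)"
  shows "prime_ideal {r. I +>\<^bsub>ring_of_class\<^esub> r \<in> Q}" and "I \<subseteq> {r. I +>\<^bsub>ring_of_class\<^esub> r \<in> Q}"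
proof -
  interpret I: ideal I "ring_of_class :: 'a ring" using I by (simp add: ideal_iff_is_ideal)
  interpret Q: primeideal Q "ring_of_class Quot I" by (rule Q)
  let ?\<pi> = "(+>\<^bsub>ring_of_class\<^esub>) I" let ?P = "{r. ?\<pi> r \<in> Q}"
  have hom: "ring_hom_ring ring_of_class (ring_of_class Quot I) ?\<pi>" by (rule I.rcos_ring_hom_ring)
  have id: "is_ideal ?P"
    using ring_hom_ring.ideal_vimage[OF hom Q.is_ideal] by (simp add: ideal_iff_is_ideal)
  have one: "?\<pi> 1 = \<one>\<^bsub>ring_of_class Quot I\<^esub>" using ring_hom_one[OF I.rcos_ring_hom] by simp
  have mult: "?\<pi> (a * b) = ?\<pi> a \<otimes>\<^bsub>ring_of_class Quot I\<^esub> ?\<pi> b" for a b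
    using ring_hom_mult[OF I.rcos_ring_hom, of a b] by simp
  have car: "?\<pi> a \<in> carrier (ring_of_class Quot I)" for a
    using ring_hom_closed[OF I.rcos_ring_hom, of a] by simp
  have "1 \<notin> ?P" using Q.one_imp_carrier Q.I_notcarr one by auto
  then show "prime_ideal ?P"
    unfolding prime_ideal_def using id Q.I_prime[OF car car] by (auto simp: mult)
  have "?\<pi> r = \<zero>\<^bsub>ring_of_class Quot I\<^esub>" if "r \<in> I" for r
  proof -
    have "?\<pi> r = ?\<pi> 0" using that by (simp add: coset_eq_iff is_ideal_addsub[OF I])
    then show ?thesis by (simp add: coset_eq FactRing_def)
  qed
  then show "I \<subseteq> ?P" using additive_subgroup.zero_closed[OF Q.additive_subgroup_axioms] by auto
qed

lemma coset_mem_image_iff: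
  fixes I P :: "'a::comm_ring_1 set"
  assumes "is_ideal I" "is_ideal P" "I \<subseteq> P"
  shows "I +>\<^bsub>ring_of_class\<^esub> r \<in> (+>\<^bsub>ring_of_class\<^esub>) I ` P \<longleftrightarrow> r \<in> P"
proof
  assume "I +>\<^bsub>ring_of_class\<^esub> r \<in> (+>\<^bsub>ring_of_class\<^esub>) I ` P"
  then obtain s where "s \<in> P" "I +>\<^bsub>ring_of_class\<^esub> r = I +>\<^bsub>ring_of_class\<^esub> s" by auto
  then have "r - s \<in> P" "s \<in> P" using assms(3) by (auto simp: coset_eq_iff is_ideal_addsub[OF assms(1)])
  then show "r \<in> P" using addsub_add[OF is_ideal_addsub[OF assms(2)], of "r - s" s] by simp
qed blast

lemma primeideal_quotient_image:
  fixes I P :: "'a::comm_ring_1 set"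
  assumes I: "is_ideal I" and P: "prime_ideal P" and IP: "I \<subseteq> P"
  shows "primeideal ((+>\<^bsub>ring_of_class\<^esub>) I ` P) (ring_of_class Quot I)"
proof -
  interpret I: ideal I "ring_of_class :: 'a ring" using I by (simp add: ideal_iff_is_ideal)
  let ?\<pi> = "(+>\<^bsub>ring_of_class\<^esub>) I"
  have idP: "is_ideal P" using P by (simp add: prime_ideal_def)
  note mem = coset_mem_image_iff[OF I idP IP]
  have car: "carrier (ring_of_class Quot I) = range ?\<pi>"
    by (auto simp: FactRing_def A_RCOSETS_def')
  show ?thesis
  proof (rule primeidealI)
    show "ideal (?\<pi> ` P) (ring_of_class Quot I)"
      by (rule ring.ring_ideal_imp_quot_ideal[OF ring_ring_of_class]) (simp_all add: ideal_iff_is_ideal I idP)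
    show "cring (ring_of_class Quot I)" by (rule I.quotient_is_cring[OF cring_ring_of_class])
    have "?\<pi> 1 \<notin> ?\<pi> ` P" using P by (simp add: mem prime_ideal_def)
    then show "carrier (ring_of_class Quot I) \<noteq> ?\<pi> ` P" unfolding car by blast
    fix x y assume "x \<in> carrier (ring_of_class Quot I)" "y \<in> carrier (ring_of_class Quot I)"
      and xy: "x \<otimes>\<^bsub>ring_of_class Quot I\<^esub> y \<in> ?\<pi> ` P"
    then obtain a b where ab: "x = ?\<pi> a" "y = ?\<pi> b" by (auto simp: car)
    have "?\<pi> (a * b) = x \<otimes>\<^bsub>ring_of_class Quot I\<^esub> y"
      using ring_hom_mult[OF I.rcos_ring_hom, of a b] by (simp add: ab)
    with xy have "?\<pi> (a * b) \<in> ?\<pi> ` P" by (simp only:)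
    then have "a * b \<in> P" by (simp only: mem)
    then show "x \<in> ?\<pi> ` P \<or> y \<in> ?\<pi> ` P" using P by (auto simp: ab mem prime_ideal_def)
  qed
qed

text \<open>Primes of the quotient ring correspond to primes containing \<open>I\<close>, strictly
  monotonically in both directions.\<close>

lemma krull_dim_quotient:
  fixes I :: "'a::comm_ring_1 set"
  assumes I: "is_ideal I"
  shows "krull_dim (ring_of_class Quot I) = Sup {enat k | k. chain_of_primes I k}"
proof -
  let ?\<pi> = "(+>\<^bsub>ring_of_class\<^esub>) I"
  have "(\<exists>P. (\<forall>i\<le>k. primeideal (P i) (ring_of_class Quot I)) \<and> (\<forall>i<k. P i \<subset> P (Suc i))) \<longleftrightarrow> chain_of_primes I k"
    (is "?L \<longleftrightarrow> ?R") for k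
  proof
    assume ?L
    then obtain P where P: "\<And>i. i \<le> k \<Longrightarrow> primeideal (P i) (ring_of_class Quot I)"
      "\<And>i. i < k \<Longrightarrow> P i \<subset> P (Suc i)" by blast
    let ?P = "\<lambda>i. {r. ?\<pi> r \<in> P i}"
    have "?P i \<subset> ?P (Suc i)" if i: "i < k" for i
    proof -
      obtain X where X: "X \<in> P (Suc i)" "X \<notin> P i" using P(2)[OF i] by blast
      have "ideal (P (Suc i)) (ring_of_class Quot I)" using P(1)[of "Suc i"] i by (simp add: primeideal.axioms(1))
      then have "X \<in> carrier (ring_of_class Quot I)" using X(1) ideal.Icarr by metis
      then obtain r where "X = ?\<pi> r" by (auto simp: FactRing_def A_RCOSETS_def')
      then show ?thesis using X P(2)[OF i] by blast
    qed
    then show ?R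
      unfolding chain_of_primes_def using prime_ideal_of_quotient[OF I P(1)]
      by (intro exI[of _ ?P]) blast
  next
    assume ?R
    then obtain P where P: "\<And>i. i \<le> k \<Longrightarrow> prime_ideal (P i)" "\<And>i. i \<le> k \<Longrightarrow> I \<subseteq> P i"
      "\<And>i. i < k \<Longrightarrow> P i \<subset> P (Suc i)" unfolding chain_of_primes_def by blast
    have id: "is_ideal (P i)" if "i \<le> k" for i using P(1)[OF that] by (simp add: prime_ideal_def)
    let ?P = "\<lambda>i. ?\<pi> ` P i"
    have "?P i \<subset> ?P (Suc i)" if i: "i < k" for i
    proof -
      obtain r where "r \<in> P (Suc i)" "r \<notin> P i" using P(3)[OF i] by blast
      then have "?\<pi> r \<in> ?P (Suc i)" "?\<pi> r \<notin> ?P i"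
        using coset_mem_image_iff[OF I id P(2)] i by auto
      moreover have "?P i \<subseteq> ?P (Suc i)" using P(3)[OF i] by blast
      ultimately show ?thesis by blast
    qed
    then show ?L
      using primeideal_quotient_image[OF I P(1,2)] by (intro exI[of _ ?P]) blast
  qed
  then show ?thesis by (simp add: krull_dim_def)
qed

lemma krull_dim_quotient_eq:
  fixes I :: "'a::comm_ring_1 set"
  assumes "is_ideal I" "chain_of_primes I d" "\<And>k. chain_of_primes I k \<Longrightarrow> k \<le> d"
  shows "krull_dim (ring_of_class Quot I) = enat d"
  unfolding krull_dim_quotient[OF assms(1)]
  by (rule antisym) (auto intro!: Sup_least Sup_upper assms(2) dest: assms(3))

text \<open>The zero ring has no primes; this settles the case \<open>C = 0\<close>.\<close>

lemma krull_dim_quotient_UNIV: "krull_dim (ring_of_class Quot (UNIV :: 'a::comm_ring_1 set)) = enat 0"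
proof -
  have "\<not> chain_of_primes (UNIV :: 'a set) k" for k
    by (auto simp: chain_of_primes_def prime_ideal_def)
  then show ?thesis
    using krull_dim_quotient[of "UNIV :: 'a set"]
    by (simp add: is_ideal_def addsub_def bot_enat_def zero_enat_def)
qed

section \<open>The annihilator of the cokernel\<close>

context frob_module
begin

text \<open>For \<open>H \<subseteq> L\<close> this is the annihilator of \<open>L/H\<close>, stated
  without cosets.\<close>

definition ann :: "'m set \<Rightarrow> 'm set \<Rightarrow> ('p, 'n) poly_ring set" where
  "ann H L = {r. \<forall>x\<in>L. scale (poly_to_alg r) x \<in> H}"

lemma is_ideal_ann:
  assumes "rsub scale H"
  shows "is_ideal (ann H L)"
  using addsub_zero[OF rsub_addsub[OF assms]] addsub_diff[OF rsub_addsub[OF assms]] rsub_scale[OF assms]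
  by (auto simp: is_ideal_def addsub_def ann_def poly_to_alg_diff scale_diff_left poly_to_alg_mult
      scale_scale[symmetric])

lemma annihilator_cokernel:
  "annihilator ring_of_class (cokernel_module scale) = ann (range (fsum scale)) UNIV"
proof -
  let ?H = "range (fsum scale)" and ?M = "restrict_to_poly scale"
  have H: "addsub ?H"
    unfolding addsub_def
  proof (intro conjI ballI)
    show "0 \<in> ?H" using fsum_zero by (metis rangeI)
    show "x - y \<in> ?H" if "x \<in> ?H" "y \<in> ?H" for x y
      using that by (auto simp: fsum_diff[symmetric])
  qed
  have cos: "?H +>\<^bsub>?M\<^esub> x = (\<lambda>h. h + x) ` ?H" for x
    by (auto simp: a_r_coset_def' restrict_to_poly_def)
  have cos0: "?H +>\<^bsub>?M\<^esub> x = ?H" if x: "x \<in> ?H" for x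
  proof -
    have "h \<in> (\<lambda>h. h + x) ` ?H" if "h \<in> ?H" for h
      using addsub_diff[OF H that x] by (intro image_eqI[of _ _ "h - x"]) auto
    then show ?thesis unfolding cos using addsub_add[OF H _ x] by blast
  qed
  have self: "x \<in> ?H +>\<^bsub>?M\<^esub> x" for x unfolding cos using addsub_zero[OF H] by force
  have coker: "cokernel_module scale = quotient_module ?M ?H"
    by (simp add: cokernel_module_def ext_module_def image_structure_map)
  have car: "carrier (quotient_module ?M ?H) = range (\<lambda>x. ?H +>\<^bsub>?M\<^esub> x)"
    by (auto simp: quotient_module_def A_RCOSETS_def' restrict_to_poly_def)
  have sm: "r \<odot>\<^bsub>quotient_module ?M ?H\<^esub> X = (\<Union>x\<in>X. ?H +>\<^bsub>?M\<^esub> scale (poly_to_alg r) x)" for r X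
    by (simp add: quotient_module_def restrict_to_poly_def)
  have z: "\<zero>\<^bsub>quotient_module ?M ?H\<^esub> = ?H" by (simp add: quotient_module_def)
  have "(\<forall>x. r \<odot>\<^bsub>quotient_module ?M ?H\<^esub> (?H +>\<^bsub>?M\<^esub> x) = ?H) \<longleftrightarrow> (\<forall>x. scale (poly_to_alg r) x \<in> ?H)" for r
  proof
    assume *: "\<forall>x. r \<odot>\<^bsub>quotient_module ?M ?H\<^esub> (?H +>\<^bsub>?M\<^esub> x) = ?H"
    show "\<forall>x. scale (poly_to_alg r) x \<in> ?H"
    proof
      fix x
      have "scale (poly_to_alg r) x \<in> r \<odot>\<^bsub>quotient_module ?M ?H\<^esub> (?H +>\<^bsub>?M\<^esub> x)"
        unfolding sm using self[of x] self[of "scale (poly_to_alg r) x"] by blast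
      then show "scale (poly_to_alg r) x \<in> ?H" using * by blast
    qed
  next
    assume *: "\<forall>x. scale (poly_to_alg r) x \<in> ?H"
    show "\<forall>x. r \<odot>\<^bsub>quotient_module ?M ?H\<^esub> (?H +>\<^bsub>?M\<^esub> x) = ?H"
    proof
      fix x
      have "(\<Union>y\<in>?H +>\<^bsub>?M\<^esub> x. ?H +>\<^bsub>?M\<^esub> scale (poly_to_alg r) y) = (\<Union>y\<in>?H +>\<^bsub>?M\<^esub> x. ?H)"
        by (rule SUP_cong[OF refl]) (use * cos0 in blast)
      then show "r \<odot>\<^bsub>quotient_module ?M ?H\<^esub> (?H +>\<^bsub>?M\<^esub> x) = ?H"
        unfolding sm using self[of x] by auto
    qed
  qed
  then show ?thesis
    unfolding annihilator_def ann_def coker car z by auto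
qed

end

text \<open>The smallest prime of the chain decides: what it contains, the others contain.\<close>

lemma chain_of_primes_split:
  assumes "\<And>P. prime_ideal P \<Longrightarrow> A \<subseteq> P \<Longrightarrow> B \<subseteq> P \<or> C \<subseteq> P" "chain_of_primes A k"
  shows "chain_of_primes B k \<or> chain_of_primes C k"
proof -
  obtain P where P: "\<And>i. i \<le> k \<Longrightarrow> prime_ideal (P i) \<and> A \<subseteq> P i" "\<And>i. i < k \<Longrightarrow> P i \<subset> P (Suc i)"
    using assms(2) unfolding chain_of_primes_def by blast
  have sub: "i \<le> k \<Longrightarrow> P 0 \<subseteq> P i" for i
  proof (induction i)
    case (Suc i)
    then show ?case using P(2)[of i] by auto
  qed simp
  have "B \<subseteq> P 0 \<or> C \<subseteq> P 0" using assms(1) P(1)[of 0] by simp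
  then show ?thesis
  proof
    assume "B \<subseteq> P 0"
    then have "\<forall>i\<le>k. prime_ideal (P i) \<and> B \<subseteq> P i" using P(1) sub by blast
    then show ?thesis unfolding chain_of_primes_def using P(2) by blast
  next
    assume "C \<subseteq> P 0"
    then have "\<forall>i\<le>k. prime_ideal (P i) \<and> C \<subseteq> P i" using P(1) sub by blast
    then show ?thesis unfolding chain_of_primes_def using P(2) by blast
  qed
qed

section \<open>Filtration of the cokernel, and finiteness of the graded components\<close>

context graded_frob_module
begin

lemma gsub_rspan: "gsub L \<Longrightarrow> (\<And>c. c \<in> set cs \<Longrightarrow> \<exists>e. c \<in> gr e) \<Longrightarrow> gsub (rspan scale L cs)"
proof (induction cs)
  case (Cons c cs)
  then obtain e where "c \<in> gr e" by force
  moreover have "gsub (rspan scale L cs)" using Cons by simp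
  ultimately have "gsub (rspan scale (rspan scale L cs) [c])" by (intro gsub_rspan_Cons)
  then show ?case by simp
qed simp

text \<open>The generators \<open>c\<^sub>j\<close> filter the cokernel with quotients \<open>R/I\<^sub>j\<close> (up to twists), where \<open>I\<^sub>j\<close> is the
  colon ideal of \<open>c\<^sub>j\<close> by the previous step. A prime contains the annihilator iff it contains one of
  the \<open>I\<^sub>j\<close>, because the product of the \<open>I\<^sub>j\<close> annihilates.\<close>

lemma rspan_dimension:
  assumes H: "gsub H" and fin: "\<And>i. finite (H \<inter> gr i)" and cs: "\<And>c. c \<in> set cs \<Longrightarrow> \<exists>e. c \<in> gr e"
  shows "(rspan scale H cs = H \<or>
    (\<exists>d F. positive_pole d F \<and> chain_of_primes (ann H (rspan scale H cs)) d \<and>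
      (\<forall>k. chain_of_primes (ann H (rspan scale H cs)) k \<longrightarrow> k \<le> d) \<and>
      (\<forall>i. fls_nth F i = rat_of_int (int (ldim CARD('p) (rspan scale H cs \<inter> gr i))
        - int (ldim CARD('p) (H \<inter> gr i))))))
    \<and> (\<forall>i. finite (rspan scale H cs \<inter> gr i))" (is "?P cs \<and> ?Q cs")
  using cs
proof (induction cs)
  case Nil
  show ?case using fin by simp
next
  case (Cons c cs)
  let ?L = "rspan scale H cs" and ?L' = "rspan scale H (c # cs)"
  have rH: "rsub scale H" using H by (simp add: gsub_def)
  have L': "?L' = rspan scale ?L [c]" by simp
  obtain e where e: "c \<in> gr e" using Cons.prems by force
  have cs: "\<And>c. c \<in> set cs \<Longrightarrow> \<exists>e. c \<in> gr e" using Cons.prems by simp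
  have gL: "gsub ?L" by (rule gsub_rspan[OF H cs])
  then have rL: "rsub scale ?L" by (simp add: gsub_def)
  have finL: "finite (?L \<inter> gr i)" for i using Cons.IH[OF cs] by blast
  have "?Q (c # cs)" unfolding L' using ldim_rspan_Cons(1)[OF gL e finL] by blast
  moreover have "?P (c # cs)"
  proof -
    define I where "I = colon ?L c"
    have hI: "hom_ideal I" unfolding I_def by (rule hom_ideal_colon[OF gL e])
    have dim: "int (ldim CARD('p) (?L' \<inter> gr i)) = int (ldim CARD('p) (?L \<inter> gr i)) + hilbert_fun {i - e} I" for i
      unfolding L' I_def by (rule ldim_rspan_Cons(2)[OF gL e finL])
    have cL': "c \<in> ?L'" by (rule subsetD[OF set_subset_rspan[OF rH]]) simp
    have "ann H ?L' \<subseteq> I"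
      using cL' subset_rspan[of H cs] unfolding ann_def I_def colon_def by blast
    note mono = chain_of_primes_mono[OF _ this]
    have "ann H ?L' \<subseteq> ann H ?L"
      using subset_rspan_Cons[of H cs c] unfolding ann_def by blast
    note mono = mono chain_of_primes_mono[OF _ this]
    \<comment> \<open>\<open>r\<close> moves \<open>?L'\<close> into \<open>?L\<close> and
      \<open>s\<close> moves \<open>?L\<close> into \<open>H\<close>, so \<open>s * r\<close>
      annihilates the quotient and lies in \<open>P\<close>.\<close>
    have split: "I \<subseteq> P \<or> ann H ?L \<subseteq> P" if P: "prime_ideal P" "ann H ?L' \<subseteq> P" for P
    proof (rule ccontr)
      assume "\<not> (I \<subseteq> P \<or> ann H ?L \<subseteq> P)"
      then obtain r s where rs: "r \<in> I" "r \<notin> P" "s \<in> ann H ?L" "s \<notin> P" by blast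
      have "scale (poly_to_alg (s * r)) x \<in> H" if x: "x \<in> ?L'" for x
      proof -
        obtain q u where qu: "x = scale (poly_to_alg q) c + u" "u \<in> ?L" using x by auto
        have "scale (poly_to_alg r) x = scale (poly_to_alg q) (scale (poly_to_alg r) c) + scale (poly_to_alg r) u"
          unfolding qu(1) scale_add_right scale_scale poly_to_alg_mult[symmetric] by (simp only: mult.commute)
        moreover have "scale (poly_to_alg r) c \<in> ?L" using rs(1) by (simp add: I_def colon_def)
        ultimately have "scale (poly_to_alg r) x \<in> ?L"
          using rsub_scale[OF rL] addsub_add[OF rsub_addsub[OF rL]] qu(2) by simp
        then have "scale (poly_to_alg s) (scale (poly_to_alg r) x) \<in> H" using rs(3) by (simp add: ann_def)
        then show ?thesis by (simp add: poly_to_alg_mult scale_scale)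
      qed
      then have "s * r \<in> P" using P(2) unfolding ann_def by blast
      then show False using P(1) rs by (auto simp: prime_ideal_def)
    qed
    have IH: "?P cs" using Cons.IH[OF cs] by blast
    show ?thesis
    proof (cases "1 \<in> I")
      case True
      then have "c \<in> ?L" by (simp add: I_def colon_def scale_one)
      then have "?L' = ?L"
        unfolding L' using rspan_subset[OF rL subset_refl, of "[c]"] subset_rspan[of ?L "[c]"] by simp
      then show ?thesis using IH by (simp only:)
    next
      case False
      obtain d1 where d1: "positive_pole d1 (hilbert_fls I)" "dimension_bound d1 I" "chain_of_primes I d1"
        using hom_ideal_dimension[OF hI False] by blast
      have aI: "addsub I" using hI by (simp add: hom_ideal_def is_ideal_def)
      have le1: "k \<le> d1" if "chain_of_primes I k" for k by (rule chain_of_primes_le[OF aI d1(2) that])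
      define F1 where "F1 = fls_shift (- e) (hilbert_fls I)"
      have F1: "positive_pole d1 F1" "\<And>i. fls_nth F1 i = rat_of_int (hilbert_fun {i - e} I)"
        by (simp_all add: F1_def positive_pole_shift d1 hilbert_fls_nth[OF aI])
      show ?thesis
      proof (cases "?L = H")
        case True
        \<comment> \<open>The quotient by \<open>H\<close> was zero so far. Its annihilator is all
          of R, so by \<open>split\<close> the chain lies above \<open>I\<close>.\<close>
        have "\<not> chain_of_primes (ann H ?L) k" for k
        proof -
          have "1 \<in> ann H ?L" unfolding True by (simp add: ann_def scale_one)
          then show ?thesis by (auto simp: chain_of_primes_def prime_ideal_def)
        qed
        then have "k \<le> d1" if "chain_of_primes (ann H ?L') k" for k
          using chain_of_primes_split[OF split that] le1 by blast
        moreover have "fls_nth F1 i = rat_of_int (int (ldim CARD('p) (?L' \<inter> gr i)) - int (ldim CARD('p) (H \<inter> gr i)))" for i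
          unfolding dim F1(2) True by simp
        ultimately show ?thesis using F1(1) mono(1)[OF d1(3)] by blast
      next
        case False
        then obtain d2 F2 where d2: "positive_pole d2 F2" "chain_of_primes (ann H ?L) d2"
          "\<And>k. chain_of_primes (ann H ?L) k \<Longrightarrow> k \<le> d2"
          "\<And>i. fls_nth F2 i = rat_of_int (int (ldim CARD('p) (?L \<inter> gr i)) - int (ldim CARD('p) (H \<inter> gr i)))"
          using IH by blast
        have "k \<le> max d1 d2" if "chain_of_primes (ann H ?L') k" for k
          using chain_of_primes_split[OF split that] le1[of k] d2(3)[of k] by auto
        moreover have "fls_nth (F1 + F2) i
            = rat_of_int (int (ldim CARD('p) (?L' \<inter> gr i)) - int (ldim CARD('p) (H \<inter> gr i)))" for i
          unfolding dim by (simp add: F1(2) d2(4))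
        moreover have "chain_of_primes (ann H ?L') (max d1 d2)"
          using mono(1)[OF d1(3)] mono(2)[OF d2(2)] by (simp add: max_def)
        ultimately show ?thesis using positive_pole_add[OF F1(1) d2(1)] by blast
      qed
    qed
  qed
  ultimately show ?case by blast
qed

text \<open>The homogeneous components of arbitrary generators serve. Generation over A takes the
  form of an induction principle, as both \<open>rspan_generators\<close> and
  \<open>gr_bounded_below\<close> apply it to a cleverly chosen \<open>S\<close>.\<close>

lemma homogeneous_generators:
  assumes "finitely_presented scale"
  obtains cs where "\<And>c. c \<in> set cs \<Longrightarrow> \<exists>e. c \<in> gr e"
    "\<And>S. addsub S \<Longrightarrow> (\<And>a x. x \<in> S \<Longrightarrow> scale a x \<in> S) \<Longrightarrow> set cs \<subseteq> S \<Longrightarrow> S = UNIV"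
proof -
  from assms obtain r :: nat and g :: "nat \<Rightarrow> 'm" where gen: "\<And>m. \<exists>c. m = (\<Sum>i<r. scale (c i) (g i))"
    unfolding finitely_presented_def by blast
  let ?G = "\<Union>i<r. lookup (dec (g i)) ` keys (dec (g i))"
  obtain cs where cs: "set cs = ?G" using finite_list[of ?G] by auto
  have "\<exists>e. c \<in> gr e" if "c \<in> set cs" for c using that dec(1) unfolding cs by blast
  moreover have "S = UNIV"
    if S: "addsub S" "\<And>a x. x \<in> S \<Longrightarrow> scale a x \<in> S" "set cs \<subseteq> S" for S
  proof -
    have "g i \<in> S" if "i < r" for i
      by (subst dec(2)) (use that S(3) in \<open>intro addsub_sum[OF S(1)]; auto simp: cs\<close>)
    then have "m \<in> S" for m using gen[of m] by (auto intro!: addsub_sum[OF S(1)] S(2))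
    then show ?thesis by blast
  qed
  ultimately show ?thesis using that by blast
qed

text \<open>The R-span of the generators together with the image of the structure morphism is
  A-stable: in the normal form of \<open>a\<close>, every summand other than the R-part sends all of
  N into that image.\<close>

lemma rspan_generators:
  assumes "\<And>S. addsub S \<Longrightarrow> (\<And>a x. x \<in> S \<Longrightarrow> scale a x \<in> S) \<Longrightarrow> set cs \<subseteq> S \<Longrightarrow> S = UNIV"
  shows "rspan scale (range (fsum scale)) cs = UNIV"
proof (rule assms)
  have H: "rsub scale (range (fsum scale))" using gsub_range_fsum by (simp add: gsub_def)
  note L = rsub_rspan[OF H, of cs]
  show "addsub (rspan scale (range (fsum scale)) cs)" by (rule rsub_addsub[OF L])
  show "set cs \<subseteq> rspan scale (range (fsum scale)) cs" by (rule set_subset_rspan[OF H])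
  fix a :: "('p, 'n) frob_alg" and x
  assume x: "x \<in> rspan scale (range (fsum scale)) cs"
  obtain r \<phi> where a: "keys \<phi> \<subseteq> exps_below CARD('p)" "a = poly_to_alg r + structure_map (*) \<phi>"
    by (rule alg_normal_form)
  have "structure_map (*) \<phi> = fsum (*) (lookup \<phi>)"
    by (rule frob_module.structure_map_eq_fsum[OF frob_module_regular a(1)])
  then have "scale (structure_map (*) \<phi>) x = fsum scale (\<lambda>v. scale (lookup \<phi> v) x)"
    by (simp add: fsum_def scale_sum_left scale_scale)
  then have "scale (structure_map (*) \<phi>) x \<in> rspan scale (range (fsum scale)) cs"
    using subset_rspan[of "range (fsum scale)" cs] by auto
  then show "scale a x \<in> rspan scale (range (fsum scale)) cs"
    unfolding a(2) scale_add_left by (intro addsub_add[OF rsub_addsub[OF L]] rsub_scale[OF L x])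
qed

text \<open>A has no negative degrees, so the elements without a part below the degrees of the
  generators form a submodule, which contains the generators.\<close>

lemma gr_bounded_below:
  assumes cs: "\<And>c. c \<in> set cs \<Longrightarrow> \<exists>e. c \<in> gr e"
    and gen: "\<And>S. addsub S \<Longrightarrow> (\<And>a x. x \<in> S \<Longrightarrow> scale a x \<in> S) \<Longrightarrow> set cs \<subseteq> S \<Longrightarrow> S = UNIV"
  shows "\<exists>k. \<forall>i<k. gr i = {0}"
proof -
  obtain e where e: "\<And>c. c \<in> set cs \<Longrightarrow> c \<in> gr (e c)" using cs by metis
  \<comment> \<open>Inserting 0 keeps the minimum defined when there are no generators; any lower
    bound for the degrees will do.\<close>
  define k where "k = Min (insert 0 (e ` set cs))"
  define S where "S = {m. part {..<k} m = 0}"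
  have S: "addsub S" by (auto simp: addsub_def S_def part_diff)
  have "scale a x \<in> S" if x: "x \<in> S" for a x
  proof -
    have "scale (alg_class b) x \<in> S" for b
    proof (induction b rule: poly_mapping_additive_induct)
      case zero
      show ?case using addsub_zero[OF S] by (simp add: alg_class_zero)
    next
      case (single w c)
      have deg: "alg_class (single w c) \<in> alg_deg (length (letters w))"
        unfolding alg_deg_def by (rule imageI) (auto split: if_splits)
      have "{i. i + int (length (letters w)) \<in> {..<k}} \<inter> {..<k} = {i. i + int (length (letters w)) \<in> {..<k}}"
        by auto
      then have "part {i. i + int (length (letters w)) \<in> {..<k}} x = 0"
        using part_part[of "{i. i + int (length (letters w)) \<in> {..<k}}" "{..<k}" x] x by (simp add: S_def)
      then have "part {..<k} (scale (alg_class (single w c)) x) = 0"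
        unfolding part_scale[OF deg] by (simp only: scale_zero_right)
      then show ?case by (simp add: S_def)
    next
      case (add a b)
      then show ?case using addsub_add[OF S] by (simp add: alg_class_add scale_add_left)
    qed
    then show ?thesis by (metis alg_class_rep)
  qed
  moreover have "set cs \<subseteq> S"
  proof
    fix c assume c: "c \<in> set cs"
    then have "k \<le> e c" by (simp add: k_def)
    then show "c \<in> S" using part_homogeneous[OF e[OF c], of "{..<k}"] by (simp add: S_def)
  qed
  ultimately have "S = UNIV" by (rule gen[OF S])
  then have "part {..<k} x = 0" for x by (auto simp: S_def)
  then have "gr i = {0}" if "i < k" for i
    using part_homogeneous[of _ i "{..<k}"] that gr_zero[of i] by auto
  then show ?thesis by blast
qed

text \<open>Induction on the degree: modulo the image of the structure morphism, N is finitely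
  generated over R, and the image in degree \<open>i\<close> involves only components of degree
  below \<open>i\<close>, since every \<open>\<epsilon>\<^sub>v\<close> has degree at least
  1.\<close>

lemma finite_gr:
  assumes cs: "\<And>c. c \<in> set cs \<Longrightarrow> \<exists>e. c \<in> gr e"
    and span: "rspan scale (range (fsum scale)) cs = UNIV"
    and k: "\<And>i. i < k \<Longrightarrow> gr i = {0}"
  shows "finite (gr i)" and "finite (range (fsum scale) \<inter> gr i)"
proof -
  have H: "finite (range (fsum scale) \<inter> gr i)"
    if "\<And>v :: 'n \<Rightarrow>\<^sub>0 nat. finite (gr (i - int (exp_deg v) - 1))" for i
    using ldim_ext_gr(1)[OF that] finite_imageI unfolding image_ext_gr[symmetric] by blast
  have all: "finite (gr i)" for i
  proof (induction "nat (i - k)" arbitrary: i rule: less_induct)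
    case less
    show ?case
    proof (cases "i < k")
      case False
      have IH: "finite (gr j)" if "j < i" for j
      proof (cases "j < k")
        case True
        then show ?thesis by (simp add: k)
      next
        case False
        then show ?thesis using that by (intro less) simp
      qed
      have "finite (range (fsum scale) \<inter> gr i)" by (rule H, rule IH) simp
      moreover have "gsub L \<Longrightarrow> finite (L \<inter> gr i) \<Longrightarrow> (\<And>c. c \<in> set cs \<Longrightarrow> \<exists>e. c \<in> gr e) \<Longrightarrow>
          finite (rspan scale L cs \<inter> gr i)" for L cs
      proof (induction cs)
        case (Cons c cs)
        obtain e where e: "c \<in> gr e" using Cons.prems(3) by force
        have "finite (rspan scale L cs \<inter> gr i)" "gsub (rspan scale L cs)"
          using Cons gsub_rspan by simp_all
        then have "finite (rspan scale (rspan scale L cs) [c] \<inter> gr i)" using ldim_rspan_Cons(1)[OF _ e] by blast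
        then show ?case by simp
      qed simp
      ultimately have "finite (rspan scale (range (fsum scale)) cs \<inter> gr i)"
        using gsub_range_fsum cs by blast
      then show ?thesis by (simp add: span)
    qed (simp add: k)
  qed
  show "finite (gr i)" by (rule all)
  show "finite (range (fsum scale) \<inter> gr i)" by (rule H, rule all)
qed

end

section \<open>The Hilbert series\<close>

lemma fls_nth_sum: "fls_nth (sum F A) i = (\<Sum>a\<in>A. fls_nth (F a) i)"
  by (induction A rule: infinite_finite_induct) simp_all

lemma fls_nth_laurent_eval: "fls_nth (laurent_eval a (fls_X :: rat fls)) i = of_int (lookup a i)"
proof (induction a rule: poly_mapping_additive_induct)
  case (single k c)
  have "laurent_eval (single k c) (fls_X :: rat fls) = fls_const (of_int c) * fls_X_intpow k"
    by (simp add: laurent_eval_single fls_of_int)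
  then show ?case by (simp add: lookup_single when_def)
qed (simp_all add: laurent_eval_add lookup_add)

text \<open>Expanding the power of the geometric sum shows that 1 - g is the generating function of
  the degrees |v| + 1 of the \<open>\<epsilon>\<^sub>v\<close>. Multiplying the Hilbert series of N
  by g thus subtracts that of \<open>\<F>\<^sub>A(N)\<close>.\<close>

lemma g_poly_eq:
  fixes t :: "'k::comm_ring_1"
  shows "g_poly p CARD('n) t = 1 - t * (\<Sum>v\<in>(exps_below p :: ('n::finite \<Rightarrow>\<^sub>0 nat) set). t ^ exp_deg v)"
proof -
  have "bij_betw lookup (exps_below p :: ('n \<Rightarrow>\<^sub>0 nat) set) (Pi\<^sub>E UNIV (\<lambda>_. {..<p}))"
  proof (rule bij_betwI[where g = "\<lambda>h. \<Sum>i\<in>UNIV. single i (h i)"])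
    have lk: "lookup (\<Sum>i\<in>UNIV. single i (h i)) = h" for h :: "'n \<Rightarrow> nat"
      by (simp add: fun_eq_iff lookup_sum lookup_single when_def)
    show "(\<lambda>h. \<Sum>i\<in>UNIV. single i (h i)) \<in> (Pi\<^sub>E UNIV (\<lambda>_. {..<p})) \<rightarrow> (exps_below p :: ('n \<Rightarrow>\<^sub>0 nat) set)"
      by (auto simp: exps_below_def lk)
    show "lookup (\<Sum>i\<in>UNIV. single i (h i)) = h" for h :: "'n \<Rightarrow> nat" by (rule lk)
    show "(\<Sum>i\<in>UNIV. single i (lookup v i)) = v" for v :: "'n \<Rightarrow>\<^sub>0 nat"
      by (rule poly_mapping_eqI) (simp add: lk)
  qed (auto simp: exps_below_def)
  from sum.reindex_bij_betw[OF this, of "\<lambda>h. \<Prod>i\<in>UNIV. t ^ h i"]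
  have "(\<Sum>v\<in>(exps_below p :: ('n \<Rightarrow>\<^sub>0 nat) set). t ^ exp_deg v)
      = (\<Sum>h\<in>Pi\<^sub>E UNIV (\<lambda>_ :: 'n. {..<p}). \<Prod>i\<in>UNIV. t ^ h i)"
    by (simp add: exp_deg_def power_sum)
  also have "\<dots> = (\<Prod>i\<in>(UNIV :: 'n set). \<Sum>k<p. t ^ k)"
    by (rule prod_sum_PiE[symmetric]) auto
  finally show ?thesis by (simp add: g_poly_def)
qed

lemma fls_nth_g_poly_mult:
  fixes F :: "rat fls"
  shows "fls_nth (g_poly p CARD('n) fls_X * F) i
    = fls_nth F i - (\<Sum>v\<in>(exps_below p :: ('n::finite \<Rightarrow>\<^sub>0 nat) set). fls_nth F (i - int (exp_deg v) - 1))"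
proof -
  have "g_poly p CARD('n) fls_X * F
      = F - (\<Sum>v\<in>(exps_below p :: ('n \<Rightarrow>\<^sub>0 nat) set). fls_X ^ (exp_deg v + 1) * F)"
    by (simp add: g_poly_eq left_diff_distrib sum_distrib_left sum_distrib_right)
  also have "\<dots> = F - (\<Sum>v\<in>(exps_below p :: ('n \<Rightarrow>\<^sub>0 nat) set). fls_shift (- int (exp_deg v + 1)) F)"
    by (simp only: fls_X_power_times_conv_shift)
  finally show ?thesis
    by (simp add: fls_nth_sum) (rule sum.cong, simp, rule arg_cong[of _ _ "fls_nth F"], simp)
qed

lemma g_poly_fls_X_nonzero: "g_poly p CARD('n::finite) (fls_X :: rat fls) \<noteq> 0"
proof
  assume "g_poly p CARD('n) (fls_X :: rat fls) = 0"
  then show False using fls_nth_g_poly_mult[of p 1 0, where 'n = 'n] by simp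
qed

text \<open>Coordinates with respect to a basis identify \<open>S\<close> with the functions from
  the basis to the ground field.\<close>

lemma (in frob_module) ldim_eq_dim:
  assumes S: "addsub S" "finite S" "\<And>c x. x \<in> S \<Longrightarrow> scale (alg_const c) x \<in> S"
  shows "vector_space.dim (const_scale scale) S = ldim CARD('p) S"
proof -
  interpret V: vector_space "const_scale scale" by (rule vector_space_const_scale)
  have sub: "V.subspace S"
    using S addsub_zero addsub_add by (auto intro!: V.subspaceI)
  obtain B where B: "B \<subseteq> S" "V.independent B" "S \<subseteq> V.span B" "card B = V.dim S"
    using V.basis_exists by blast
  have fB: "finite B" using B(1) S(2) finite_subset by blast
  have span: "V.span B = S" using V.span_minimal[OF B(1) sub] B(3) by blast
  let ?f = "\<lambda>u :: 'm \<Rightarrow> 'p mod_ring. \<Sum>v\<in>B. scale (alg_const (u v)) v"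
  let ?P = "Pi\<^sub>E B (\<lambda>_. UNIV :: 'p mod_ring set)"
  have "?f ` ?P = S"
  proof
    show "?f ` ?P \<subseteq> S" using B(1) S by (auto intro!: addsub_sum)
    show "S \<subseteq> ?f ` ?P"
    proof
      fix x assume "x \<in> S"
      then have "x \<in> range ?f" using V.span_finite[OF fB] span by simp
      then obtain u where "x = ?f u" by blast
      then have "x = ?f (restrict u B)" by simp
      then show "x \<in> ?f ` ?P" by (rule image_eqI[of x ?f "restrict u B"]) simp
    qed
  qed
  moreover have "inj_on ?f ?P"
  proof (rule inj_onI)
    fix u w assume uw: "u \<in> ?P" "w \<in> ?P" "?f u = ?f w"
    have "alg_const (c - c') = alg_const c - (alg_const c' :: ('p, 'n) frob_alg)" for c c'
      by (simp add: eq_diff_eq flip: alg_const_add)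
    then have "?f (\<lambda>v. u v - w v) = 0"
      using uw(3) by (simp add: scale_diff_left sum_subtractf)
    then have "u v - w v = 0" if "v \<in> B" for v
      using V.independentD[OF B(2) fB subset_refl _ that, of "\<lambda>v. u v - w v"] by simp
    then show "u = w" using uw(1,2) by (intro PiE_ext[of u B _ w]) auto
  qed
  ultimately have "card S = card ?P" using card_image[of ?f ?P] by simp
  also have "\<dots> = CARD('p) ^ card B" by (simp add: card_PiE fB)
  finally have "ldim CARD('p) S = V.dim S" unfolding B(4) by (rule ldim_card_power[OF prime_card])
  then show ?thesis by (rule sym)
qed

context graded_frob_module
begin

text \<open>Nonzero homogeneous elements of different degrees are distinct, so a finite kernel meets
  only finitely many degrees.\<close>

lemma finite_kernel_support:
  assumes "finitely_presented scale"
  shows "finite {i. ldim CARD('p) {\<phi> \<in> ext_gr i. structure_map scale \<phi> = 0} \<noteq> 0}" (is "finite ?I")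
proof -
  let ?K = "{\<phi>. keys \<phi> \<subseteq> exps_below CARD('p) \<and> structure_map scale \<phi> = 0}"
  have "\<exists>\<phi>. \<phi> \<in> ext_gr i \<and> structure_map scale \<phi> = 0 \<and> \<phi> \<noteq> 0" if i: "i \<in> ?I" for i
  proof (rule ccontr)
    assume "\<not> ?thesis"
    moreover have "0 \<in> ext_gr i" by (rule addsub_zero[OF addsub_ext_gr])
    ultimately have "{\<phi> \<in> ext_gr i. structure_map scale \<phi> = 0} = {0}" by auto
    then show False using i by (simp add: ldim_singleton)
  qed
  then have "\<forall>i\<in>?I. \<exists>\<phi>. \<phi> \<in> ext_gr i \<and> structure_map scale \<phi> = 0 \<and> \<phi> \<noteq> 0" by blast
  from bchoice[OF this] obtain \<phi>
    where \<phi>: "\<And>i. i \<in> ?I \<Longrightarrow> \<phi> i \<in> ext_gr i \<and> structure_map scale (\<phi> i) = 0 \<and> \<phi> i \<noteq> 0"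
    by fast
  have "inj_on \<phi> ?I"
  proof (rule inj_onI)
    fix i j assume ij: "i \<in> ?I" "j \<in> ?I" "\<phi> i = \<phi> j"
    obtain v where v: "v \<in> keys (\<phi> i)" using \<phi>[OF ij(1)] by (metis all_not_in_conv keys_eq_empty)
    then have vE: "v \<in> exps_below CARD('p)" using \<phi>[OF ij(1)] by (auto simp: ext_gr_def)
    let ?x = "lookup (\<phi> i) v"
    have "?x \<in> gr (i - int (exp_deg v) - 1)" "?x \<in> gr (j - int (exp_deg v) - 1)"
      using \<phi>[OF ij(1)] \<phi>[OF ij(2)] vE unfolding ij(3) ext_gr_def by blast+
    moreover have "?x \<noteq> 0" using v by (simp add: in_keys_iff)
    ultimately have "i - int (exp_deg v) - 1 = j - int (exp_deg v) - 1"
      using part_homogeneous[of ?x _ "{i - int (exp_deg v) - 1}"] by (metis singletonD singletonI)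
    then show "i = j" by simp
  qed
  moreover have "\<phi> ` ?I \<subseteq> ?K" using \<phi> by (auto simp: ext_gr_def)
  ultimately show ?thesis
    using finite_kernel_structure_map[OF assms] finite_imageD finite_subset by blast
qed

text \<open>The count of \<open>0 \<rightarrow> K \<rightarrow> \<F>\<^sub>A(N) \<rightarrow> N
  \<rightarrow> C \<rightarrow> 0\<close> in each degree, with \<open>b\<close> the Hilbert series
  of K. The difference of dimensions is that of C, and \<open>F\<close> in the third claim is the
  Hilbert series of C.\<close>

lemma hilbert_series_cokernel:
  assumes "finitely_presented scale"
  shows "has_hilbert_series scale gr"
    and "\<exists>b. \<forall>i. fls_nth (g_poly CARD('p) CARD('n) fls_X * hilbert_series scale gr) i
      = rat_of_int (int (ldim CARD('p) (gr i)) - int (ldim CARD('p) (range (fsum scale) \<inter> gr i)))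
        - fls_nth (laurent_eval b fls_X) i"
    and "range (fsum scale) = UNIV \<or>
    (\<exists>d F. positive_pole d F \<and> chain_of_primes (ann (range (fsum scale)) UNIV) d \<and>
      (\<forall>k. chain_of_primes (ann (range (fsum scale)) UNIV) k \<longrightarrow> k \<le> d) \<and>
      (\<forall>i. fls_nth F i = rat_of_int (int (ldim CARD('p) (gr i))
        - int (ldim CARD('p) (range (fsum scale) \<inter> gr i)))))"
proof -
  let ?H = "range (fsum scale)"
  obtain cs where cs: "\<And>c. c \<in> set cs \<Longrightarrow> \<exists>e. c \<in> gr e"
    and gen: "\<And>S. addsub S \<Longrightarrow> (\<And>a x. x \<in> S \<Longrightarrow> scale a x \<in> S) \<Longrightarrow> set cs \<subseteq> S \<Longrightarrow> S = UNIV"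
    using homogeneous_generators[OF assms] by blast
  have span: "rspan scale ?H cs = UNIV" by (rule rspan_generators[OF gen])
  obtain k where k: "\<And>i. i < k \<Longrightarrow> gr i = {0}" using gr_bounded_below[OF cs gen] by blast
  have fin: "finite (gr i)" "finite (?H \<inter> gr i)" for i
    using finite_gr[of cs k i] cs span k by blast+
  interpret V: vector_space "const_scale scale" by (rule vector_space_const_scale)
  show hs: "has_hilbert_series scale gr"
    unfolding has_hilbert_series_def
  proof (intro conjI allI)
    show "\<exists>B. finite B \<and> gr i \<subseteq> V.span B" for i
      by (intro exI[of _ "gr i"] conjI fin(1) V.span_superset)
    show "\<exists>k. \<forall>i<k. gr i = {0}" using k by blast
  qed
  have nth: "fls_nth (hilbert_series scale gr) i = of_nat (ldim CARD('p) (gr i))" for i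
  proof -
    have "scale (alg_const c) x \<in> gr i" if "x \<in> gr i" for c x
      using gr_scale[OF alg_const_deg that, of c] by simp
    then show ?thesis
      unfolding hilbert_series_nth[OF hs] by (simp add: ldim_eq_dim[OF addsub_gr fin(1)])
  qed
  let ?k = "\<lambda>i. ldim CARD('p) {\<phi> \<in> ext_gr i. structure_map scale \<phi> = 0}"
  define b where "b = Abs_poly_mapping (\<lambda>i. int (?k i))"
  have b: "lookup b i = int (?k i)" for i
    unfolding b_def using finite_kernel_support[OF assms] by (subst lookup_Abs_poly_mapping) simp_all
  have "fls_nth (g_poly CARD('p) CARD('n) fls_X * hilbert_series scale gr) i
      = rat_of_int (int (ldim CARD('p) (gr i)) - int (ldim CARD('p) (?H \<inter> gr i)))
        - fls_nth (laurent_eval b fls_X) i" for i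
  proof -
    have "finite (ext_gr i)" by (rule ldim_ext_gr(1)[OF fin(1)])
    then have "(\<Sum>v\<in>exps_below CARD('p). ldim CARD('p) (gr (i - int (exp_deg (v :: 'n \<Rightarrow>\<^sub>0 nat)) - 1)))
        = ldim CARD('p) (?H \<inter> gr i) + ?k i"
      using ldim_kernel[of i] ldim_ext_gr(2)[where i = i, OF fin(1)] by simp
    then have "(\<Sum>v\<in>(exps_below CARD('p) :: ('n \<Rightarrow>\<^sub>0 nat) set). rat_of_nat (ldim CARD('p) (gr (i - int (exp_deg v) - 1))))
        = of_nat (ldim CARD('p) (?H \<inter> gr i)) + of_nat (?k i)"
      by (simp flip: of_nat_sum)
    then show ?thesis
      unfolding fls_nth_g_poly_mult fls_nth_laurent_eval by (simp add: nth b)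
  qed
  then show "\<exists>b. \<forall>i. fls_nth (g_poly CARD('p) CARD('n) fls_X * hilbert_series scale gr) i
      = rat_of_int (int (ldim CARD('p) (gr i)) - int (ldim CARD('p) (?H \<inter> gr i)))
        - fls_nth (laurent_eval b fls_X) i" by blast
  have "UNIV = ?H \<or>
    (\<exists>d F. positive_pole d F \<and> chain_of_primes (ann ?H UNIV) d \<and>
      (\<forall>k. chain_of_primes (ann ?H UNIV) k \<longrightarrow> k \<le> d) \<and>
      (\<forall>i. fls_nth F i = rat_of_int (int (ldim CARD('p) (gr i)) - int (ldim CARD('p) (?H \<inter> gr i)))))"
    by (rule rspan_dimension[of ?H cs, OF gsub_range_fsum fin(2), THEN conjunct1, unfolded span Int_UNIV_left])
       (rule cs)
  then show "?H = UNIV \<or>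
    (\<exists>d F. positive_pole d F \<and> chain_of_primes (ann ?H UNIV) d \<and>
      (\<forall>k. chain_of_primes (ann ?H UNIV) k \<longrightarrow> k \<le> d) \<and>
      (\<forall>i. fls_nth F i = rat_of_int (int (ldim CARD('p) (gr i)) - int (ldim CARD('p) (?H \<inter> gr i)))))"
    by (elim disjE) (rule disjI1, erule sym, erule disjI2)
qed

end

theorem theorem4p20:
  fixes scale :: "('p::prime_card, 'n::finite) frob_alg \<Rightarrow> 'm::ab_group_add \<Rightarrow> 'm"
    and gr :: "int \<Rightarrow> 'm set"
  assumes "graded_frob_module scale gr"
    and "finitely_presented scale"
  shows "has_hilbert_series scale gr \<and>
    (\<exists>(d::nat) (a :: int \<Rightarrow>\<^sub>0 int).
       module_krull_dim (ring_of_class :: ('p, 'n) poly_ring ring) (cokernel_module scale) = enat d \<and>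
       d \<le> CARD('n) \<and>
       hilbert_series scale gr =
         laurent_eval a fls_X / ((1 - fls_X) ^ d * g_poly CARD('p) CARD('n) fls_X) \<and>
       (d > 0 \<longrightarrow> laurent_eval a (1::rat) > 0))"
proof -
  interpret N: graded_frob_module scale gr by (rule assms(1))
  let ?H = "range (fsum scale)" and ?g = "g_poly CARD('p) CARD('n) (fls_X :: rat fls)"
    and ?HS = "hilbert_series scale gr"
  note hs = N.hilbert_series_cokernel[OF assms(2)]
  obtain b where b: "\<And>i. fls_nth (?g * ?HS) i
      = rat_of_int (int (ldim CARD('p) (gr i)) - int (ldim CARD('p) (?H \<inter> gr i)))
        - fls_nth (laurent_eval b fls_X) i" using hs(2) by blast
  have kd: "module_krull_dim ring_of_class (cokernel_module scale) = krull_dim (ring_of_class Quot N.ann ?H UNIV)"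
    by (simp add: module_krull_dim_def N.annihilator_cokernel)
  have rH: "rsub scale ?H" using N.gsub_range_fsum by (simp add: N.gsub_def)
  have id: "is_ideal (N.ann ?H UNIV)" by (rule N.is_ideal_ann[OF rH])
  have div: "?HS = laurent_eval a fls_X / ((1 - fls_X) ^ d * ?g)"
    if "?g * ?HS * (1 - fls_X) ^ d = laurent_eval a fls_X" for a d
  proof -
    have "(1 - fls_X :: rat fls) \<noteq> 0"
      by (metis eq_iff_diff_eq_0 fls_X_nth(1) fls_one_nth zero_neq_one)
    then have "(1 - fls_X) ^ d * ?g \<noteq> 0" using g_poly_fls_X_nonzero by simp
    then show ?thesis using that by (simp add: field_simps)
  qed
  from hs(3) show ?thesis
  proof (elim disjE exE conjE)
    \<comment> \<open>Here \<open>C = 0\<close>, so the dimension is 0 by convention and only K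
      contributes to the numerator.\<close>
    assume H: "?H = UNIV"
    then have "N.ann ?H UNIV = UNIV" by (simp add: N.ann_def)
    then have "module_krull_dim (ring_of_class :: ('p, 'n) poly_ring ring) (cokernel_module scale) = enat 0"
      unfolding kd by (simp add: krull_dim_quotient_UNIV)
    moreover have "?g * ?HS = laurent_eval (- b) fls_X"
      by (rule fls_eqI) (simp add: b H laurent_eval_uminus)
    then have "?HS = laurent_eval (- b) fls_X / ((1 - fls_X) ^ 0 * ?g)" by (intro div) simp
    ultimately show ?thesis using hs(1) by blast
  next
    fix d F
    assume F: "positive_pole d F" "chain_of_primes (N.ann ?H UNIV) d"
      "\<forall>k. chain_of_primes (N.ann ?H UNIV) k \<longrightarrow> k \<le> d"
      "\<forall>i. fls_nth F i = rat_of_int (int (ldim CARD('p) (gr i)) - int (ldim CARD('p) (?H \<inter> gr i)))"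
    have "module_krull_dim (ring_of_class :: ('p, 'n) poly_ring ring) (cokernel_module scale) = enat d"
      unfolding kd using F(2,3) by (intro krull_dim_quotient_eq id) auto
    moreover have "d \<le> CARD('n)"
      by (rule chain_of_primes_le_vars[OF F(2)]) (rule addsub_zero[OF is_ideal_addsub[OF id]])
    moreover obtain c where c: "F * (1 - fls_X) ^ d = laurent_eval c fls_X" "laurent_eval c (1 :: rat) > 0"
      using F(1) by (auto simp: positive_pole_def laurent_pole_def)
    \<comment> \<open>\<open>?q\<close> is (1 - t)^d as a Laurent polynomial; it brings the kernel
      term over the common denominator.\<close>
    let ?q = "(1 - single 1 1) ^ d :: int \<Rightarrow>\<^sub>0 int"
    have "?g * ?HS = F - laurent_eval b fls_X"
      by (rule fls_eqI) (use F(4) in \<open>simp add: b\<close>)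
    then have "?g * ?HS * (1 - fls_X) ^ d = laurent_eval (c - b * ?q) fls_X"
      by (simp add: left_diff_distrib c(1) laurent_eval_diff laurent_eval_mult laurent_eval_power
          laurent_eval_single)
    then have "?HS = laurent_eval (c - b * ?q) fls_X / ((1 - fls_X) ^ d * ?g)" by (rule div)
    moreover have "laurent_eval (c - b * ?q) (1 :: rat) > 0" if "d > 0"
      using c(2) that
      by (simp add: laurent_eval_diff laurent_eval_mult laurent_eval_power laurent_eval_single zero_power)
    ultimately show ?thesis using hs(1) by blast
  qed
qed

end
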